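(* Let $K\subset S^3$ be a nontrivial knot with property (D). Then for every rational slope $\frac pq\ge 2g(K)-1$, the fundamental group of the $3$-manifold obtained by Dehn surgery on $K$ with slope $\frac pq$ is not left orderable.
   Context: $g(K)$ denotes the Seifert genus. Slopes are with respect to the standard meridian $\mu$ and preferred longitude $\lambda$ of $K$: surgery with slope $\frac pq$ has fundamental group $\pi_1(S^3\setminus K)/\langle\langle\mu^p\lambda^q\rangle\rangle$. A nontrivial group $G$ is left orderable if it admits a total order $\le$ such that $g\le h$ implies $fg\le fh$ for all $f,g,h\in G$; the trivial group is by convention not left orderable. Root-closed, conjugacy-closed submonoid: for a subset $S$ of a group $G$, the root-closed, conjugacy-closed submonoid of $G$ generated by $S$ is the smallest subset $M\subseteq G$ containing $S$ and the identity such that: if $f,g\in M$ then $fg\in M$; if $f\in M$ and $g\in G$ then $gfg^{-1}\in M$; if $n$ is a positive integer and $f\in G$ satisfies $f^n\in M$, then $f\in M$. Property (D): let $K\subset S^3$ be a nontrivial knot, and let $\mu,\lambda\in\pi_1(S^3\setminus K)$ represent a meridian and the corresponding (preferred) longitude. $K$ has property (D) if (a) for every homomorphism $\rho:\pi_1(S^3\setminus K)\to\mathrm{Homeo}_+(\mathbf{R})$ (orientation-preserving homeomorphisms of the line), if $s\in\mathbf{R}$ is a common fixed point of $\rho(\mu)$ and $\rho(\lambda)$, then $s$ is fixed by $\rho(g)$ for every $g\in\pi_1(S^3\setminus K)$; and (b) $\mu$ lies in the root-closed, conjugacy-closed submonoid of $\pi_1(S^3\setminus K)$ generated by $\mu^{2g(K)-1}\lambda$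 and $\mu^{-1}$. *)

theory Defs
  imports "HOL-Analysis.Analysis" "HOL-Homology.Homology"
begin

section \<open>Groups\<close>

definition left_orderable :: "('a, 'b) monoid_scheme \<Rightarrow> bool" where
  "left_orderable G \<longleftrightarrow>
     carrier G \<noteq> {\<one>\<^bsub>G\<^esub>} \<and>
     (\<exists>r. linear_order_on (carrier G) r \<and>
          (\<forall>f\<in>carrier G. \<forall>g\<in>carrier G. \<forall>h\<in>carrier G.
             (g, h) \<in> r \<longrightarrow> (f \<otimes>\<^bsub>G\<^esub> g, f \<otimes>\<^bsub>G\<^esub> h) \<in> r))"

inductive_set root_conj_closed_submonoid :: "('a, 'b) monoid_scheme \<Rightarrow> 'a set \<Rightarrow> 'a set"
  for G :: "('a, 'b) monoid_scheme" (structure) and S :: "'a set" where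
  one: "\<one> \<in> root_conj_closed_submonoid G S"
| gen: "s \<in> S \<Longrightarrow> s \<in> root_conj_closed_submonoid G S"
| mult: "\<lbrakk>f \<in> root_conj_closed_submonoid G S; g \<in> root_conj_closed_submonoid G S\<rbrakk>
         \<Longrightarrow> f \<otimes> g \<in> root_conj_closed_submonoid G S"
| conj: "\<lbrakk>f \<in> root_conj_closed_submonoid G S; g \<in> carrier G\<rbrakk>
         \<Longrightarrow> g \<otimes> f \<otimes> inv g \<in> root_conj_closed_submonoid G S"
| root: "\<lbrakk>f \<in> carrier G; 0 < n; f [^] (n::nat) \<in> root_conj_closed_submonoid G S\<rbrakk>
         \<Longrightarrow> f \<in> root_conj_closed_submonoid G S"

definition Homeo_plus :: "(real \<Rightarrow> real) monoid" where
  "Homeo_plus =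
     \<lparr>carrier = {f. (\<exists>g. homeomorphism UNIV UNIV f g) \<and> strict_mono f},
      mult = (\<circ>), one = id\<rparr>"

section \<open>The fundamental group\<close>

text \<open>The library's \<open>joinpaths\<close> needs a topological type class; here spaces
  are values of type \<open>'a topology\<close>.\<close>

definition loop_join :: "(real \<Rightarrow> 'a) \<Rightarrow> (real \<Rightarrow> 'a) \<Rightarrow> real \<Rightarrow> 'a" where
  "loop_join p q = (\<lambda>t. if t \<le> 1/2 then p (2 * t) else q (2 * t - 1))"

definition loops :: "'a topology \<Rightarrow> 'a \<Rightarrow> (real \<Rightarrow> 'a) set" where
  "loops X x = {p. pathin X p \<and> p 0 = x \<and> p 1 = x}"

definition loop_class :: "'a topology \<Rightarrow> 'a \<Rightarrow> (real \<Rightarrow> 'a) \<Rightarrow> (real \<Rightarrow> 'a) set" where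
  "loop_class X x p =
     {q \<in> loops X x. homotopic_with (\<lambda>r. r 0 = x \<and> r 1 = x) (top_of_set {0..1}) X p q}"

definition fundamental_group :: "'a topology \<Rightarrow> 'a \<Rightarrow> (real \<Rightarrow> 'a) set monoid" where
  "fundamental_group X x =
     \<lparr>carrier = loop_class X x ` loops X x,
      mult = (\<lambda>A B. \<Union>p\<in>A. \<Union>q\<in>B. loop_class X x (loop_join p q)),
      one = loop_class X x (\<lambda>_. x)\<rparr>"

section \<open>Smooth knots in the 3-sphere\<close>

abbreviation S3 :: "(real^4) set" where "S3 \<equiv> sphere 0 1"

abbreviation circle :: "complex set" where "circle \<equiv> sphere 0 1"

text \<open>Continuous differentiability of order \<open>k\<close> on an open set, through directional derivatives.\<close>

primrec Ck_on :: "nat \<Rightarrow> 'a::euclidean_space set \<Rightarrow> ('a \<Rightarrow> 'b::euclidean_space) \<Rightarrow> bool" where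
  "Ck_on 0 U f \<longleftrightarrow> continuous_on U f"
| "Ck_on (Suc k) U f \<longleftrightarrow>
     (\<exists>f'. (\<forall>x\<in>U. (f has_derivative f' x) (at x)) \<and> (\<forall>v. Ck_on k U (\<lambda>x. f' x v)))"

definition smooth_on :: "'a::euclidean_space set \<Rightarrow> ('a \<Rightarrow> 'b::euclidean_space) \<Rightarrow> bool" where
  "smooth_on U f \<longleftrightarrow> (\<forall>k. Ck_on k U f)"

definition knot :: "(real^4) set \<Rightarrow> bool" where
  "knot K \<longleftrightarrow>
     K \<subseteq> S3 \<and>
     (\<exists>f :: complex \<Rightarrow> real^4.
        smooth_on UNIV (\<lambda>t. f (cis t)) \<and>
        (\<forall>t. vector_derivative (\<lambda>t. f (cis t)) (at t) \<noteq> 0) \<and>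
        inj_on f circle \<and> f ` circle = K)"

definition ambient_isotopic :: "(real^4) set \<Rightarrow> (real^4) set \<Rightarrow> bool" where
  "ambient_isotopic K L \<longleftrightarrow>
     (\<exists>H :: real \<times> (real^4) \<Rightarrow> real^4.
        continuous_on ({0..1} \<times> S3) H \<and>
        (\<forall>t\<in>{0..1}. \<exists>g. homeomorphism S3 S3 (\<lambda>x. H (t, x)) g) \<and>
        (\<forall>x\<in>S3. H (0, x) = x) \<and>
        (\<lambda>x. H (1, x)) ` K = L)"

definition trivial_knot :: "(real^4) set \<Rightarrow> bool" where
  "trivial_knot K \<longleftrightarrow> ambient_isotopic K {x \<in> S3. x $ 3 = 0 \<and> x $ 4 = 0}"

section \<open>Seifert genus\<close>

definition surface_with_boundary :: "(real^4) set \<Rightarrow> (real^4) set \<Rightarrow> bool" where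
  "surface_with_boundary F B \<longleftrightarrow>
     (\<forall>x \<in> F - B. \<exists>U. openin (top_of_set F) U \<and> x \<in> U \<and> U homeomorphic ball (0::complex) 1) \<and>
     (\<forall>x \<in> B. \<exists>U \<phi> \<psi>. openin (top_of_set F) U \<and> x \<in> U \<and>
        homeomorphism U {z \<in> ball (0::complex) 1. 0 \<le> Im z} \<phi> \<psi> \<and>
        \<phi> ` (U \<inter> B) = {z \<in> ball 0 1. Im z = 0})"

text \<open>A bicollar of a compact surface in the (orientable) 3-sphere exists exactly when the
  surface is tamely embedded and orientable, so it stands for orientability and for the exclusion
  of wild surfaces at once.\<close>

definition bicollared :: "(real^4) set \<Rightarrow> bool" where
  "bicollared F \<longleftrightarrow>
     (\<exists>b :: (real^4) \<times> real \<Rightarrow> real^4.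
        continuous_on (F \<times> {-1..1}) b \<and> inj_on b (F \<times> {-1..1}) \<and>
        b ` (F \<times> {-1..1}) \<subseteq> S3 \<and> (\<forall>x\<in>F. b (x, 0) = x))"

definition seifert_surface :: "(real^4) set \<Rightarrow> (real^4) set \<Rightarrow> bool" where
  "seifert_surface K F \<longleftrightarrow>
     F \<subseteq> S3 \<and> compact F \<and> connected F \<and> surface_with_boundary F K \<and> bicollared F"

text \<open>A compact connected orientable surface with one boundary circle has Euler
  characteristic \<open>1 - 2 * g\<close>, i.e. its first homology is free abelian of rank \<open>2 * g\<close>.\<close>

definition surface_genus :: "(real^4) set \<Rightarrow> nat \<Rightarrow> bool" where
  "surface_genus F g \<longleftrightarrow>
     homology_group 1 (top_of_set F) \<cong> free_Abelian_group {..<2 * g}"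

definition seifert_genus :: "(real^4) set \<Rightarrow> nat" where
  "seifert_genus K = (LEAST g. \<exists>F. seifert_surface K F \<and> surface_genus F g)"

section \<open>Meridian and preferred longitude\<close>

text \<open>A smooth embedding of \<open>circle \<times> ball 0 2\<close> with core \<open>K\<close>; the tubular neighbourhood proper
  is the image of \<open>circle \<times> cball 0 1\<close>. The sign of the determinant says that the embedding
  preserves orientation, the sphere being oriented as the boundary of the unit ball (outward
  normal first). Thus the meridian has linking number 1 with \<open>K\<close> oriented by the parameter
  on \<open>circle\<close>.\<close>

definition tubular_nbhd :: "(real^4) set \<Rightarrow> (complex \<times> complex \<Rightarrow> real^4) \<Rightarrow> bool" where
  "tubular_nbhd K N \<longleftrightarrow>
     (let P = (\<lambda>(t :: real, z :: complex). N (cis t, z)) in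
        smooth_on (UNIV \<times> ball 0 2) P \<and>
        (\<forall>t. \<forall>z \<in> ball 0 2. let D = frechet_derivative P (at (t, z)) in
           0 < det (vector [P (t, z), D (1, 0), D (0, 1), D (0, \<i>)] :: real^4^4))) \<and>
     inj_on N (circle \<times> ball 0 2) \<and>
     N ` (circle \<times> ball 0 2) \<subseteq> S3 \<and>
     (\<lambda>u. N (u, 0)) ` circle = K"

text \<open>The parallel copy of the core at \<open>z = 1\<close> is the preferred longitude if it is
  null-homologous in the complement of the knot.\<close>

definition preferred_nbhd :: "(real^4) set \<Rightarrow> (complex \<times> complex \<Rightarrow> real^4) \<Rightarrow> bool" where
  "preferred_nbhd K N \<longleftrightarrow>
     tubular_nbhd K N \<and>
     (\<forall>c \<in> carrier (homology_group 1 (top_of_set circle)).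
        hom_induced 1 (top_of_set circle) {} (top_of_set (S3 - K)) {} (\<lambda>u. N (u, 1)) c
        = \<one>\<^bsub>homology_group 1 (top_of_set (S3 - K))\<^esub>)"

definition knot_group ::
  "(real^4) set \<Rightarrow> (complex \<times> complex \<Rightarrow> real^4) \<Rightarrow> (real \<Rightarrow> real^4) set monoid" where
  "knot_group K N = fundamental_group (top_of_set (S3 - K)) (N (1, 1))"

definition meridian ::
  "(real^4) set \<Rightarrow> (complex \<times> complex \<Rightarrow> real^4) \<Rightarrow> (real \<Rightarrow> real^4) set" where
  "meridian K N = loop_class (top_of_set (S3 - K)) (N (1, 1)) (\<lambda>t. N (1, cis (2 * pi * t)))"

definition longitude ::
  "(real^4) set \<Rightarrow> (complex \<times> complex \<Rightarrow> real^4) \<Rightarrow> (real \<Rightarrow> real^4) set" where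
  "longitude K N = loop_class (top_of_set (S3 - K)) (N (1, 1)) (\<lambda>t. N (cis (2 * pi * t), 1))"

text \<open>Up to conjugation and simultaneous inversion, the pair of meridian and longitude does not
  depend on the choice of \<open>N\<close>, and both conditions below are invariant under these operations.\<close>

definition property_D :: "(real^4) set \<Rightarrow> bool" where
  "property_D K \<longleftrightarrow>
     (\<forall>N. preferred_nbhd K N \<longrightarrow>
        (let G = knot_group K N; m = meridian K N; l = longitude K N in
           (\<forall>\<rho> \<in> hom G Homeo_plus. \<forall>s. \<rho> m s = s \<and> \<rho> l s = s \<longrightarrow>
              (\<forall>g \<in> carrier G. \<rho> g s = s)) \<and>
           m \<in> root_conj_closed_submonoid G
                 {m [^]\<^bsub>G\<^esub> (2 * int (seifert_genus K) - 1) \<otimes>\<^bsub>G\<^esub> l, inv\<^bsub>G\<^esub> m}))"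

section \<open>Dehn surgery\<close>

definition knot_exterior :: "(complex \<times> complex \<Rightarrow> real^4) \<Rightarrow> (real^4) set" where
  "knot_exterior N = S3 - N ` (circle \<times> ball 0 1)"

text \<open>The simple closed curve on the boundary torus in the class \<open>p\<close> times the meridian plus
  \<open>q\<close> times the longitude.\<close>

definition slope_curve :: "(complex \<times> complex \<Rightarrow> real^4) \<Rightarrow> int \<Rightarrow> int \<Rightarrow> (real^4) set" where
  "slope_curve N p q = range (\<lambda>t. N (cis (of_int q * t), cis (of_int p * t)))"

text \<open>\<open>M\<close> is the space obtained by gluing \<open>Y\<close> to \<open>X\<close> along \<open>h : A \<rightarrow> X\<close>, where \<open>A\<close> is a subset
  of \<open>Y\<close> and \<open>h\<close> is injective: the disjoint union modulo the identification of \<open>a\<close> with \<open>h a\<close>,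
  with the quotient topology.\<close>

definition glued_space ::
  "'a topology \<Rightarrow> 'b topology \<Rightarrow> 'b set \<Rightarrow> ('b \<Rightarrow> 'a) \<Rightarrow> 'm topology \<Rightarrow> bool" where
  "glued_space X Y A h M \<longleftrightarrow>
     (\<exists>i j. inj_on i (topspace X) \<and> inj_on j (topspace Y) \<and>
        topspace M = i ` topspace X \<union> j ` topspace Y \<and>
        (\<forall>x \<in> topspace X. \<forall>y \<in> topspace Y. i x = j y \<longleftrightarrow> y \<in> A \<and> x = h y) \<and>
        (\<forall>W \<subseteq> topspace M. openin M W \<longleftrightarrow>
           openin X {x \<in> topspace X. i x \<in> W} \<and> openin Y {y \<in> topspace Y. j y \<in> W}))"

text \<open>The solid torus \<open>circle \<times> cball 0 1\<close> is glued to the exterior so that the boundary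
  \<open>{1} \<times> circle\<close> of a meridian disc goes to the curve of slope \<open>p / q\<close>.\<close>

definition dehn_surgery :: "(real^4) set \<Rightarrow> int \<Rightarrow> int \<Rightarrow> 'm topology \<Rightarrow> bool" where
  "dehn_surgery K p q M \<longleftrightarrow>
     (\<exists>N h k. preferred_nbhd K N \<and>
        homeomorphism (circle \<times> circle) (N ` (circle \<times> circle)) h k \<and>
        h ` ({1} \<times> circle) = slope_curve N p q \<and>
        glued_space (top_of_set (knot_exterior N)) (top_of_set (circle \<times> cball 0 1))
          (circle \<times> circle) h M)"

end

theory Submission
  imports Defs
begin

text \<open>Suppose that the group \<open>H\<close> of the surgered manifold is left orderable. The radial retraction of
  the knot complement onto the knot exterior, followed by the inclusion into the manifold, induces a
  homomorphism from the knot group \<open>G\<close> to \<open>H\<close>. It kills \<open>\<mu>\<^sup>p \<lambda>\<^sup>q\<close>, and it is onto because loops can be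
  pushed off the core of the glued solid torus. If its image were nontrivial, it would be a countable
  left-orderable group and so act on the line without a global fixed point. By condition (a), \<open>\<mu>\<close> then
  has no fixed point: it would be fixed by \<open>\<lambda>\<^sup>q = \<mu>\<^bsup>-p\<^esup>\<close>, hence by \<open>\<lambda>\<close>, hence by \<open>G\<close>. So \<open>\<mu>\<close> moves all
  points in the same direction, say up. With \<open>c = 2 g(K) - 1 \<le> p/q\<close> the power \<open>(\<mu>\<^sup>c \<lambda>)\<^sup>q\<close> acts as
  \<open>\<mu>\<^bsup>cq-p\<^esup>\<close>, so neither \<open>\<mu>\<^sup>c \<lambda>\<close> nor \<open>\<mu>\<^bsup>-1\<^esup>\<close> moves a point up. Elements of this kind form a
  root-closed, conjugacy-closed submonoid, which contains \<open>\<mu>\<close> by condition (b), a contradiction.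
  Hence the image is trivial, and with it \<open>H\<close>; but the trivial group is not left orderable.\<close>

section \<open>Path homotopy and the fundamental group\<close>

text \<open>Condition (a) speaks of actions on the line, whereas left orderability gives only an
  order. The passage from one to the other needs countability, which is available for the knot group
  but not in advance for \<open>H\<close>; so the order is restricted to the image of
  \<open>G\<close>. No presentation of \<open>H\<close> is computed: a map that kills the slope and
  is onto suffices, so of van Kampen's theorem only the generation half occurs. The other obstacles
  are topological. The surgered manifold is an abstract quotient space without a metric; compactness
  of the two pieces makes them homeomorphic to closed subspaces. The tubular neighbourhood is given
  by a map and must be shown to be open in the sphere, for which invariance of domain serves. The
  base point \<open>y\<close> is arbitrary, hence the conjugation by a path. Most explicit
  homotopies are straight lines in a convex set, followed by a fixed continuous map.\<close>

definition path_homotopic :: "'a topology \<Rightarrow> (real \<Rightarrow> 'a) \<Rightarrow> (real \<Rightarrow> 'a) \<Rightarrow> bool" where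
  "path_homotopic X p q \<longleftrightarrow>
     homotopic_with (\<lambda>r. r 0 = p 0 \<and> r 1 = p 1) (top_of_set {0..1}) X p q"

lemma path_homotopic_iff:
  "path_homotopic X p q \<longleftrightarrow>
     (\<exists>h :: real \<times> real \<Rightarrow> 'a. continuous_map (top_of_set ({0..1} \<times> {0..1})) X h \<and>
          (\<forall>t\<in>{0..1}. h (0, t) = p t) \<and> (\<forall>t\<in>{0..1}. h (1, t) = q t) \<and>
          (\<forall>s\<in>{0..1}. h (s, 0) = p 0 \<and> h (s, 1) = p 1))"
proof -
  have [simp]: "prod_topology (top_of_set {0..1::real}) (top_of_set {0..1::real}) =
      top_of_set ({0..1} \<times> {0..1})"
    by (simp add: prod_topology_subtopology_eu)
  show ?thesis
    unfolding path_homotopic_def by (subst homotopic_with) auto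
qed

lemma path_homotopic_endpoints:
  assumes "path_homotopic X p q"
  shows "q 0 = p 0" "q 1 = p 1"
proof -
  obtain h :: "real \<times> real \<Rightarrow> 'a" where h: "\<forall>t\<in>{0..1::real}. h (1, t) = q t" "\<forall>s\<in>{0..1::real}. h (s, 0) = p 0 \<and> h (s, 1) = p 1"
    using assms unfolding path_homotopic_iff by blast
  have "h (1, 0) = q 0" "h (1, 1) = q 1" using h(1) by auto
  moreover have "h (1, 0) = p 0" "h (1, 1) = p 1" using h(2) by auto
  ultimately show "q 0 = p 0" "q 1 = p 1" by auto
qed

lemma path_homotopic_pathin:
  assumes "path_homotopic X p q"
  shows "pathin X p" "pathin X q"
  using assms homotopic_with_imp_continuous_maps
  unfolding path_homotopic_def pathin_def by blast+

lemma path_homotopic_refl: "pathin X p \<Longrightarrow> path_homotopic X p p"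
  unfolding path_homotopic_def pathin_def by (simp add: homotopic_with_refl)

lemma path_homotopic_sym:
  assumes "path_homotopic X p q" shows "path_homotopic X q p"
  using assms path_homotopic_endpoints[OF assms] unfolding path_homotopic_def
  by (simp add: homotopic_with_sym)

lemma path_homotopic_trans [trans]:
  assumes "path_homotopic X p q" "path_homotopic X q r"
  shows "path_homotopic X p r"
  using assms path_homotopic_endpoints[OF assms(1)] unfolding path_homotopic_def
  by (auto intro: homotopic_with_trans)

lemma path_homotopic_eq:
  assumes "pathin X p" "\<And>t. t \<in> {0..1} \<Longrightarrow> p t = q t"
  shows "path_homotopic X p q"
  using assms unfolding path_homotopic_def pathin_def
  by (intro homotopic_with_equal) auto

lemma path_homotopic_image:
  assumes "path_homotopic X p q" "continuous_map X Y f"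
  shows "path_homotopic Y (f \<circ> p) (f \<circ> q)"
  using assms unfolding path_homotopic_def
  by (auto intro: homotopic_with_compose_continuous_map_left)

text \<open>The straight line between \<open>u\<close> and \<open>v\<close> stays in the convex set
  \<open>C\<close>, and \<open>P\<close> carries it to \<open>X\<close>. Depending on the use,
  \<open>C\<close> is a parameter interval, the plane covering the boundary torus, a meridian disc,
  or an interval times a disc.\<close>

lemma path_homotopic_convex:
  fixes C :: "'b::real_normed_vector set"
  assumes "convex C" "continuous_map (top_of_set C) X P"
    and u: "continuous_on {0..1} u" "u ` {0..1} \<subseteq> C"
    and v: "continuous_on {0..1} v" "v ` {0..1} \<subseteq> C"
    and "u 0 = v 0" "u 1 = v 1"
  shows "path_homotopic X (\<lambda>t. P (u t)) (\<lambda>t. P (v t))"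
proof -
  let ?h = "\<lambda>z. (1 - fst z) *\<^sub>R u (snd z) + fst z *\<^sub>R v (snd z)"
  have "continuous_on ({0..1} \<times> {0..1}) ?h"
    by (intro continuous_intros continuous_on_compose2[OF u(1)] continuous_on_compose2[OF v(1)]) auto
  moreover have "?h ` ({0..1} \<times> {0..1}) \<subseteq> C"
    using u(2) v(2) by (auto intro!: convexD_alt[OF assms(1)])
  ultimately have "continuous_map (top_of_set ({0..1} \<times> {0..1})) (top_of_set C) ?h"
    by (simp add: image_subset_iff_funcset)
  then have "continuous_map (top_of_set ({0..1} \<times> {0..1})) X (P \<circ> ?h)"
    using assms(2) by (rule continuous_map_compose)
  then show ?thesis
    unfolding path_homotopic_iff using assms(7,8)
    by (intro exI[of _ "P \<circ> ?h"]) (auto simp flip: scaleR_left_distrib)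
qed

lemma path_homotopic_reparam:
  assumes "continuous_map (top_of_set {a..b}) X P"
    and "continuous_on {0..1} u" "u ` {0..1} \<subseteq> {a..b}"
    and "continuous_on {0..1} v" "v ` {0..1} \<subseteq> {a..b::real}"
    and "u 0 = v 0" "u 1 = v 1"
  shows "path_homotopic X (\<lambda>t. P (u t)) (\<lambda>t. P (v t))"
  by (rule path_homotopic_convex[OF _ assms]) auto

lemma continuous_map_real_cases:
  assumes "continuous_on T k"
    and "continuous_map (top_of_set {x\<in>T. k x \<le> c}) X f"
    and "continuous_map (top_of_set {x\<in>T. c \<le> k x}) X g"
    and "\<And>x. x \<in> T \<Longrightarrow> k x = (c::real) \<Longrightarrow> f x = g x"
  shows "continuous_map (top_of_set T) X (\<lambda>x. if k x \<le> c then f x else g x)"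
proof (rule continuous_map_cases_le)
  have *: "T \<inter> {x \<in> T. k x \<le> c} = {x \<in> T. k x \<le> c}" "T \<inter> {x \<in> T. c \<le> k x} = {x \<in> T. c \<le> k x}"
    by auto
  show "continuous_map (subtopology (top_of_set T) {x \<in> topspace (top_of_set T). k x \<le> c}) X f"
    "continuous_map (subtopology (top_of_set T) {x \<in> topspace (top_of_set T). c \<le> k x}) X g"
    using assms by (simp_all add: subtopology_subtopology *)
qed (use assms in auto)

lemma continuous_map_comp_on:
  assumes "continuous_map (top_of_set T) X f" "continuous_on S u" "u ` S \<subseteq> T"
  shows "continuous_map (top_of_set S) X (\<lambda>x. f (u x))"
proof -
  have "continuous_map (top_of_set S) (top_of_set T) u"
    using assms by (simp add: image_subset_iff_funcset)
  from continuous_map_compose[OF this assms(1)] show ?thesis by (simp add: o_def)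
qed

lemma pathin_loop_join:
  assumes "pathin X p" "pathin X q" "p 1 = q 0"
  shows "pathin X (loop_join p q)"
  unfolding pathin_def loop_join_def
proof (rule continuous_map_real_cases)
  show "p (2 * t) = q (2 * t - 1)" if "t = 1/2" for t
    using assms(3) by (simp add: that)
qed (use assms in \<open>auto simp: pathin_def intro!: continuous_intros continuous_map_comp_on[of "{0..1}"]\<close>)

lemma loop_join_ends [simp]: "loop_join p q 0 = p 0" "loop_join p q 1 = q 1"
  by (auto simp: loop_join_def)

lemma path_homotopic_join:
  assumes "path_homotopic X p p'" "path_homotopic X q q'" "p 1 = q 0"
  shows "path_homotopic X (loop_join p q) (loop_join p' q')"
proof -
  obtain h :: "real \<times> real \<Rightarrow> 'a" where h: "continuous_map (top_of_set ({0..1} \<times> {0..1})) X h"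
    "\<forall>t\<in>{0..1}. h (0, t) = p t" "\<forall>t\<in>{0..1}. h (1, t) = p' t"
    "\<forall>s\<in>{0..1}. h (s, 0) = p 0 \<and> h (s, 1) = p 1"
    using assms(1) unfolding path_homotopic_iff by blast
  obtain k :: "real \<times> real \<Rightarrow> 'a" where k: "continuous_map (top_of_set ({0..1} \<times> {0..1})) X k"
    "\<forall>t\<in>{0..1}. k (0, t) = q t" "\<forall>t\<in>{0..1}. k (1, t) = q' t"
    "\<forall>s\<in>{0..1}. k (s, 0) = q 0 \<and> k (s, 1) = q 1"
    using assms(2) unfolding path_homotopic_iff by blast
  let ?H = "\<lambda>z. if snd z \<le> 1/2 then h (fst z, 2 * snd z) else k (fst z, 2 * snd z - 1)"
  have "continuous_map (top_of_set ({0..1} \<times> {0..1})) X ?H"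
  proof (rule continuous_map_real_cases)
    fix x :: "real \<times> real" assume "x \<in> {0..1} \<times> {0..1}" "snd x = 1/2"
    then obtain s where "s \<in> {0..1}" "x = (s, 1/2)" by (cases x) auto
    then show "h (fst x, 2 * snd x) = k (fst x, 2 * snd x - 1)"
      using h(4) k(4) assms(3) by auto
  qed (auto intro!: continuous_intros continuous_map_comp_on[OF h(1)] continuous_map_comp_on[OF k(1)])
  then show ?thesis
    unfolding path_homotopic_iff
    by (intro exI[of _ ?H]) (use h k in \<open>auto simp: loop_join_def\<close>)
qed

lemma path_homotopic_join_const_left:
  assumes "pathin X p" "p 0 = x"
  shows "path_homotopic X (loop_join (\<lambda>_. x) p) p"
proof -
  have "path_homotopic X (\<lambda>t. p (max 0 (2*t - 1))) (\<lambda>t. p t)"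
    using assms unfolding pathin_def by (intro path_homotopic_reparam) (auto intro!: continuous_intros)
  moreover have "(\<lambda>t. p (max 0 (2*t - 1))) = loop_join (\<lambda>_. x) p"
    using assms(2) by (auto simp: loop_join_def fun_eq_iff)
  ultimately show ?thesis by simp
qed

lemma path_homotopic_join_const_right:
  assumes "pathin X p" "p 1 = x"
  shows "path_homotopic X (loop_join p (\<lambda>_. x)) p"
proof -
  have "path_homotopic X (\<lambda>t. p (min 1 (2*t))) (\<lambda>t. p t)"
    using assms unfolding pathin_def by (intro path_homotopic_reparam) (auto intro!: continuous_intros)
  moreover have "min 1 (2*t) = (if t \<le> 1/2 then 2*t else 1)" for t :: real
    by auto
  then have "(\<lambda>t. p (min 1 (2*t))) = loop_join p (\<lambda>_. x)"
    using assms(2) by (simp add: loop_join_def fun_eq_iff)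
  ultimately show ?thesis by simp
qed

text \<open>Laying the three paths end to end gives one path \<open>?P\<close> on {0..3}. The two
  bracketings are its reparametrisations by \<open>min (4*t) (2*t+1)\<close> and
  \<open>max (2*t) (4*t - 1)\<close>, both of which run from 0 to 3.\<close>

lemma path_homotopic_join_assoc:
  assumes p: "pathin X p" and q: "pathin X q" and r: "pathin X r"
    and "p 1 = q 0" "q 1 = r 0"
  shows "path_homotopic X (loop_join (loop_join p q) r) (loop_join p (loop_join q r))"
proof -
  let ?P = "\<lambda>s. if s \<le> 1 then p s else if s \<le> 2 then q (s - 1) else r (s - 2)"
  have sets: "{x\<in>{0..3}. x \<le> 1} = {0..1::real}" "{x\<in>{0..3}. 1 \<le> x} = {1..3::real}"
    "{x\<in>{1..3}. x \<le> 2} = {1..2::real}" "{x\<in>{1..3}. 2 \<le> x} = {2..3::real}"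
    by auto
  have "continuous_map (top_of_set {1..3}) X (\<lambda>s. if s \<le> 2 then q (s - 1) else r (s - 2))"
  proof (rule continuous_map_real_cases, unfold sets)
    show "continuous_map (top_of_set {1..2}) X (\<lambda>s. q (s - 1))"
      "continuous_map (top_of_set {2..3}) X (\<lambda>s. r (s - 2))"
      using q r by (auto simp: pathin_def intro!: continuous_intros continuous_map_comp_on[of "{0..1}"])
  qed (use assms in \<open>auto intro!: continuous_intros\<close>)
  note q_r = this
  have P: "continuous_map (top_of_set {0..3}) X ?P"
    by (rule continuous_map_real_cases, unfold sets)
      (use q_r assms in \<open>auto simp: pathin_def intro!: continuous_intros\<close>)
  have "path_homotopic X (\<lambda>t. ?P (min (4*t) (2*t+1))) (\<lambda>t. ?P (max (2*t) (4*t - 1)))"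
    by (rule path_homotopic_reparam[OF P]) (auto intro!: continuous_intros)
  moreover have "path_homotopic X (loop_join (loop_join p q) r) (\<lambda>t. ?P (min (4*t) (2*t+1)))"
  proof (rule path_homotopic_eq)
    show "loop_join (loop_join p q) r t = ?P (min (4*t) (2*t+1))" for t
      by (cases "t \<le> 1/2"; cases "t \<le> 1/4") (auto simp: loop_join_def min_def)
  qed (use assms in \<open>auto intro!: pathin_loop_join\<close>)
  moreover have "path_homotopic X (loop_join p (loop_join q r)) (\<lambda>t. ?P (max (2*t) (4*t - 1)))"
  proof (rule path_homotopic_eq)
    show "loop_join p (loop_join q r) t = ?P (max (2*t) (4*t - 1))" for t
    proof (cases "t = 1/2")
      case True
      show ?thesis unfolding True by (simp add: loop_join_def)
    next
      case False
      then show ?thesis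
        by (cases "t \<le> 1/2"; cases "t \<le> 3/4") (auto simp: loop_join_def max_def)
    qed
  qed (use assms in \<open>auto intro!: pathin_loop_join\<close>)
  ultimately show ?thesis by (meson path_homotopic_sym path_homotopic_trans)
qed

definition rev_path :: "(real \<Rightarrow> 'a) \<Rightarrow> real \<Rightarrow> 'a" where
  "rev_path p = (\<lambda>t. p (1 - t))"

lemma rev_path_ends [simp]: "rev_path p 0 = p 1" "rev_path p 1 = p 0"
  by (auto simp: rev_path_def)

lemma rev_path_rev_path [simp]: "rev_path (rev_path p) = p"
  by (simp add: rev_path_def)

lemma pathin_rev_path: "pathin X p \<Longrightarrow> pathin X (rev_path p)"
  unfolding pathin_def rev_path_def
  by (erule continuous_map_comp_on) (auto intro!: continuous_intros)

lemma path_homotopic_join_rev: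
  assumes "pathin X p" "p 0 = x"
  shows "path_homotopic X (loop_join p (rev_path p)) (\<lambda>_. x)"
proof -
  have "path_homotopic X (\<lambda>t. p (min (2*t) (2 - 2*t))) (\<lambda>t. p 0)"
    using assms unfolding pathin_def
    by (intro path_homotopic_reparam) (auto intro!: continuous_intros)
  moreover have "min (2*t) (2 - 2*t) = (if t \<le> 1/2 then 2*t else 1 - (2*t - 1))" for t :: real
    by auto
  then have "(\<lambda>t. p (min (2*t) (2 - 2*t))) = loop_join p (rev_path p)"
    by (simp add: loop_join_def fun_eq_iff rev_path_def)
  ultimately show ?thesis using assms by simp
qed

lemma path_homotopic_rev_join:
  assumes "pathin X p" "p 1 = x"
  shows "path_homotopic X (loop_join (rev_path p) p) (\<lambda>_. x)"
  using path_homotopic_join_rev[OF pathin_rev_path[OF assms(1)]] assms by simp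

lemma loop_join_image: "f \<circ> loop_join p q = loop_join (f \<circ> p) (f \<circ> q)"
  by (auto simp: loop_join_def fun_eq_iff)

lemma pathin_image: "pathin X p \<Longrightarrow> continuous_map X Y f \<Longrightarrow> pathin Y (f \<circ> p)"
  unfolding pathin_def by (rule continuous_map_compose)

lemma loop_class_eq:
  assumes "p \<in> loops X x"
  shows "loop_class X x p = {q. path_homotopic X p q}"
proof -
  have p: "p 0 = x" "p 1 = x" using assms by (auto simp: loops_def)
  have "q \<in> loops X x" if "path_homotopic X p q" for q
    using path_homotopic_endpoints[OF that] path_homotopic_pathin[OF that] p by (simp add: loops_def)
  then show ?thesis
    unfolding loop_class_def path_homotopic_def p by blast
qed

lemma loops_path_homotopic: "p \<in> loops X x \<Longrightarrow> path_homotopic X p q \<Longrightarrow> q \<in> loops X x"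
  by (simp add: loops_def path_homotopic_endpoints path_homotopic_pathin)

lemma loop_class_eq_iff:
  assumes "p \<in> loops X x" "q \<in> loops X x"
  shows "loop_class X x p = loop_class X x q \<longleftrightarrow> path_homotopic X p q"
proof
  assume "loop_class X x p = loop_class X x q"
  then show "path_homotopic X p q"
    using assms path_homotopic_refl[of X q] by (auto simp: loop_class_eq loops_def)
next
  assume pq: "path_homotopic X p q"
  have "path_homotopic X p r \<longleftrightarrow> path_homotopic X q r" for r
    using path_homotopic_trans[OF pq] path_homotopic_trans[OF path_homotopic_sym[OF pq]] by blast
  then show "loop_class X x p = loop_class X x q"
    by (simp add: loop_class_eq assms)
qed

lemma loop_class_eqI: "path_homotopic X p q \<Longrightarrow> p \<in> loops X x \<Longrightarrow> loop_class X x p = loop_class X x q"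
  using loop_class_eq_iff[of p X x q] loops_path_homotopic[of p X x q] by blast

lemma loop_class_refl: "p \<in> loops X x \<Longrightarrow> p \<in> loop_class X x p"
  by (simp add: loop_class_eq path_homotopic_refl loops_def)

lemma const_loop: "x \<in> topspace X \<Longrightarrow> (\<lambda>_. x) \<in> loops X x"
  by (auto simp: loops_def pathin_def)

lemma loops_join: "p \<in> loops X x \<Longrightarrow> q \<in> loops X x \<Longrightarrow> loop_join p q \<in> loops X x"
  by (auto simp: loops_def intro: pathin_loop_join)

lemma loops_rev: "p \<in> loops X x \<Longrightarrow> rev_path p \<in> loops X x"
  by (auto simp: loops_def intro: pathin_rev_path)

text \<open>Products and homomorphisms are defined on classes by a union over all representatives.
  Such a union collapses to one value as soon as the value does not depend on the
  representative.\<close>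

lemma UN_loop_class_const:
  assumes "p \<in> loops X x" "\<And>q. path_homotopic X p q \<Longrightarrow> f q = f p"
  shows "(\<Union>q\<in>loop_class X x p. f q) = f p"
proof -
  have "f q = f p" if "q \<in> loop_class X x p" for q
    using that assms(2) unfolding loop_class_eq[OF assms(1)] by blast
  then show ?thesis using loop_class_refl[OF assms(1)] by blast
qed

lemma fundamental_group_mult:
  assumes p: "p \<in> loops X x" and q: "q \<in> loops X x"
  shows "loop_class X x p \<otimes>\<^bsub>fundamental_group X x\<^esub> loop_class X x q = loop_class X x (loop_join p q)"
proof -
  have *: "loop_class X x (loop_join p' q') = loop_class X x (loop_join p q)"
    if "path_homotopic X p p'" "path_homotopic X q q'" for p' q'
  proof -
    have "path_homotopic X (loop_join p q) (loop_join p' q')"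
      using that p q by (intro path_homotopic_join) (auto simp: loops_def)
    moreover have "loop_join p' q' \<in> loops X x"
      using loops_join[OF loops_path_homotopic[OF p that(1)] loops_path_homotopic[OF q that(2)]] .
    ultimately show ?thesis
      using p q by (metis loop_class_eq_iff loops_join)
  qed
  have pp: "path_homotopic X p p" "path_homotopic X q q"
    using p q by (simp_all add: path_homotopic_refl loops_def)
  have inner: "(\<Union>q'\<in>loop_class X x q. loop_class X x (loop_join p' q')) = loop_class X x (loop_join p q)"
    if "path_homotopic X p p'" for p'
    by (subst UN_loop_class_const[OF q]) (simp_all only: *[OF that] pp)
  have "(\<Union>p'\<in>loop_class X x p. \<Union>q'\<in>loop_class X x q. loop_class X x (loop_join p' q')) =
      loop_class X x (loop_join p q)"
    by (subst UN_loop_class_const[OF p]) (simp_all only: inner pp)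
  then show ?thesis
    by (simp add: fundamental_group_def)
qed

lemma fundamental_group_carrier [simp]:
  "carrier (fundamental_group X x) = loop_class X x ` loops X x"
  by (simp add: fundamental_group_def)

lemma fundamental_group_one:
  "\<one>\<^bsub>fundamental_group X x\<^esub> = loop_class X x (\<lambda>_. x)"
  by (simp add: fundamental_group_def)

lemma fundamental_group_group:
  assumes "x \<in> topspace X"
  shows "group (fundamental_group X x)"
proof (rule groupI)
  fix a b c
  assume "a \<in> carrier (fundamental_group X x)" "b \<in> carrier (fundamental_group X x)"
    "c \<in> carrier (fundamental_group X x)"
  then obtain p q r where *: "p \<in> loops X x" "q \<in> loops X x" "r \<in> loops X x"
    "a = loop_class X x p" "b = loop_class X x q" "c = loop_class X x r" by auto
  have "loop_class X x (loop_join (loop_join p q) r) = loop_class X x (loop_join p (loop_join q r))"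
    by (rule loop_class_eqI[OF path_homotopic_join_assoc])
      (use *(1-3) in \<open>simp_all add: loops_join, simp_all add: loops_def\<close>)
  then show "a \<otimes>\<^bsub>fundamental_group X x\<^esub> b \<otimes>\<^bsub>fundamental_group X x\<^esub> c =
      a \<otimes>\<^bsub>fundamental_group X x\<^esub> (b \<otimes>\<^bsub>fundamental_group X x\<^esub> c)"
    using * by (simp add: fundamental_group_mult loops_join)
next
  fix a assume "a \<in> carrier (fundamental_group X x)"
  then obtain p where p: "p \<in> loops X x" "a = loop_class X x p" by auto
  have "loop_class X x (loop_join (\<lambda>_. x) p) = loop_class X x p"
    by (rule loop_class_eqI[OF path_homotopic_join_const_left])
      (use p assms in \<open>simp_all add: loops_join const_loop, simp_all add: loops_def\<close>)
  then show "\<one>\<^bsub>fundamental_group X x\<^esub> \<otimes>\<^bsub>fundamental_group X x\<^esub> a = a"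
    using p by (simp add: fundamental_group_one fundamental_group_mult const_loop assms)
  have "loop_class X x (loop_join (rev_path p) p) = loop_class X x (\<lambda>_. x)"
    by (rule loop_class_eqI[OF path_homotopic_rev_join])
      (use p assms in \<open>simp_all add: loops_join loops_rev, simp_all add: loops_def\<close>)
  then show "\<exists>b\<in>carrier (fundamental_group X x). b \<otimes>\<^bsub>fundamental_group X x\<^esub> a = \<one>\<^bsub>fundamental_group X x\<^esub>"
    using p by (auto simp: fundamental_group_one fundamental_group_mult loops_rev intro!: bexI[of _ "rev_path p"])
next
  fix a b assume "a \<in> carrier (fundamental_group X x)" "b \<in> carrier (fundamental_group X x)"
  then show "a \<otimes>\<^bsub>fundamental_group X x\<^esub> b \<in> carrier (fundamental_group X x)"
    by (auto simp: fundamental_group_mult loops_join)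
qed (auto simp: fundamental_group_one const_loop assms)

text \<open>\<open>F\<close> has to respect joins only up to homotopy. This generality is required
  for a continuous map followed by a change of base point, where the two trips along the connecting
  path cancel only up to homotopy.\<close>

lemma fundamental_group_hom:
  assumes F: "\<And>p. p \<in> loops X x \<Longrightarrow> F p \<in> loops Y y"
    and cong: "\<And>p q. p \<in> loops X x \<Longrightarrow> path_homotopic X p q \<Longrightarrow> path_homotopic Y (F p) (F q)"
    and join: "\<And>p q. p \<in> loops X x \<Longrightarrow> q \<in> loops X x \<Longrightarrow>
                 path_homotopic Y (F (loop_join p q)) (loop_join (F p) (F q))"
  obtains \<phi> where "\<phi> \<in> hom (fundamental_group X x) (fundamental_group Y y)"
    and "\<And>p. p \<in> loops X x \<Longrightarrow> \<phi> (loop_class X x p) = loop_class Y y (F p)"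
proof -
  let ?\<phi> = "\<lambda>A. \<Union>p\<in>A. loop_class Y y (F p)"
  have eq: "?\<phi> (loop_class X x p) = loop_class Y y (F p)" if "p \<in> loops X x" for p
  proof (rule UN_loop_class_const[OF that])
    fix q assume "path_homotopic X p q"
    then show "loop_class Y y (F q) = loop_class Y y (F p)"
      using loop_class_eqI[OF cong[OF that] F[OF that]] by simp
  qed
  have "?\<phi> \<in> hom (fundamental_group X x) (fundamental_group Y y)"
  proof (rule homI)
    fix a b
    assume "a \<in> carrier (fundamental_group X x)" "b \<in> carrier (fundamental_group X x)"
    then obtain p q where *: "p \<in> loops X x" "q \<in> loops X x" "a = loop_class X x p" "b = loop_class X x q"
      by auto
    have "loop_class Y y (F (loop_join p q)) = loop_class Y y (loop_join (F p) (F q))"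
      by (rule loop_class_eqI[OF join[OF *(1,2)] F[OF loops_join[OF *(1,2)]]])
    then show "?\<phi> (a \<otimes>\<^bsub>fundamental_group X x\<^esub> b) = ?\<phi> a \<otimes>\<^bsub>fundamental_group Y y\<^esub> ?\<phi> b"
      unfolding *(3,4) fundamental_group_mult[OF *(1,2)] eq[OF loops_join[OF *(1,2)]] eq[OF *(1)] eq[OF *(2)]
        fundamental_group_mult[OF F[OF *(1)] F[OF *(2)]] .
  next
    fix a assume "a \<in> carrier (fundamental_group X x)"
    then obtain p where p: "p \<in> loops X x" "a = loop_class X x p" by auto
    show "?\<phi> a \<in> carrier (fundamental_group Y y)"
      unfolding p(2) eq[OF p(1)] using F[OF p(1)] by auto
  qed
  then show thesis using eq by (rule that)
qed

section \<open>Change of base point\<close>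

lemma path_homotopic_cancel_left:
  assumes "pathin X \<gamma>" "pathin X \<delta>" "\<gamma> 0 = \<delta> 0"
  shows "path_homotopic X (loop_join \<delta> (loop_join (rev_path \<delta>) \<gamma>)) \<gamma>"
proof -
  have "path_homotopic X (loop_join \<delta> (loop_join (rev_path \<delta>) \<gamma>)) (loop_join (loop_join \<delta> (rev_path \<delta>)) \<gamma>)"
    by (rule path_homotopic_sym[OF path_homotopic_join_assoc]) (use assms in \<open>simp_all add: pathin_rev_path\<close>)
  also have "path_homotopic X \<dots> (loop_join (\<lambda>_. \<delta> 0) \<gamma>)"
    by (rule path_homotopic_join[OF path_homotopic_join_rev path_homotopic_refl]) (use assms in simp_all)
  also have "path_homotopic X \<dots> \<gamma>"
    by (rule path_homotopic_join_const_left) (use assms in simp_all)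
  finally show ?thesis .
qed

lemma path_homotopic_cancel_right:
  assumes "pathin X \<gamma>" "pathin X \<delta>" "\<gamma> 1 = \<delta> 0"
  shows "path_homotopic X (loop_join (loop_join \<gamma> \<delta>) (rev_path \<delta>)) \<gamma>"
proof -
  have "path_homotopic X (loop_join (loop_join \<gamma> \<delta>) (rev_path \<delta>)) (loop_join \<gamma> (loop_join \<delta> (rev_path \<delta>)))"
    by (rule path_homotopic_join_assoc) (use assms in \<open>simp_all add: pathin_rev_path\<close>)
  also have "path_homotopic X \<dots> (loop_join \<gamma> (\<lambda>_. \<delta> 0))"
    by (rule path_homotopic_join[OF path_homotopic_refl path_homotopic_join_rev]) (use assms in simp_all)
  also have "path_homotopic X \<dots> \<gamma>"
    by (rule path_homotopic_join_const_right) (use assms in simp_all)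
  finally show ?thesis .
qed

text \<open>With \<open>\<delta>\<close> running from \<open>x\<close> to \<open>y\<close>, this
  turns a loop at \<open>x\<close> into a loop at \<open>y\<close>. It is needed since
  \<open>y\<close> in the surgered manifold is arbitrary, whereas the peripheral loops start on the
  boundary torus.\<close>

definition conj_path :: "(real \<Rightarrow> 'a) \<Rightarrow> (real \<Rightarrow> 'a) \<Rightarrow> real \<Rightarrow> 'a" where
  "conj_path \<delta> \<gamma> = loop_join (loop_join (rev_path \<delta>) \<gamma>) \<delta>"

lemma conj_path_in_loops:
  assumes "\<gamma> \<in> loops X x" "pathin X \<delta>" "\<delta> 0 = x" "\<delta> 1 = y"
  shows "conj_path \<delta> \<gamma> \<in> loops X y"
  using assms by (simp add: loops_def conj_path_def pathin_loop_join pathin_rev_path)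

lemma path_homotopic_conj:
  assumes "path_homotopic X \<gamma> \<gamma>'" "\<gamma> \<in> loops X x" "pathin X \<delta>" "\<delta> 0 = x"
  shows "path_homotopic X (conj_path \<delta> \<gamma>) (conj_path \<delta> \<gamma>')"
  unfolding conj_path_def
  by (intro path_homotopic_join path_homotopic_refl assms(1))
    (use assms in \<open>simp_all add: loops_def pathin_rev_path\<close>)

lemma path_homotopic_conj_const:
  assumes "path_homotopic X \<gamma> (\<lambda>_. x)" "\<gamma> \<in> loops X x" "pathin X \<delta>" "\<delta> 0 = x" "\<delta> 1 = y"
  shows "path_homotopic X (conj_path \<delta> \<gamma>) (\<lambda>_. y)"
proof -
  have "path_homotopic X (conj_path \<delta> \<gamma>) (conj_path \<delta> (\<lambda>_. x))"
    by (rule path_homotopic_conj[OF assms(1-4)])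
  also have "path_homotopic X \<dots> (loop_join (rev_path \<delta>) \<delta>)"
    unfolding conj_path_def
    by (intro path_homotopic_join path_homotopic_join_const_right path_homotopic_refl)
      (use assms in \<open>simp_all add: pathin_rev_path\<close>)
  also have "path_homotopic X \<dots> (\<lambda>_. y)"
    by (rule path_homotopic_rev_join[OF assms(3,5)])
  finally show ?thesis .
qed

text \<open>On the right-hand side the \<open>\<delta>\<close> that ends the first factor cancels
  against the reversed \<open>\<delta>\<close> that begins the second; the rest is
  rebracketing.\<close>

lemma path_homotopic_conj_join:
  assumes "\<gamma> \<in> loops X x" "\<gamma>' \<in> loops X x" "pathin X \<delta>" "\<delta> 0 = x"
  shows "path_homotopic X (conj_path \<delta> (loop_join \<gamma> \<gamma>')) (loop_join (conj_path \<delta> \<gamma>) (conj_path \<delta> \<gamma>'))"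
proof -
  let ?R = "rev_path \<delta>"
  have ends: "pathin X \<gamma>" "\<gamma> 0 = x" "\<gamma> 1 = x" "pathin X \<gamma>'" "\<gamma>' 0 = x" "\<gamma>' 1 = x" "pathin X ?R"
    using assms by (auto simp: loops_def pathin_rev_path)
  note simps = ends assms(3,4) pathin_loop_join
  have "path_homotopic X (loop_join (conj_path \<delta> \<gamma>) (conj_path \<delta> \<gamma>'))
      (loop_join (loop_join (loop_join ?R \<gamma>) \<delta>) (loop_join ?R (loop_join \<gamma>' \<delta>)))"
    unfolding conj_path_def
    by (intro path_homotopic_join path_homotopic_join_assoc path_homotopic_refl) (simp_all add: simps)
  also have "path_homotopic X \<dots> (loop_join (loop_join ?R \<gamma>) (loop_join \<delta> (loop_join ?R (loop_join \<gamma>' \<delta>))))"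
    by (rule path_homotopic_join_assoc) (simp_all add: simps)
  also have "path_homotopic X \<dots> (loop_join (loop_join ?R \<gamma>) (loop_join \<gamma>' \<delta>))"
    by (intro path_homotopic_join path_homotopic_cancel_left path_homotopic_refl) (simp_all add: simps)
  also have "path_homotopic X \<dots> (loop_join (loop_join (loop_join ?R \<gamma>) \<gamma>') \<delta>)"
    by (rule path_homotopic_sym[OF path_homotopic_join_assoc]) (simp_all add: simps)
  also have "path_homotopic X \<dots> (conj_path \<delta> (loop_join \<gamma> \<gamma>'))"
    unfolding conj_path_def
    by (intro path_homotopic_join path_homotopic_join_assoc path_homotopic_refl) (simp_all add: simps)
  finally show ?thesis by (rule path_homotopic_sym)
qed

lemma path_homotopic_conj_rev:
  assumes "\<gamma> \<in> loops X x" "pathin X \<delta>" "\<delta> 0 = x"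
  shows "path_homotopic X (conj_path (rev_path \<delta>) (conj_path \<delta> \<gamma>)) \<gamma>"
proof -
  let ?R = "rev_path \<delta>"
  have ends: "pathin X \<gamma>" "\<gamma> 0 = x" "\<gamma> 1 = x" "pathin X ?R"
    using assms by (auto simp: loops_def pathin_rev_path)
  note simps = ends assms(2,3) pathin_loop_join
  have "path_homotopic X (loop_join \<delta> (conj_path \<delta> \<gamma>)) (loop_join \<delta> (loop_join ?R (loop_join \<gamma> \<delta>)))"
    unfolding conj_path_def
    by (intro path_homotopic_join path_homotopic_join_assoc path_homotopic_refl) (simp_all add: simps)
  also have "path_homotopic X \<dots> (loop_join \<gamma> \<delta>)"
    by (rule path_homotopic_cancel_left) (simp_all add: simps)
  finally have "path_homotopic X (loop_join (loop_join \<delta> (conj_path \<delta> \<gamma>)) ?R) (loop_join (loop_join \<gamma> \<delta>) ?R)"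
    by (rule path_homotopic_join[OF _ path_homotopic_refl]) (simp_all add: simps conj_path_def)
  also have "path_homotopic X \<dots> \<gamma>"
    by (rule path_homotopic_cancel_right) (simp_all add: simps)
  finally show ?thesis by (simp add: conj_path_def[of "rev_path \<delta>"])
qed

text \<open>The implication from left to right is the other one for the reversed path, because
  conjugating back along \<open>rev_path \<delta>\<close> recovers \<open>\<gamma>\<close> up to
  homotopy.\<close>

lemma null_homotopic_conj_iff:
  assumes "\<gamma> \<in> loops X x" "pathin X \<delta>" "\<delta> 0 = x" "\<delta> 1 = y"
  shows "path_homotopic X (conj_path \<delta> \<gamma>) (\<lambda>_. y) \<longleftrightarrow> path_homotopic X \<gamma> (\<lambda>_. x)"
proof
  assume "path_homotopic X (conj_path \<delta> \<gamma>) (\<lambda>_. y)"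
  then have "path_homotopic X (conj_path (rev_path \<delta>) (conj_path \<delta> \<gamma>)) (\<lambda>_. x)"
    by (rule path_homotopic_conj_const[OF _ conj_path_in_loops[OF assms]])
      (use assms in \<open>simp_all add: pathin_rev_path\<close>)
  then show "path_homotopic X \<gamma> (\<lambda>_. x)"
    using path_homotopic_trans path_homotopic_sym[OF path_homotopic_conj_rev[OF assms(1-3)]] by blast
qed (rule path_homotopic_conj_const[OF _ assms])

section \<open>Deforming loops into an open set\<close>

definition sub_path :: "(real \<Rightarrow> 'a) \<Rightarrow> real \<Rightarrow> real \<Rightarrow> real \<Rightarrow> 'a" where
  "sub_path \<gamma> s t = (\<lambda>x. \<gamma> (s + (t - s) * x))"

lemma sub_path_ends [simp]: "sub_path \<gamma> s t 0 = \<gamma> s" "sub_path \<gamma> s t 1 = \<gamma> t"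
  by (simp_all add: sub_path_def)

lemma sub_path_range:
  fixes s t x :: real
  assumes "s \<le> t" "0 \<le> x" "x \<le> 1" shows "s + (t - s) * x \<in> {s..t}"
  using assms mult_left_le[of x "t - s"] by auto

lemma pathin_sub_path:
  assumes "pathin X \<gamma>" "0 \<le> s" "s \<le> t" "t \<le> 1" "\<And>x. x \<in> {s..t} \<Longrightarrow> \<gamma> x \<in> A"
  shows "pathin (subtopology X A) (sub_path \<gamma> s t)"
proof -
  have r: "s + (t - s) * x \<in> {s..t}" if "x \<in> {0..1}" for x
    using sub_path_range[OF assms(3)] that by auto
  have "continuous_map (top_of_set {0..1}) X (sub_path \<gamma> s t)"
    unfolding sub_path_def using assms(1) unfolding pathin_def
  proof (rule continuous_map_comp_on)
    show "continuous_on {0..1} (\<lambda>x. s + (t - s) * x)" by (intro continuous_intros)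
    show "(\<lambda>x. s + (t - s) * x) ` {0..1} \<subseteq> {0..1}"
    proof (rule image_subsetI)
      fix x :: real assume "x \<in> {0..1}"
      from r[OF this] show "s + (t - s) * x \<in> {0..1}" using assms(2,4) by simp
    qed
  qed
  then show ?thesis
    unfolding pathin_def by (rule continuous_map_into_subtopology) (use r assms(5) in \<open>auto simp: sub_path_def\<close>)
qed

lemma path_homotopic_sub_path_join:
  assumes "pathin X \<gamma>" "0 \<le> a" "a \<le> b" "b \<le> c" "c \<le> 1"
  shows "path_homotopic X (loop_join (sub_path \<gamma> a b) (sub_path \<gamma> b c)) (sub_path \<gamma> a c)"
proof -
  let ?u = "\<lambda>x. a + (b - a) * min (2 * x) 1 + (c - b) * max 0 (2 * x - 1)"
  have u: "?u x \<in> {0..1}" if "x \<in> {0..1}" for x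
    using sub_path_range[OF assms(3), of "min (2 * x) 1"] sub_path_range[OF assms(4), of "max 0 (2 * x - 1)"]
      that assms by (cases "x \<le> 1/2") auto
  have v: "a + (c - a) * x \<in> {0..1}" if "x \<in> {0..1}" for x
    using sub_path_range[of a c x] that assms by auto
  have "path_homotopic X (\<lambda>x. \<gamma> (?u x)) (\<lambda>x. \<gamma> (a + (c - a) * x))"
  proof (rule path_homotopic_reparam[OF assms(1)[unfolded pathin_def]])
    show "?u ` {0..1} \<subseteq> {0..1}" by (rule image_subsetI) (rule u)
    show "(\<lambda>x. a + (c - a) * x) ` {0..1} \<subseteq> {0..1}" by (rule image_subsetI) (rule v)
  qed (auto intro!: continuous_intros)
  moreover have "loop_join (sub_path \<gamma> a b) (sub_path \<gamma> b c) = (\<lambda>x. \<gamma> (?u x))"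
  proof
    show "loop_join (sub_path \<gamma> a b) (sub_path \<gamma> b c) x = \<gamma> (?u x)" for x
      by (cases "x \<le> 1/2") (simp_all add: loop_join_def sub_path_def)
  qed
  ultimately show ?thesis by (simp add: sub_path_def)
qed

lemma pathin_subtopology: "pathin (subtopology X A) p \<Longrightarrow> pathin X p"
  unfolding pathin_def by (simp add: continuous_map_in_subtopology)

lemma pathin_open_nbhd:
  assumes "pathin X \<gamma>" "openin X A" "x \<in> {0..1}" "\<gamma> x \<in> A"
  shows "\<exists>d>0. \<forall>t\<in>{0..1}. dist t x < d \<longrightarrow> \<gamma> t \<in> A"
proof -
  have "openin (top_of_set {0..1}) {t \<in> topspace (top_of_set {0..1}). \<gamma> t \<in> A}"
    using assms(1,2) unfolding pathin_def by (rule openin_continuous_map_preimage)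
  then have "openin (top_of_set {0..1}) {t \<in> {0..1}. \<gamma> t \<in> A}" by simp
  then show ?thesis
    using assms(3,4) unfolding openin_euclidean_subtopology_iff by blast
qed

text \<open>One half of the van Kampen theorem. The path is traversed piece by piece; what has been
  traversed so far is deformed into \<open>A\<close>, followed at most by one path in \<open>B\<close>.\<close>

theorem loops_deform_into_open_set:
  assumes A: "openin M A" and B: "openin M B" and cover: "topspace M = A \<union> B" and b: "b \<in> A"
    and B_to_A: "\<And>\<beta>. pathin (subtopology M B) \<beta> \<Longrightarrow> \<beta> 0 \<in> A \<Longrightarrow> \<beta> 1 \<in> A \<Longrightarrow>
                   \<exists>\<beta>'. pathin (subtopology M A) \<beta>' \<and> path_homotopic M \<beta> \<beta>'"
    and \<gamma>: "\<gamma> \<in> loops M b"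
  shows "\<exists>\<gamma>'. \<gamma>' \<in> loops (subtopology M A) b \<and> path_homotopic M \<gamma> \<gamma>'"
proof -
  let ?A = "subtopology M A" and ?B = "subtopology M B"
  have p\<gamma>: "pathin M \<gamma>" "\<gamma> 0 = b" "\<gamma> 1 = b" using \<gamma> by (auto simp: loops_def)
  \<comment> \<open>The second alternative stores a pending piece \<open>\<beta>\<close> in
    \<open>B\<close> that starts in \<open>A\<close> but may end outside it. \<open>B_to_A\<close>
    cannot be applied until the end returns to \<open>A\<close>, so further pieces in
    \<open>B\<close> are merely appended to \<open>\<beta>\<close>.\<close>
  define good where "good \<alpha> \<longleftrightarrow> (\<exists>\<alpha>'. pathin ?A \<alpha>' \<and> path_homotopic M \<alpha> \<alpha>') \<or>
    (\<exists>\<alpha>' \<beta>. pathin ?A \<alpha>' \<and> pathin ?B \<beta> \<and> \<alpha>' 1 = \<beta> 0 \<and> path_homotopic M \<alpha> (loop_join \<alpha>' \<beta>))" for \<alpha>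
  have in_A: "p t \<in> A" if "pathin ?A p" "t \<in> {0..1}" for p t
    using that unfolding pathin_def continuous_map_in_subtopology by auto
  have good_path: "pathin M \<alpha>" if "good \<alpha>" for \<alpha>
    using that path_homotopic_pathin(1) unfolding good_def by blast
  have good_homotopic: "good \<alpha>" if "good \<beta>" "path_homotopic M \<alpha> \<beta>" for \<alpha> \<beta>
    using that(1) path_homotopic_trans[OF that(2)] unfolding good_def by blast
  have good_A: "\<exists>\<alpha>'. pathin ?A \<alpha>' \<and> path_homotopic M \<alpha> \<alpha>'" if \<alpha>: "good \<alpha>" "\<alpha> 1 \<in> A" for \<alpha>
  proof (rule ccontr)
    assume no: "\<not> ?thesis"
    then obtain \<alpha>' \<beta> where *: "pathin ?A \<alpha>'" "pathin ?B \<beta>" "\<alpha>' 1 = \<beta> 0" "path_homotopic M \<alpha> (loop_join \<alpha>' \<beta>)"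
      using \<alpha>(1) unfolding good_def by blast
    have "\<beta> 1 = \<alpha> 1" using path_homotopic_endpoints(2)[OF *(4)] by simp
    then have "\<beta> 0 \<in> A" "\<beta> 1 \<in> A" using in_A[OF *(1), of 1] *(3) \<alpha>(2) by simp_all
    then obtain \<beta>' where \<beta>': "pathin ?A \<beta>'" "path_homotopic M \<beta> \<beta>'" using B_to_A[OF *(2)] by blast
    have "path_homotopic M \<alpha> (loop_join \<alpha>' \<beta>')"
      using *(4) path_homotopic_join[OF path_homotopic_refl[OF pathin_subtopology[OF *(1)]] \<beta>'(2) *(3)]
      by (rule path_homotopic_trans)
    moreover have "pathin ?A (loop_join \<alpha>' \<beta>')"
      using *(1,3) \<beta>' path_homotopic_endpoints(1)[OF \<beta>'(2)] by (intro pathin_loop_join) auto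
    ultimately show False using no by blast
  qed
  have extend_A: "good (loop_join \<alpha> \<epsilon>)" if \<alpha>: "good \<alpha>" and \<epsilon>: "pathin ?A \<epsilon>" "\<alpha> 1 = \<epsilon> 0" for \<alpha> \<epsilon>
  proof -
    have "\<alpha> 1 \<in> A" using in_A[OF \<epsilon>(1), of 0] \<epsilon>(2) by simp
    then obtain \<alpha>' where \<alpha>': "pathin ?A \<alpha>'" "path_homotopic M \<alpha> \<alpha>'" using good_A[OF \<alpha>] by blast
    have "path_homotopic M (loop_join \<alpha> \<epsilon>) (loop_join \<alpha>' \<epsilon>)"
      by (rule path_homotopic_join[OF \<alpha>'(2) path_homotopic_refl[OF pathin_subtopology[OF \<epsilon>(1)]] \<epsilon>(2)])
    moreover have "pathin ?A (loop_join \<alpha>' \<epsilon>)"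
      using \<alpha>' \<epsilon> path_homotopic_endpoints(2)[OF \<alpha>'(2)] by (intro pathin_loop_join) auto
    ultimately show ?thesis unfolding good_def by blast
  qed
  have extend_B: "good (loop_join \<alpha> \<epsilon>)" if \<alpha>: "good \<alpha>" and \<epsilon>: "pathin ?B \<epsilon>" "\<alpha> 1 = \<epsilon> 0" for \<alpha> \<epsilon>
  proof -
    note \<epsilon>M = pathin_subtopology[OF \<epsilon>(1)]
    from \<alpha> consider \<alpha>' where "pathin ?A \<alpha>'" "path_homotopic M \<alpha> \<alpha>'"
      | \<alpha>' \<beta> where "pathin ?A \<alpha>'" "pathin ?B \<beta>" "\<alpha>' 1 = \<beta> 0" "path_homotopic M \<alpha> (loop_join \<alpha>' \<beta>)"
      unfolding good_def by blast
    then show ?thesis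
    proof cases
      case 1
      then have "path_homotopic M (loop_join \<alpha> \<epsilon>) (loop_join \<alpha>' \<epsilon>)" "\<alpha>' 1 = \<epsilon> 0"
        using path_homotopic_join[OF 1(2) path_homotopic_refl[OF \<epsilon>M] \<epsilon>(2)] path_homotopic_endpoints(2)[OF 1(2)] \<epsilon>(2)
        by simp_all
      then show ?thesis using 1(1) \<epsilon>(1) unfolding good_def by blast
    next
      case 2
      have \<beta>\<epsilon>: "\<beta> 1 = \<epsilon> 0" using path_homotopic_endpoints(2)[OF 2(4)] \<epsilon>(2) by simp
      have "path_homotopic M (loop_join \<alpha> \<epsilon>) (loop_join (loop_join \<alpha>' \<beta>) \<epsilon>)"
        by (rule path_homotopic_join[OF 2(4) path_homotopic_refl[OF \<epsilon>M] \<epsilon>(2)])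
      also have "path_homotopic M \<dots> (loop_join \<alpha>' (loop_join \<beta> \<epsilon>))"
        by (rule path_homotopic_join_assoc[OF pathin_subtopology[OF 2(1)] pathin_subtopology[OF 2(2)] \<epsilon>M 2(3) \<beta>\<epsilon>])
      finally show ?thesis
        using 2(1,3) pathin_loop_join[OF 2(2) \<epsilon>(1) \<beta>\<epsilon>] unfolding good_def
        by (intro disjI2 exI[of _ \<alpha>'] exI[of _ "loop_join \<beta> \<epsilon>"]) simp
    qed
  qed
  \<comment> \<open>Quantifying over every good prefix \<open>\<alpha>\<close> makes the property
    pass from two adjacent intervals to their union. Since it also holds on all short intervals
    around each point, \<open>Bolzano\<close> gives it for {0..1} without the choice of a
    subdivision.\<close>
  define P where "P s t \<longleftrightarrow> (0 \<le> s \<longrightarrow> s \<le> t \<longrightarrow> t \<le> 1 \<longrightarrow>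
    (\<forall>\<alpha>. good \<alpha> \<longrightarrow> \<alpha> 1 = \<gamma> s \<longrightarrow> good (loop_join \<alpha> (sub_path \<gamma> s t))))" for s t
  have "P 0 1"
  proof (rule Bolzano)
    fix a b c :: real assume *: "P a b" "P b c" "a \<le> b" "b \<le> c"
    show "P a c"
      unfolding P_def
    proof (intro impI allI)
      fix \<alpha> assume a: "0 \<le> a" "c \<le> 1" and \<alpha>: "good \<alpha>" "\<alpha> 1 = \<gamma> a"
      have ab: "pathin M (sub_path \<gamma> a b)" and bc: "pathin M (sub_path \<gamma> b c)"
        using pathin_subtopology[OF pathin_sub_path[OF p\<gamma>(1), of _ _ UNIV]] a *(3,4) by auto
      have good1: "good (loop_join (loop_join \<alpha> (sub_path \<gamma> a b)) (sub_path \<gamma> b c))"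
        using *(1,2) a \<alpha> *(3,4) unfolding P_def by simp
      have "path_homotopic M (loop_join \<alpha> (sub_path \<gamma> a c)) (loop_join \<alpha> (loop_join (sub_path \<gamma> a b) (sub_path \<gamma> b c)))"
        by (rule path_homotopic_join[OF path_homotopic_refl[OF good_path[OF \<alpha>(1)]]
            path_homotopic_sym[OF path_homotopic_sub_path_join[OF p\<gamma>(1)]]])
          (use a *(3,4) \<alpha>(2) in simp_all)
      also have "path_homotopic M \<dots> (loop_join (loop_join \<alpha> (sub_path \<gamma> a b)) (sub_path \<gamma> b c))"
        by (rule path_homotopic_sym[OF path_homotopic_join_assoc[OF good_path[OF \<alpha>(1)] ab bc]])
          (use \<alpha>(2) in simp_all)
      finally show "good (loop_join \<alpha> (sub_path \<gamma> a c))" by (rule good_homotopic[OF good1])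
    qed
  next
    fix x :: real assume x: "0 \<le> x" "x \<le> 1"
    have local: "\<exists>d>0. \<forall>a b. a \<le> x \<and> x \<le> b \<and> b - a < d \<longrightarrow> P a b"
      if C: "openin M C" "\<gamma> x \<in> C" and
        ext: "\<And>\<alpha> \<epsilon>. good \<alpha> \<Longrightarrow> pathin (subtopology M C) \<epsilon> \<Longrightarrow> \<alpha> 1 = \<epsilon> 0 \<Longrightarrow> good (loop_join \<alpha> \<epsilon>)" for C
    proof -
      obtain d where d: "0 < d" "\<forall>t\<in>{0..1}. dist t x < d \<longrightarrow> \<gamma> t \<in> C"
        using pathin_open_nbhd[OF p\<gamma>(1) C(1) _ C(2)] x by auto
      have "P a b" if ab: "a \<le> x" "x \<le> b" "b - a < d" for a b
        unfolding P_def
      proof (intro impI allI)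
        fix \<alpha> assume *: "0 \<le> a" "a \<le> b" "b \<le> 1" "good \<alpha>" "\<alpha> 1 = \<gamma> a"
        have "\<gamma> t \<in> C" if "t \<in> {a..b}" for t using d(2) that ab * by (auto simp: dist_real_def)
        then show "good (loop_join \<alpha> (sub_path \<gamma> a b))"
          using * pathin_sub_path[OF p\<gamma>(1)] by (intro ext) auto
      qed
      then show ?thesis using d(1) by blast
    qed
    have "\<gamma> x \<in> A \<union> B"
      using p\<gamma>(1) x cover unfolding pathin_def continuous_map_def by auto
    then show "\<exists>d>0. \<forall>a b. a \<le> x \<and> x \<le> b \<and> b - a < d \<longrightarrow> P a b"
      using local[OF A _ extend_A] local[OF B _ extend_B] by blast
  qed simp
  moreover have "good (\<lambda>_. b)"
  proof -
    have "pathin ?A (\<lambda>_. b)" using b cover by (auto simp: pathin_def)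
    then show ?thesis using path_homotopic_refl[OF pathin_subtopology] unfolding good_def by blast
  qed
  ultimately have "good (loop_join (\<lambda>_. b) \<gamma>)"
    using p\<gamma>(2) unfolding P_def by (simp add: sub_path_def)
  then have "good \<gamma>"
    using path_homotopic_sym[OF path_homotopic_join_const_left[OF p\<gamma>(1,2)]] by (rule good_homotopic)
  then obtain \<gamma>' where \<gamma>': "pathin ?A \<gamma>'" "path_homotopic M \<gamma> \<gamma>'" using good_A[of \<gamma>] p\<gamma>(3) b by auto
  then show ?thesis
    using path_homotopic_endpoints[OF \<gamma>'(2)] p\<gamma> by (auto simp: loops_def)
qed

section \<open>Countability of the fundamental group\<close>

lemma subdivision_index:
  fixes t :: real
  assumes "t \<in> {0..1}" "0 < n"
  shows "\<exists>k<n. t \<in> {real k / real n..real (Suc k) / real n}"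
proof (cases "t = 1")
  case True
  then show ?thesis using assms(2) by (intro exI[of _ "n - 1"]) (auto simp: field_simps of_nat_diff)
next
  case False
  define k where "k = nat \<lfloor>t * n\<rfloor>"
  have "0 \<le> t * n" "t * n < n" using assms False by auto
  then have "real k \<le> t * n" "t * n < real k + 1" "k < n"
    unfolding k_def by linarith+
  then show ?thesis using assms(2) by (intro exI[of _ k]) (auto simp: field_simps)
qed

text \<open>Two loops that run through the same finite chain of balls are joined by the straight-line
  homotopy, and countably many balls suffice.\<close>

theorem countable_fundamental_group_nbhd_retract:
  fixes S U :: "'a::euclidean_space set"
  assumes U: "open U" "S \<subseteq> U" and r: "continuous_on U r" "r ` U \<subseteq> S" "\<And>x. x \<in> S \<Longrightarrow> r x = x"
  shows "countable (carrier (fundamental_group (top_of_set S) x))"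
proof -
  obtain D :: "'a set" where D: "countable D" "\<And>X. open X \<Longrightarrow> X \<noteq> {} \<Longrightarrow> \<exists>d\<in>D. d \<in> X"
    using countable_dense_setE by blast
  \<comment> \<open>Countably many centres and radii leave countably many balls. Only those inside
    \<open>U\<close> are kept, so that segments within one ball stay where \<open>r\<close> is
    defined.\<close>
  define \<B> where "\<B> = {B \<in> (\<lambda>(c, n). ball c (inverse (real (Suc n)))) ` (D \<times> UNIV). B \<subseteq> U}"
  have "countable \<B>"
  proof (rule countable_subset)
    show "\<B> \<subseteq> (\<lambda>(c, n). ball c (inverse (real (Suc n)))) ` (D \<times> UNIV)" by (auto simp: \<B>_def)
    show "countable ((\<lambda>(c, n). ball c (inverse (real (Suc n)))) ` (D \<times> (UNIV :: nat set)))"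
      by (rule countable_image) (use D(1) in simp)
  qed
  \<comment> \<open>\<open>Bs\<close> is an itinerary: the \<open>k\<close>-th of
    \<open>length Bs\<close> equal subintervals is sent into the \<open>k\<close>-th ball. There are
    only countably many finite lists over \<open>\<B>\<close>, and each will determine at most one
    class.\<close>
  define fits where "fits p Bs \<longleftrightarrow> Bs \<in> lists \<B> \<and> Bs \<noteq> [] \<and>
     (\<forall>k<length Bs. \<forall>t\<in>{real k / length Bs..real (Suc k) / length Bs}. p t \<in> Bs ! k)"
    for p :: "real \<Rightarrow> 'a" and Bs
  have loop: "continuous_on {0..1} p" "p ` {0..1} \<subseteq> S" "p 0 = x" "p 1 = x"
    if "p \<in> loops (top_of_set S) x" for p
    using that by (auto simp: loops_def pathin_def)
  have unique: "loop_class (top_of_set S) x p = loop_class (top_of_set S) x q"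
    if p: "p \<in> loops (top_of_set S) x" "fits p Bs" and q: "q \<in> loops (top_of_set S) x" "fits q Bs"
    for p q Bs
  proof (rule loop_class_eqI[OF _ p(1)])
    let ?l = "\<lambda>z. (1 - fst z) *\<^sub>R p (snd z) + fst z *\<^sub>R q (snd z)"
    have "?l (s, t) \<in> U" if st: "s \<in> {0..1}" "t \<in> {0..1}" for s t
    proof -
      obtain k where k: "k < length Bs" "t \<in> {real k / length Bs..real (Suc k) / length Bs}"
        using subdivision_index[OF st(2), of "length Bs"] p(2) unfolding fits_def by auto
      then have pq: "p t \<in> Bs ! k" "q t \<in> Bs ! k" using p(2) q(2) unfolding fits_def by blast+
      have "Bs ! k \<in> \<B>" using p(2) k(1) unfolding fits_def by auto
      then have "convex (Bs ! k)" "Bs ! k \<subseteq> U" unfolding \<B>_def by auto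
      then show ?thesis using convexD_alt[OF _ pq, of s] st(1) by auto
    qed
    then have im: "?l ` ({0..1} \<times> {0..1}) \<subseteq> U" by auto
    have "continuous_on ({0..1} \<times> {0..1}) ?l"
      by (intro continuous_intros continuous_on_compose2[OF loop(1)[OF p(1)]]
          continuous_on_compose2[OF loop(1)[OF q(1)]]) auto
    then have "continuous_on ({0..1} \<times> {0..1}) (\<lambda>z. r (?l z))"
      by (rule continuous_on_compose2[OF r(1) _ im])
    then have cont: "continuous_map (top_of_set ({0..1} \<times> {0..1})) (top_of_set S) (\<lambda>z. r (?l z))"
      using im r(2) by fastforce
    have "x \<in> S" using loop(2,3)[OF p(1)] by force
    show "path_homotopic (top_of_set S) p q"
      unfolding path_homotopic_iff
    proof (intro exI conjI ballI)
      show "r (?l (0, t)) = p t" "r (?l (1, t)) = q t" if "t \<in> {0..1}" for t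
        using r(3)[of "p t"] r(3)[of "q t"] that loop(2)[OF p(1)] loop(2)[OF q(1)]
        by (simp_all add: image_subset_iff)
      show "r (?l (s, 0)) = p 0" "r (?l (s, 1)) = p 1" for s
        using loop(3,4)[OF p(1)] loop(3,4)[OF q(1)] r(3)[OF \<open>x \<in> S\<close>] by (simp_all flip: scaleR_left_distrib)
    qed (rule cont)
  qed
  have ex: "\<exists>Bs. fits p Bs" if p: "p \<in> loops (top_of_set S) x" for p
  proof -
    have "compact (p ` {0..1})" by (intro compact_continuous_image loop(1) p) simp
    moreover have "p ` {0..1} \<subseteq> U" using loop(2)[OF p] U(2) by blast
    ultimately obtain e where e: "0 < e" "(\<Union>y\<in>p ` {0..1}. ball y e) \<subseteq> U"
      using compact_subset_open_imp_ball_epsilon_subset[OF _ U(1)] by metis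
    obtain m where m: "inverse (real (Suc m)) < e / 2" using reals_Archimedean[of "e / 2"] e(1) by auto
    \<comment> \<open>With \<epsilon> below half of \<open>e\<close>, a centre within \<epsilon>/2
      of \<open>p (k / N)\<close> has its \<epsilon>-ball inside the \<open>e\<close>-ball around
      that point. The other half of \<epsilon> absorbs the oscillation of \<open>p\<close> on one
      subinterval.\<close>
    define \<epsilon> where "\<epsilon> = inverse (real (Suc m))"
    have \<epsilon>: "0 < \<epsilon>" "\<epsilon> < e / 2" using m by (simp_all add: \<epsilon>_def)
    have "uniformly_continuous_on {0..1} p" using loop(1)[OF p] by (simp add: compact_uniformly_continuous)
    then obtain d where d: "0 < d" "\<And>s t. s \<in> {0..1} \<Longrightarrow> t \<in> {0..1} \<Longrightarrow> dist t s < d \<Longrightarrow> dist (p t) (p s) < \<epsilon> / 2"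
      using \<epsilon>(1) half_gt_zero unfolding uniformly_continuous_on_def by meson
    obtain n where "inverse (real (Suc n)) < d" using reals_Archimedean[OF d(1)] by auto
    define N where "N = Suc n"
    have N: "0 < N" "1 / real N < d" using \<open>inverse (real (Suc n)) < d\<close> by (simp_all add: N_def field_simps)
    have "\<forall>k. \<exists>c\<in>D. dist c (p (real k / N)) < \<epsilon> / 2"
    proof
      fix k
      show "\<exists>c\<in>D. dist c (p (real k / N)) < \<epsilon> / 2"
        using D(2)[of "ball (p (real k / N)) (\<epsilon> / 2)"] \<epsilon>(1) by (auto simp: dist_commute)
    qed
    then obtain c where c: "\<And>k. c k \<in> D" "\<And>k. dist (c k) (p (real k / N)) < \<epsilon> / 2" by metis
    define Bs where "Bs = map (\<lambda>k. ball (c k) \<epsilon>) [0..<N]"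
    have "ball (c k) \<epsilon> \<in> \<B>" if "k < N" for k
    proof -
      have "real k / N \<in> {0..1}" using that by auto
      then have "ball (p (real k / N)) e \<subseteq> U" using e(2) by blast
      moreover have "ball (c k) \<epsilon> \<subseteq> ball (p (real k / N)) e"
      proof
        fix z assume "z \<in> ball (c k) \<epsilon>"
        then have "dist (p (real k / N)) z < e"
          using dist_triangle[of "p (real k / N)" z "c k"] c(2)[of k] \<epsilon> by (simp add: dist_commute)
        then show "z \<in> ball (p (real k / N)) e" by simp
      qed
      ultimately have "ball (c k) \<epsilon> \<subseteq> U" by blast
      then show ?thesis using c(1)[of k] unfolding \<B>_def \<epsilon>_def by force
    qed
    moreover have "p t \<in> ball (c k) \<epsilon>" if k: "k < N" and t: "t \<in> {real k / N..real (Suc k) / N}" for k t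
    proof -
      have I: "real k / N \<in> {0..1}" "real (Suc k) / N \<le> 1" "0 \<le> real k / N" using k by auto
      have "t - real k / N \<le> 1 / N" using t by (auto simp: add_divide_distrib)
      then have "dist t (real k / N) < d" using t N by (auto simp: dist_real_def)
      moreover have "t \<in> {0..1}" using t I(2,3) by (meson atLeastAtMost_iff order_trans)
      ultimately have "dist (p t) (p (real k / N)) < \<epsilon> / 2" using d(2)[OF I(1)] by blast
      then show ?thesis using c(2)[of k] dist_triangle[of "c k" "p t" "p (real k / N)"] by (simp add: dist_commute)
    qed
    ultimately have "fits p Bs" using N(1) unfolding fits_def Bs_def by auto
    then show ?thesis ..
  qed
  let ?C = "\<lambda>Bs. {loop_class (top_of_set S) x p |p. p \<in> loops (top_of_set S) x \<and> fits p Bs}"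
  have "countable (?C Bs)" for Bs
  proof (cases "?C Bs = {}")
    case False
    then obtain p where "p \<in> loops (top_of_set S) x" "fits p Bs" by blast
    note p = this
    have "?C Bs \<subseteq> {loop_class (top_of_set S) x p}"
    proof
      fix a assume "a \<in> ?C Bs"
      then obtain q where q: "q \<in> loops (top_of_set S) x" "fits q Bs" "a = loop_class (top_of_set S) x q" by blast
      show "a \<in> {loop_class (top_of_set S) x p}" using unique[OF q(1,2) p] q(3) by simp
    qed
    then show ?thesis by (rule countable_subset) simp
  next
    case True
    then show ?thesis by (simp only: countable_empty)
  qed
  then have "countable (\<Union>Bs\<in>lists \<B>. ?C Bs)"
    by (rule countable_UN[OF countable_lists[OF \<open>countable \<B>\<close>]])
  moreover have "carrier (fundamental_group (top_of_set S) x) \<subseteq> (\<Union>Bs\<in>lists \<B>. ?C Bs)"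
  proof
    fix a assume "a \<in> carrier (fundamental_group (top_of_set S) x)"
    then obtain p where p: "p \<in> loops (top_of_set S) x" "a = loop_class (top_of_set S) x p" by auto
    obtain Bs where Bs: "fits p Bs" using ex[OF p(1)] by blast
    show "a \<in> (\<Union>Bs\<in>lists \<B>. ?C Bs)"
    proof (rule UN_I)
      show "Bs \<in> lists \<B>" using Bs by (simp add: fits_def)
      show "a \<in> ?C Bs" using p Bs by blast
    qed
  qed
  ultimately show ?thesis using countable_subset by blast
qed

section \<open>Actions of countable left-ordered groups on the line\<close>

locale dense_unbounded_order =
  fixes A :: "'a set" and lt :: "'a \<Rightarrow> 'a \<Rightarrow> bool"
  assumes irrefl: "x \<in> A \<Longrightarrow> \<not> lt x x"
    and trans: "x \<in> A \<Longrightarrow> y \<in> A \<Longrightarrow> z \<in> A \<Longrightarrow> lt x y \<Longrightarrow> lt y z \<Longrightarrow> lt x z"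
    and total: "x \<in> A \<Longrightarrow> y \<in> A \<Longrightarrow> x = y \<or> lt x y \<or> lt y x"
    and dense: "x \<in> A \<Longrightarrow> y \<in> A \<Longrightarrow> lt x y \<Longrightarrow> \<exists>z\<in>A. lt x z \<and> lt z y"
    and above: "x \<in> A \<Longrightarrow> \<exists>y\<in>A. lt x y"
    and below: "x \<in> A \<Longrightarrow> \<exists>y\<in>A. lt y x"
    and nonempty: "A \<noteq> {}"
begin

text \<open>Reversing the order exchanges \<open>above\<close> and \<open>below\<close>; facts on
  greatest elements thereby yield those on least elements.\<close>

lemma converse: "dense_unbounded_order A (\<lambda>x y. lt y x)"
proof
  fix x y z assume *: "x \<in> A" "y \<in> A" "z \<in> A" "lt y x" "lt z y"
  show "lt z x" by (rule trans[OF *(3,2,1,5,4)])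
next
  fix x y assume *: "x \<in> A" "y \<in> A"
  show "x = y \<or> lt y x \<or> lt x y" using total[OF *] by blast
  assume "lt y x"
  then show "\<exists>z\<in>A. lt z x \<and> lt y z" using dense[OF *(2,1)] by blast
qed (use irrefl above below nonempty in auto)

lemma finite_has_greatest:
  assumes "finite L" "L \<noteq> {}" "L \<subseteq> A"
  shows "\<exists>m\<in>L. \<forall>l\<in>L. l = m \<or> lt l m"
  using assms
proof (induction L rule: finite_ne_induct)
  case (insert x L)
  then obtain m where m: "m \<in> L" "\<forall>l\<in>L. l = m \<or> lt l m" by auto
  have A: "x \<in> A" "m \<in> A" "L \<subseteq> A" using insert.prems m(1) by auto
  show ?case
  proof (cases "lt m x")
    case True
    have "lt l x" if "l \<in> L" for l
    proof (cases "l = m")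
      case False
      then have "lt l m" using m(2) that by blast
      then show ?thesis using trans[OF _ A(2,1) _ True] that A(3) by blast
    qed (use True in simp)
    then show ?thesis by blast
  next
    case False
    then have "x = m \<or> lt x m" using total[OF A(1,2)] by blast
    then show ?thesis using m by blast
  qed
qed simp

text \<open>Only the greatest element of \<open>L\<close> and the least of \<open>U\<close> matter:
  density gives a point between them, and \<open>above\<close>, \<open>below\<close> or
  \<open>nonempty\<close> takes over when a side is empty. This is the extension property behind the
  back-and-forth construction.\<close>

lemma finite_cut_filled:
  assumes L: "finite L" "L \<subseteq> A" and U: "finite U" "U \<subseteq> A"
    and LU: "\<And>l u. l \<in> L \<Longrightarrow> u \<in> U \<Longrightarrow> lt l u"
  shows "\<exists>b\<in>A. (\<forall>l\<in>L. lt l b) \<and> (\<forall>u\<in>U. lt b u)"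
proof -
  interpret conv: dense_unbounded_order A "\<lambda>x y. lt y x" by (rule converse)
  have over_L: "\<forall>l\<in>L. lt l b" if m: "m \<in> L" "\<forall>l\<in>L. l = m \<or> lt l m" and b: "lt m b" "b \<in> A" for m b
  proof
    fix l assume "l \<in> L"
    then show "lt l b" using m b trans[OF _ _ b(2) _ b(1), of l] L(2) by (cases "l = m") auto
  qed
  have under_U: "\<forall>u\<in>U. lt b u" if m: "m \<in> U" "\<forall>u\<in>U. u = m \<or> lt m u" and b: "lt b m" "b \<in> A" for m b
  proof
    fix u assume "u \<in> U"
    then show "lt b u" using m b trans[OF b(2) _ _ b(1), of u] U(2) by (cases "u = m") auto
  qed
  consider "L = {}" "U = {}" | "L \<noteq> {}" "U = {}" | "L = {}" "U \<noteq> {}" | "L \<noteq> {}" "U \<noteq> {}" by blast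
  then show ?thesis
  proof cases
    case 1 then show ?thesis using nonempty by blast
  next
    case 2
    obtain m where m: "m \<in> L" "\<forall>l\<in>L. l = m \<or> lt l m" using finite_has_greatest[OF L(1) 2(1) L(2)] by blast
    obtain b where "b \<in> A" "lt m b" using above[of m] m(1) L by blast
    then show ?thesis using over_L[OF m] 2 by blast
  next
    case 3
    obtain m where m: "m \<in> U" "\<forall>u\<in>U. u = m \<or> lt m u" using conv.finite_has_greatest[OF U(1) 3(2) U(2)] by blast
    obtain b where "b \<in> A" "lt b m" using below[of m] m(1) U by blast
    then show ?thesis using under_U[OF m] 3 by blast
  next
    case 4
    obtain m where m: "m \<in> L" "\<forall>l\<in>L. l = m \<or> lt l m" using finite_has_greatest[OF L(1) 4(1) L(2)] by blast
    obtain n where n: "n \<in> U" "\<forall>u\<in>U. u = n \<or> lt n u" using conv.finite_has_greatest[OF U(1) 4(2) U(2)] by blast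
    obtain b where "b \<in> A" "lt m b" "lt b n" using dense[OF _ _ LU[OF m(1) n(1)]] m(1) n(1) L U by blast
    then show ?thesis using over_L[OF m] under_U[OF n] by blast
  qed
qed

end

definition order_matching :: "('a \<Rightarrow> 'a \<Rightarrow> bool) \<Rightarrow> ('b \<Rightarrow> 'b \<Rightarrow> bool) \<Rightarrow> ('a \<times> 'b) set \<Rightarrow> bool" where
  "order_matching ltA ltB P \<longleftrightarrow>
     (\<forall>a b a' b'. (a, b) \<in> P \<longrightarrow> (a', b') \<in> P \<longrightarrow> ltA a a' \<longleftrightarrow> ltB b b')"

text \<open>The partners of the points of \<open>P\<close> below \<open>a\<close> and above
  \<open>a\<close> form a finite cut in \<open>B\<close>, and any point filling it can serve as the
  partner of \<open>a\<close>. A point already matched keeps its partner.\<close>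

lemma order_matching_extend:
  assumes A: "dense_unbounded_order A ltA" and B: "dense_unbounded_order B ltB"
    and P: "finite P" "P \<subseteq> A \<times> B" "order_matching ltA ltB P" and a: "a \<in> A"
  shows "\<exists>b\<in>B. order_matching ltA ltB (insert (a, b) P)"
proof (cases "a \<in> fst ` P")
  case True
  then obtain b where "(a, b) \<in> P" by auto
  then show ?thesis using P by (intro bexI[of _ b]) (auto simp: insert_absorb)
next
  case False
  interpret A: dense_unbounded_order A ltA by (rule A)
  interpret B: dense_unbounded_order B ltB by (rule B)
  let ?L = "{l. \<exists>x. (x, l) \<in> P \<and> ltA x a}" and ?U = "{u. \<exists>y. (y, u) \<in> P \<and> ltA a y}"
  have fin: "finite ?L" "finite ?U"
    by (rule finite_subset[OF _ finite_imageI[OF P(1), of snd]], force)+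
  have sub: "?L \<subseteq> B" "?U \<subseteq> B" using P(2) by auto
  have "ltB l u" if lu: "l \<in> ?L" "u \<in> ?U" for l u
  proof -
    obtain x where x: "(x, l) \<in> P" "ltA x a" using lu(1) by blast
    obtain y where y: "(y, u) \<in> P" "ltA a y" using lu(2) by blast
    have "ltA x y" using A.trans[OF _ a _ x(2) y(2)] x(1) y(1) P(2) by blast
    then show ?thesis using x y P(3) unfolding order_matching_def by blast
  qed
  then obtain b where b: "b \<in> B" "\<forall>l\<in>?L. ltB l b" "\<forall>u\<in>?U. ltB b u"
    using B.finite_cut_filled[OF fin(1) sub(1) fin(2) sub(2)] by blast
  have "(ltA a a' \<longleftrightarrow> ltB b b') \<and> (ltA a' a \<longleftrightarrow> ltB b' b)" if ab': "(a', b') \<in> P" for a' b'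
  proof -
    have in_AB: "a' \<in> A" "b' \<in> B" "a' \<noteq> a" using ab' P(2) False by force+
    have 1: "ltB b' b" if "ltA a' a" using that ab' b(2) by blast
    have 2: "ltB b b'" if "ltA a a'" using that ab' b(3) by blast
    have "\<not> (ltA a a' \<and> ltA a' a)" using A.trans[OF a in_AB(1) a] A.irrefl[OF a] by blast
    moreover have "\<not> (ltB b b' \<and> ltB b' b)" using B.trans[OF b(1) in_AB(2) b(1)] B.irrefl[OF b(1)] by blast
    ultimately show ?thesis
      using 1 2 in_AB(3) A.total[OF in_AB(1) a] by blast
  qed
  then have "order_matching ltA ltB (insert (a, b) P)"
    using P(3) A.irrefl[OF a] B.irrefl[OF b(1)] unfolding order_matching_def by auto
  then show ?thesis using b(1) by blast
qed

lemma order_matching_converse: "order_matching ltA ltB P \<longleftrightarrow> order_matching ltB ltA (P\<inverse>)"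
  unfolding order_matching_def by auto

theorem countable_dense_unbounded_orders_isomorphic:
  assumes A: "dense_unbounded_order A ltA" "countable A" and B: "dense_unbounded_order B ltB" "countable B"
  obtains f where "bij_betw f A B" "\<And>x y. x \<in> A \<Longrightarrow> y \<in> A \<Longrightarrow> ltA x y \<longleftrightarrow> ltB (f x) (f y)"
proof -
  interpret A: dense_unbounded_order A ltA by (rule A)
  interpret B: dense_unbounded_order B ltB by (rule B)
  note ne = A.nonempty B.nonempty
  let ?a = "from_nat_into A" and ?b = "from_nat_into B"
  let ?Q = "\<lambda>(n::nat) P. finite P \<and> P \<subseteq> A \<times> B \<and> order_matching ltA ltB P"
  \<comment> \<open>Stage \<open>n\<close> matches the \<open>n\<close>-th element of both
    enumerations, so the union of the stages is total on both sides. The step back from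
    \<open>B\<close> to \<open>A\<close> is the same extension lemma applied to the converse
    relation.\<close>
  let ?R = "\<lambda>n P P'. P \<subseteq> P' \<and> ?a n \<in> fst ` P' \<and> ?b n \<in> snd ` P'"
  have "\<exists>F. \<forall>n. ?Q n (F n) \<and> ?R n (F n) (F (Suc n))"
  proof (rule dependent_nat_choice)
    show "\<exists>P. ?Q 0 P" by (intro exI[of _ "{}"]) (auto simp: order_matching_def)
    fix P n assume P: "?Q n P"
    obtain b where b: "b \<in> B" "order_matching ltA ltB (insert (?a n, b) P)"
      using order_matching_extend[OF A(1) B(1)] P from_nat_into[OF ne(1)] by blast
    let ?P = "insert (?a n, b) P"
    have "finite (?P\<inverse>)" "?P\<inverse> \<subseteq> B \<times> A" "order_matching ltB ltA (?P\<inverse>)"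
      using P b from_nat_into[OF ne(1)] order_matching_converse by auto
    then obtain a where a: "a \<in> A" "order_matching ltB ltA (insert (?b n, a) (?P\<inverse>))"
      using order_matching_extend[OF B(1) A(1)] from_nat_into[OF ne(2)] by blast
    have "insert (?b n, a) (?P\<inverse>) = (insert (a, ?b n) ?P)\<inverse>" by auto
    then have "order_matching ltA ltB (insert (a, ?b n) ?P)"
      using a(2) order_matching_converse by metis
    then show "\<exists>P'. ?Q (Suc n) P' \<and> ?R n P P'"
      using P a(1) b(1) from_nat_into[OF ne(1)] from_nat_into[OF ne(2)]
      by (intro exI[of _ "insert (a, ?b n) ?P"]) force
  qed
  then obtain F where F: "\<And>n. ?Q n (F n)" "\<And>n. ?R n (F n) (F (Suc n))" by blast
  define P where "P = (\<Union>n. F n)"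
  have mono: "F m \<subseteq> F n" if "m \<le> n" for m n
    using lift_Suc_mono_le[of F, OF _ that] F(2) by blast
  have match: "ltA a a' \<longleftrightarrow> ltB b b'" if PP: "(a, b) \<in> P" "(a', b') \<in> P" for a b a' b'
  proof -
    obtain m n where "(a, b) \<in> F m" "(a', b') \<in> F n" using PP unfolding P_def by blast
    then have "(a, b) \<in> F (max m n)" "(a', b') \<in> F (max m n)" using mono[of m "max m n"] mono[of n "max m n"] by auto
    then show ?thesis using F(1)[of "max m n"] unfolding order_matching_def by blast
  qed
  have PAB: "P \<subseteq> A \<times> B" using F(1) by (auto simp: P_def)
  have uniq: "a = a' \<longleftrightarrow> b = b'" if "(a, b) \<in> P" "(a', b') \<in> P" for a b a' b'
  proof -
    have *: "a \<in> A" "a' \<in> A" "b \<in> B" "b' \<in> B" using that PAB by auto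
    show ?thesis
      using match[OF that] match[OF that(2,1)] A.total[OF *(1,2)] B.total[OF *(3,4)]
        A.irrefl[OF *(1)] B.irrefl[OF *(3)] by blast
  qed
  have totA: "\<exists>b. (a, b) \<in> P" if a: "a \<in> A" for a
  proof -
    obtain n where "a = ?a n" using from_nat_into_surj[OF A(2) a] by metis
    then have "a \<in> fst ` F (Suc n)" using F(2) by blast
    then show ?thesis by (force simp: P_def)
  qed
  have totB: "\<exists>a. (a, b) \<in> P" if b: "b \<in> B" for b
  proof -
    obtain n where "b = ?b n" using from_nat_into_surj[OF B(2) b] by metis
    then have "b \<in> snd ` F (Suc n)" using F(2) by blast
    then show ?thesis by (force simp: P_def)
  qed
  obtain f where f: "\<And>a. a \<in> A \<Longrightarrow> (a, f a) \<in> P" using totA by metis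
  have "bij_betw f A B"
  proof (rule bij_betwI')
    show "f x = f y \<longleftrightarrow> x = y" if "x \<in> A" "y \<in> A" for x y using uniq f that by blast
    show "f x \<in> B" if "x \<in> A" for x using f[OF that] PAB by blast
    show "\<exists>x\<in>A. y = f x" if "y \<in> B" for y
    proof -
      obtain a where a: "(a, y) \<in> P" using totB[OF \<open>y \<in> B\<close>] by blast
      then have "a \<in> A" using PAB by blast
      then show ?thesis using uniq[OF a f[of a]] by blast
    qed
  qed
  then show thesis using f match by (intro that[of f]) blast+
qed

section \<open>From order automorphisms of the rationals to homeomorphisms of the line\<close>

definition real_extension :: "(rat \<Rightarrow> rat) \<Rightarrow> real \<Rightarrow> real" where
  "real_extension f x = Sup {of_rat (f q) |q. of_rat q < x}"

text \<open>Once \<open>f\<close> is onto, this cut determines the extended value completely, so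
  identities between extensions can be checked on rational cuts. For strictness a further rational
  \<open>r\<close> is inserted between \<open>q\<close> and \<open>x\<close>, since membership of
  \<open>f q\<close> in the set gives only a weak inequality.\<close>

lemma real_extension_cut:
  assumes "strict_mono f"
  shows "of_rat (f q) < real_extension f x \<longleftrightarrow> of_rat q < x"
proof -
  let ?S = "{of_rat (f q) :: real |q. of_rat q < x}"
  obtain q0 where q0: "x < of_rat q0" using of_rat_dense[of x "x + 1"] by auto
  have "y \<le> of_rat (f q0)" if y: "y \<in> ?S" for y
  proof -
    obtain q where q: "y = of_rat (f q)" "of_rat q < x" using y by blast
    then have "of_rat q < (of_rat q0 :: real)" using q0 by linarith
    then have "f q < f q0" using assms by (simp add: of_rat_less strict_mono_less)
    then show ?thesis by (simp add: q(1) of_rat_less_eq)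
  qed
  then have bdd: "bdd_above ?S" by (meson bdd_above.I)
  obtain q1 where "of_rat q1 < x" using of_rat_dense[of "x - 1" x] by auto
  then have ne: "?S \<noteq> {}" by blast
  show ?thesis
  proof
    assume "of_rat q < x"
    then obtain r where r: "of_rat q < (of_rat r :: real)" "of_rat r < x" using of_rat_dense by blast
    then have "of_rat (f q) < (of_rat (f r) :: real)"
      using assms by (simp add: of_rat_less strict_mono_less)
    also have "\<dots> \<le> real_extension f x"
      unfolding real_extension_def using r by (intro cSup_upper bdd) blast
    finally show "of_rat (f q) < real_extension f x" .
  next
    assume less: "of_rat (f q) < real_extension f x"
    then obtain y where "y \<in> ?S" "of_rat (f q) < y"
      unfolding real_extension_def using less_cSup_iff[OF ne bdd] by blast
    then obtain r where "of_rat r < x" "of_rat (f q) < (of_rat (f r) :: real)" by auto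
    then have "of_rat q < (of_rat r :: real)" "of_rat r < x"
      using assms by (simp_all add: of_rat_less strict_mono_less)
    then show "of_rat q < x" by linarith
  qed
qed

lemma real_eqI_rat_cut:
  fixes x y :: real
  assumes "\<And>q. of_rat q < x \<longleftrightarrow> of_rat q < y"
  shows "x = y"
proof (rule linorder_cases[of x y])
  assume "x < y"
  then obtain q where "x < of_rat q" "of_rat q < y" using of_rat_dense by blast
  then show ?thesis using assms[of q] by simp
next
  assume "y < x"
  then obtain q where "y < of_rat q" "of_rat q < x" using of_rat_dense by blast
  then show ?thesis using assms[of q] by simp
qed

text \<open>Surjectivity allows an arbitrary rational to be written as \<open>f (g r)\<close>; on
  either side its position relative to the value then reduces to that of \<open>r\<close> relative
  to \<open>x\<close>.\<close>

lemma real_extension_comp: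
  assumes "strict_mono f" "strict_mono g" "surj f" "surj g"
  shows "real_extension (f \<circ> g) x = real_extension f (real_extension g x)"
proof (rule real_eqI_rat_cut)
  fix q
  obtain r where r: "q = f (g r)" using assms(3,4) by (metis surjD)
  have "strict_mono (f \<circ> g)" using assms by (simp add: strict_mono_def)
  from real_extension_cut[OF this, of r x]
  show "of_rat q < real_extension (f \<circ> g) x \<longleftrightarrow> of_rat q < real_extension f (real_extension g x)"
    by (simp add: r real_extension_cut assms)
qed

lemma real_extension_id: "real_extension (\<lambda>q. q) x = x"
  by (rule real_eqI_rat_cut) (use real_extension_cut[of "\<lambda>q. q"] in \<open>simp add: strict_mono_def\<close>)

lemma strict_mono_real_extension:
  assumes "strict_mono f" shows "strict_mono (real_extension f)"
proof (rule strict_monoI)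
  fix x y :: real assume "x < y"
  then obtain q where q: "x < of_rat q" "of_rat q < y" using of_rat_dense by blast
  then show "real_extension f x < real_extension f y"
    using real_extension_cut[OF assms, of q x] real_extension_cut[OF assms, of q y] by simp
qed

text \<open>A monotone map onto the line has no jumps and is therefore continuous. The inverse is
  again monotone and onto, so the same argument covers it.\<close>

lemma strict_mono_surj_homeo:
  assumes "strict_mono f" "surj f" shows "f \<in> carrier Homeo_plus"
proof -
  define g where "g = inv_into UNIV f"
  have fg: "f (g x) = x" for x using assms(2) by (simp add: g_def surj_f_inv_f)
  have gf: "g (f x) = x" for x using strict_mono_imp_inj_on[OF assms(1)] by (simp add: g_def)
  have "strict_mono g"
    by (rule strict_monoI) (metis assms(1) fg strict_mono_less)
  have "surj g" using gf by (metis surjI)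
  have "continuous_on UNIV f" "continuous_on UNIV g"
    using assms \<open>strict_mono g\<close> \<open>surj g\<close> by (auto intro!: continuous_onI_mono simp: strict_mono_less_eq)
  then have "homeomorphism UNIV UNIV f g"
    using fg gf assms(2) \<open>surj g\<close> by (intro homeomorphismI) auto
  then show ?thesis using assms(1) by (auto simp: Homeo_plus_def)
qed

text \<open>Some \<open>b\<close> is greater than the identity: \<open>a\<close> or
  \<open>inv a\<close>, for any \<open>a\<close> other than the identity. Translating the inequality
  on the left by \<open>g\<close> places \<open>g \<otimes> b\<close> above
  \<open>g\<close>.\<close>

lemma left_ordered_group_unbounded:
  fixes G (structure)
  assumes "group G" "\<And>f g h. f \<in> carrier G \<Longrightarrow> g \<in> carrier G \<Longrightarrow> h \<in> carrier G \<Longrightarrow>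
      (g, h) \<in> r \<Longrightarrow> (f \<otimes>\<^bsub>G\<^esub> g, f \<otimes>\<^bsub>G\<^esub> h) \<in> r"
    and "linear_order_on (carrier G) r" "carrier G \<noteq> {\<one>\<^bsub>G\<^esub>}" "g \<in> carrier G"
  shows "\<exists>h\<in>carrier G. (g, h) \<in> r \<and> g \<noteq> h"
proof -
  interpret group G by fact
  obtain a where a: "a \<in> carrier G" "a \<noteq> \<one>" using assms(4) one_closed by blast
  have tot: "(a, \<one>) \<in> r \<or> (\<one>, a) \<in> r"
    using assms(3) a unfolding linear_order_on_def total_on_def by auto
  have "\<exists>b\<in>carrier G. (\<one>, b) \<in> r \<and> b \<noteq> \<one>"
  proof (cases "(\<one>, a) \<in> r")
    case False
    then have "(inv a \<otimes> a, inv a \<otimes> \<one>) \<in> r" using tot assms(2) a by blast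
    then have "(\<one>, inv a) \<in> r" "inv a \<noteq> \<one>" using a by (auto simp: inv_eq_1_iff)
    then show ?thesis using a by blast
  qed (use a in blast)
  then obtain b where b: "b \<in> carrier G" "(\<one>, b) \<in> r" "b \<noteq> \<one>" by blast
  then have "(g \<otimes> \<one>, g \<otimes> b) \<in> r" using assms(2,5) by blast
  then show ?thesis using b assms(5) by (intro bexI[of _ "g \<otimes> b"]) auto
qed

text \<open>The group acts by left translation on the first factor of \<open>D\<close>, its
  lexicographic product with the rationals. Cantor's theorem, which asks for countability,
  identifies \<open>D\<close> with the rationals, and \<open>real_extension\<close> carries the
  action to the line. There is no common fixed point because translations move any layer of
  \<open>D\<close> above any other.\<close>

theorem countable_left_orderable_acts_on_line:
  fixes G (structure)
  assumes "group G" "left_orderable G" "countable (carrier G)"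
  obtains \<rho> where "\<rho> \<in> hom G Homeo_plus" "\<And>s. \<exists>g\<in>carrier G. \<rho> g s \<noteq> s"
proof -
  interpret group G by fact
  obtain r where nontriv: "carrier G \<noteq> {\<one>}" and r: "linear_order_on (carrier G) r"
    and left: "\<And>f g h. f \<in> carrier G \<Longrightarrow> g \<in> carrier G \<Longrightarrow> h \<in> carrier G \<Longrightarrow>
      (g, h) \<in> r \<Longrightarrow> (f \<otimes> g, f \<otimes> h) \<in> r"
    using assms(2) unfolding left_orderable_def by blast
  define lt where "lt g h \<longleftrightarrow> (g, h) \<in> r \<and> g \<noteq> h" for g h
  have lt_trans: "lt g k" if "lt g h" "lt h k" for g h k
  proof -
    have "trans r" "antisym r" using r by (auto simp: order_on_defs)
    then show ?thesis using that unfolding lt_def by (blast dest: transD antisymD)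
  qed
  have lt_total: "g = h \<or> lt g h \<or> lt h g" if "g \<in> carrier G" "h \<in> carrier G" for g h
    using that r unfolding lt_def order_on_defs total_on_def by blast
  have lt_left: "lt (f \<otimes> g) (f \<otimes> h)" if "f \<in> carrier G" "g \<in> carrier G" "h \<in> carrier G" "lt g h" for f g h
    using that left unfolding lt_def by auto
  have lt_unb: "\<exists>h\<in>carrier G. lt g h" if "g \<in> carrier G" for g
    using left_ordered_group_unbounded[OF assms(1) left r nontriv that] by (auto simp: lt_def)
  \<comment> \<open>Replacing every group element by a copy of the rationals makes the order dense and unbounded.\<close>
  define D where "D = carrier G \<times> (UNIV :: rat set)"
  define ltD where "ltD x y \<longleftrightarrow> lt (fst x) (fst y) \<or> fst x = fst y \<and> snd x < snd y" for x y :: "'a \<times> rat"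
  have irr: "\<not> lt g g" for g by (simp add: lt_def)
  have "dense_unbounded_order D ltD"
  proof
    fix x y z assume *: "ltD x y" "ltD y z"
    show "ltD x z"
      using * lt_trans[of "fst x" "fst y" "fst z"] unfolding ltD_def by auto
  next
    fix x y assume *: "x \<in> D" "y \<in> D"
    show "x = y \<or> ltD x y \<or> ltD y x"
      using lt_total[of "fst x" "fst y"] * unfolding ltD_def D_def by (auto simp: prod_eq_iff)
    assume "ltD x y"
    show "\<exists>z\<in>D. ltD x z \<and> ltD z y"
    proof (cases "lt (fst x) (fst y)")
      case True
      then show ?thesis using * by (intro bexI[of _ "(fst x, snd x + 1)"]) (auto simp: ltD_def D_def)
    next
      case False
      then have xy: "fst x = fst y" "snd x < snd y" using \<open>ltD x y\<close> by (auto simp: ltD_def)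
      then obtain q where "snd x < q" "q < snd y" using dense by blast
      then show ?thesis using xy * by (intro bexI[of _ "(fst x, q)"]) (auto simp: ltD_def D_def)
    qed
  next
    fix x assume x: "x \<in> D"
    have "(fst x, snd x + 1) \<in> D" "(fst x, snd x - 1) \<in> D" using x by (auto simp: D_def)
    moreover have "ltD x (fst x, snd x + 1)" "ltD (fst x, snd x - 1) x" by (simp_all add: ltD_def)
    ultimately show "\<exists>y\<in>D. ltD x y" "\<exists>y\<in>D. ltD y x" by blast+
  qed (auto simp: ltD_def irr D_def)
  moreover have "dense_unbounded_order UNIV ((<) :: rat \<Rightarrow> rat \<Rightarrow> bool)"
    by standard (auto simp: dense gt_ex lt_ex)
  moreover have "countable D" using assms(3) by (simp add: D_def)
  ultimately obtain \<theta> where \<theta>: "bij_betw \<theta> D (UNIV :: rat set)"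
    "\<And>x y. x \<in> D \<Longrightarrow> y \<in> D \<Longrightarrow> ltD x y \<longleftrightarrow> \<theta> x < \<theta> y"
    using countable_dense_unbounded_orders_isomorphic[of D ltD "UNIV :: rat set" "(<)"] by auto
  define \<eta> where "\<eta> = inv_into D \<theta>"
  have \<eta>: "\<eta> q \<in> D" "\<theta> (\<eta> q) = q" for q
    using \<theta>(1) bij_betw_imp_surj_on[OF \<theta>(1)] by (auto simp: \<eta>_def inv_into_into f_inv_into_f)
  have \<eta>\<theta>: "\<eta> (\<theta> x) = x" if "x \<in> D" for x
    using \<theta>(1) that by (simp add: \<eta>_def bij_betw_inv_into_left)
  define act where "act g q = \<theta> (g \<otimes> fst (\<eta> q), snd (\<eta> q))" for g q
  have shift: "(g \<otimes> fst x, snd x) \<in> D" if "g \<in> carrier G" "x \<in> D" for g x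
    using that by (auto simp: D_def)
  have act_mono: "strict_mono (act g)" if g: "g \<in> carrier G" for g
  proof (rule strict_monoI)
    fix p q :: rat assume "p < q"
    then have "ltD (\<eta> p) (\<eta> q)" using \<theta>(2) \<eta> by simp
    then have "ltD (g \<otimes> fst (\<eta> p), snd (\<eta> p)) (g \<otimes> fst (\<eta> q), snd (\<eta> q))"
      using g \<eta>(1)[of p] \<eta>(1)[of q] lt_left unfolding ltD_def D_def by auto
    then show "act g p < act g q" using \<theta>(2) shift[OF g \<eta>(1)] by (simp add: act_def)
  qed
  have act_mult: "act (g \<otimes> h) = act g \<circ> act h" if "g \<in> carrier G" "h \<in> carrier G" for g h
  proof
    fix q
    have "fst (\<eta> q) \<in> carrier G" using \<eta>(1)[of q] by (auto simp: D_def)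
    then show "act (g \<otimes> h) q = (act g \<circ> act h) q"
      using that shift[OF that(2) \<eta>(1)] by (simp add: act_def \<eta>\<theta> m_assoc)
  qed
  have act_one: "act \<one> = (\<lambda>q. q)"
  proof
    fix q
    have "fst (\<eta> q) \<in> carrier G" using \<eta>(1)[of q] by (auto simp: D_def)
    then show "act \<one> q = q" by (simp add: act_def \<eta>)
  qed
  have act_surj: "surj (act g)" if "g \<in> carrier G" for g
  proof -
    have "act g (act (inv g) q) = q" for q
      using act_mult[of g "inv g"] that by (simp add: act_one fun_eq_iff)
    then show ?thesis by (metis surjI)
  qed
  define \<rho> where "\<rho> g = real_extension (act g)" for g
  have \<rho>_mult: "\<rho> (g \<otimes> h) = \<rho> g \<circ> \<rho> h" if "g \<in> carrier G" "h \<in> carrier G" for g h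
    using that by (auto simp: \<rho>_def act_mult act_mono act_surj real_extension_comp)
  have \<rho>_surj: "surj (\<rho> g)" if "g \<in> carrier G" for g
  proof -
    have "\<rho> g (\<rho> (inv g) x) = x" for x
      using \<rho>_mult[of g "inv g"] that by (simp add: fun_eq_iff) (simp add: \<rho>_def act_one real_extension_id)
    then show ?thesis by (metis surjI)
  qed
  have "\<rho> \<in> hom G Homeo_plus"
  proof (rule homI)
    show "\<rho> g \<in> carrier Homeo_plus" if "g \<in> carrier G" for g
      using strict_mono_surj_homeo \<rho>_surj[OF that] strict_mono_real_extension[OF act_mono[OF that]] by (simp add: \<rho>_def)
  qed (simp add: \<rho>_mult Homeo_plus_def)
  moreover have "\<exists>g\<in>carrier G. \<rho> g s \<noteq> s" for s
  proof (rule ccontr)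
    assume "\<not> ?thesis"
    then have fixed: "\<rho> g s = s" if "g \<in> carrier G" for g using that by blast
    obtain p q where pq: "of_rat p < s" "s < of_rat q" using of_rat_dense[of "s - 1" s] of_rat_dense[of s "s + 1"] by auto
    obtain h where h: "h \<in> carrier G" "lt (fst (\<eta> q)) h" using lt_unb[of "fst (\<eta> q)"] \<eta>(1)[of q] by (auto simp: D_def)
    have p: "fst (\<eta> p) \<in> carrier G" using \<eta>(1)[of p] by (auto simp: D_def)
    \<comment> \<open>This element carries the layer of \<open>p\<close> to the layer of
      \<open>h\<close>, above that of \<open>q\<close>. So it moves \<open>p\<close>, which lies
      below \<open>s\<close>, beyond \<open>q\<close>, which lies above \<open>s\<close>; a monotone
      map fixing \<open>s\<close> cannot do this.\<close>
    let ?g = "h \<otimes> inv (fst (\<eta> p))"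
    have g: "?g \<in> carrier G" using h p by simp
    have "of_rat (act ?g p) < s"
      using real_extension_cut[OF act_mono[OF g], of p s] fixed[OF g] pq(1) by (simp add: \<rho>_def)
    moreover have "q < act ?g p"
    proof -
      have "?g \<otimes> fst (\<eta> p) = h" using h p by (simp add: m_assoc)
      then have "ltD (\<eta> q) (?g \<otimes> fst (\<eta> p), snd (\<eta> p))" using h by (simp add: ltD_def)
      then have "\<theta> (\<eta> q) < \<theta> (?g \<otimes> fst (\<eta> p), snd (\<eta> p))" using \<theta>(2)[OF \<eta>(1) shift[OF g \<eta>(1)]] by blast
      then show ?thesis by (simp add: \<eta> act_def)
    qed
    then have "of_rat q < (of_rat (act ?g p) :: real)" by (simp add: of_rat_less)
    ultimately show False using pq(2) by linarith
  qed
  ultimately show thesis by (rule that)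
qed

section \<open>Left orders and peripheral elements\<close>

lemma hom_Homeo_plus:
  fixes G (structure)
  assumes "group G" "\<rho> \<in> hom G Homeo_plus"
  shows "\<And>g h x. g \<in> carrier G \<Longrightarrow> h \<in> carrier G \<Longrightarrow> \<rho> (g \<otimes> h) x = \<rho> g (\<rho> h x)"
    and "\<And>g. g \<in> carrier G \<Longrightarrow> strict_mono (\<rho> g)"
    and "\<And>g. g \<in> carrier G \<Longrightarrow> continuous_on UNIV (\<rho> g)"
    and "\<And>x. \<rho> \<one> x = x"
    and "\<And>g x. g \<in> carrier G \<Longrightarrow> \<rho> g (\<rho> (inv g) x) = x"
    and "\<And>g x. g \<in> carrier G \<Longrightarrow> \<rho> (inv g) (\<rho> g x) = x"
proof -
  interpret group G by fact
  have hom: "\<rho> g \<in> carrier Homeo_plus" if "g \<in> carrier G" for g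
    using assms(2) that by (rule hom_in_carrier)
  show mult: "\<rho> (g \<otimes> h) x = \<rho> g (\<rho> h x)" if "g \<in> carrier G" "h \<in> carrier G" for g h x
    using hom_mult[OF assms(2) that] by (simp add: Homeo_plus_def)
  show mono: "strict_mono (\<rho> g)" if "g \<in> carrier G" for g
    using hom[OF that] by (simp add: Homeo_plus_def)
  show "continuous_on UNIV (\<rho> g)" if "g \<in> carrier G" for g
    using hom[OF that] by (auto simp: Homeo_plus_def homeomorphism_def)
  show one: "\<rho> \<one> x = x" for x
    using mult[of \<one> \<one> x] strict_mono_eq[OF mono[of \<one>], of "\<rho> \<one> x" x] by simp
  show "\<rho> g (\<rho> (inv g) x) = x" "\<rho> (inv g) (\<rho> g x) = x" if "g \<in> carrier G" for g x
    using mult[of g "inv g" x] mult[of "inv g" g x] that one by simp_all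
qed

lemma hom_Homeo_plus_pow:
  fixes G (structure)
  assumes "group G" "\<rho> \<in> hom G Homeo_plus" "g \<in> carrier G"
  shows "\<rho> (g [^] (n::nat)) x = (\<rho> g ^^ n) x"
proof (induction n arbitrary: x)
  interpret group G by fact
  {
    case 0
    then show ?case by (simp add: hom_Homeo_plus(4)[OF assms(1,2)])
  next
    case (Suc n)
    have "\<rho> (g [^] Suc n) x = \<rho> (g [^] n) (\<rho> g x)"
      using assms(3) hom_Homeo_plus(1)[OF assms(1,2), of "g [^] n" g x] by simp
    then show ?case using Suc by (simp add: funpow_swap1)
  }
qed

text \<open>If \<open>f x\<close> lies strictly on the wrong side of \<open>x\<close>, monotonicity
  keeps all further iterates at or beyond \<open>f x\<close>, so none returns. The relation
  \<open>R\<close> lets one proof serve both directions.\<close>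

lemma strict_mono_funpow_one_sided:
  fixes f :: "real \<Rightarrow> real"
  assumes R: "R = (\<le>) \<or> R = (\<ge>)" and f: "strict_mono f" and n: "0 < n" "R ((f ^^ n) x) x"
  shows "R (f x) x"
proof (rule ccontr)
  have R_refl: "R x x" and R_trans: "R x y \<Longrightarrow> R y z \<Longrightarrow> R x z"
    and R_total: "\<not> R x y \<Longrightarrow> R y x" and R_mono: "R x y \<Longrightarrow> R (f x) (f y)" for x y z
    using R strict_mono_less_eq[OF f] by auto
  assume not: "\<not> R (f x) x"
  have "R (f x) ((f ^^ Suc k) x)" for k
  proof (induction k)
    case (Suc k)
    have "R (f x) (f (f x))" using R_total[OF not] by (rule R_mono)
    also have "R (f (f x)) (f ((f ^^ Suc k) x))" using Suc by (rule R_mono)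
    finally (R_trans) show ?case by simp
  qed (simp add: R_refl)
  from this[of "n - 1"] have "R (f x) ((f ^^ n) x)" using n(1) by simp
  then show False using n(2) not R_trans by blast
qed

text \<open>For conjugates, the monotone \<open>\<rho> g\<close> is applied to the inequality for
  \<open>f\<close> at the point \<open>\<rho> (inv g) x\<close>. For roots, a monotone map moves
  each point to the same side as its positive iterates do. Membership in the carrier is carried
  along because the rule \<open>gen\<close> does not supply it.\<close>

lemma root_conj_closed_submonoid_one_sided:
  fixes G (structure) and R :: "real \<Rightarrow> real \<Rightarrow> bool"
  assumes "group G" "\<rho> \<in> hom G Homeo_plus" and R: "R = (\<le>) \<or> R = (\<ge>)"
    and S: "\<And>g. g \<in> S \<Longrightarrow> g \<in> carrier G \<and> (\<forall>x. R (\<rho> g x) x)"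
    and "f \<in> root_conj_closed_submonoid G S"
  shows "f \<in> carrier G \<and> (\<forall>x. R (\<rho> f x) x)"
  using assms(5)
proof (induction rule: root_conj_closed_submonoid.induct)
  interpret group G by fact
  note \<rho> = hom_Homeo_plus[OF assms(1,2)]
  have R_refl: "R x x" and R_trans: "R x y \<Longrightarrow> R y z \<Longrightarrow> R x z"
    and R_total: "\<not> R x y \<Longrightarrow> R y x" for x y z
    using R by auto
  have R_mono: "R (\<rho> g x) (\<rho> g y)" if "g \<in> carrier G" "R x y" for g x y
    using R that strict_mono_less_eq[OF \<rho>(2)[OF that(1)]] by auto
  {
    case one
    then show ?case by (simp add: \<rho> R_refl)
  next
    case (gen s)
    then show ?case by (rule S)
  next
    case (mult f g)
    then show ?case using R_trans by (auto simp: \<rho>) blast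
  next
    case (conj f g)
    have "R (\<rho> (g \<otimes> f \<otimes> inv g) x) x" for x
    proof -
      have "R (\<rho> g (\<rho> f (\<rho> (inv g) x))) (\<rho> g (\<rho> (inv g) x))"
        using conj by (intro R_mono) auto
      then show ?thesis using conj by (simp add: \<rho>)
    qed
    then show ?case using conj by simp
  next
    case (root f n)
    have "R (\<rho> f x) x" for x
      using strict_mono_funpow_one_sided[OF R \<rho>(2)[OF root(1)] root(2)] root
      by (simp add: hom_Homeo_plus_pow[OF assms(1,2)])
    then show ?case using root by simp
  }
qed

lemma continuous_without_fixed_point:
  fixes f :: "real \<Rightarrow> real"
  assumes "continuous_on UNIV f" "\<And>x. f x \<noteq> x"
  shows "(\<forall>x. f x < x) \<or> (\<forall>x. x < f x)"
proof (rule ccontr)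
  let ?d = "\<lambda>x. f x - x"
  assume "\<not> ?thesis"
  then obtain a b where "?d a \<ge> 0" "?d b \<le> 0" by (meson diff_ge_0_iff_ge diff_le_0_iff_le not_less)
  moreover have "connected (?d ` UNIV)"
    using assms(1) by (intro connected_continuous_image continuous_intros) auto
  ultimately have "0 \<in> ?d ` UNIV"
    using connectedD_interval[of "?d ` UNIV" "?d b" "?d a" 0] by blast
  then show False using assms(2) by auto
qed

lemma left_orderable_subgroup:
  assumes "subgroup K H" "left_orderable H" "K \<noteq> {\<one>\<^bsub>H\<^esub>}"
  shows "left_orderable (H\<lparr>carrier := K\<rparr>)"
proof -
  obtain r where r: "linear_order_on (carrier H) r"
    "\<forall>f\<in>carrier H. \<forall>g\<in>carrier H. \<forall>h\<in>carrier H. (g, h) \<in> r \<longrightarrow> (f \<otimes>\<^bsub>H\<^esub> g, f \<otimes>\<^bsub>H\<^esub> h) \<in> r"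
    using assms(2) unfolding left_orderable_def by blast
  have K: "K \<subseteq> carrier H" "\<And>a b. a \<in> K \<Longrightarrow> b \<in> K \<Longrightarrow> a \<otimes>\<^bsub>H\<^esub> b \<in> K"
    using assms(1) by (auto simp: subgroup_def)
  have "linear_order_on K (r \<inter> K \<times> K)"
    unfolding order_on_defs
  proof (intro conjI)
    have "refl_on (carrier H) r" "total_on (carrier H) r" using r(1) by (auto simp: order_on_defs)
    then show "refl_on K (r \<inter> K \<times> K)" "total_on K (r \<inter> K \<times> K)"
      using K(1) by (auto simp: refl_on_def total_on_def)
    show "trans (r \<inter> K \<times> K)"
      using r(1) unfolding order_on_defs by (auto intro!: transI dest: transD)
    show "antisym (r \<inter> K \<times> K)"
      using r(1) unfolding order_on_defs by (auto intro!: antisymI dest: antisymD)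
  qed auto
  then show ?thesis
    unfolding left_orderable_def using assms(3) r(2) K
    by (auto intro!: exI[of _ "r \<inter> K \<times> K"])
qed

lemma (in group) int_pow_commute:
  assumes "x \<in> carrier G" "y \<in> carrier G" "x \<otimes> y = y \<otimes> x"
  shows "x [^] (a::int) \<otimes> y = y \<otimes> x [^] a"
proof -
  have nat: "x [^] (n::nat) \<otimes> y = y \<otimes> x [^] n" for n
  proof (induction n)
    case (Suc n)
    have "x [^] Suc n \<otimes> y = x [^] n \<otimes> y \<otimes> x" using assms by (simp add: m_assoc)
    then show ?case using assms Suc by (simp add: m_assoc)
  qed (use assms in simp)
  have "inv (x [^] (n::nat)) \<otimes> y = y \<otimes> inv (x [^] n)" for n
  proof -
    have "inv (x [^] n) \<otimes> y = inv (x [^] n) \<otimes> (y \<otimes> x [^] n) \<otimes> inv (x [^] n)"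
      using assms by (simp add: m_assoc)
    also have "\<dots> = inv (x [^] n) \<otimes> (x [^] n \<otimes> y) \<otimes> inv (x [^] n)"
      by (simp only: nat)
    also have "inv (x [^] n) \<otimes> (x [^] n \<otimes> y) = y"
      using assms by (simp add: m_assoc[symmetric])
    finally show ?thesis .
  qed
  then show ?thesis
    using nat assms by (cases a rule: int_cases2) (simp_all add: int_pow_int int_pow_neg_int)
qed

theorem peripheral_quotient_trivial:
  fixes G (structure) and H :: "('b, 'c) monoid_scheme" and p q c :: int
  assumes G: "group G" "countable (carrier G)" and H: "group H" "left_orderable H"
    and \<phi>: "\<phi> \<in> hom G H"
    and m: "m \<in> carrier G" and l: "l \<in> carrier G" and comm: "m \<otimes> l = l \<otimes> m"
    and fix_all: "\<And>\<rho> s g. \<rho> \<in> hom G Homeo_plus \<Longrightarrow> \<rho> m s = s \<Longrightarrow> \<rho> l s = s \<Longrightarrow> g \<in> carrier G \<Longrightarrow> \<rho> g s = s"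
    and gen: "m \<in> root_conj_closed_submonoid G {m [^] c \<otimes> l, inv m}"
    and slope: "0 < q" "c * q \<le> p" "\<phi> (m [^] p \<otimes> l [^] q) = \<one>\<^bsub>H\<^esub>"
    and g: "g \<in> carrier G"
  shows "\<phi> g = \<one>\<^bsub>H\<^esub>"
proof (rule ccontr)
  assume "\<phi> g \<noteq> \<one>\<^bsub>H\<^esub>"
  interpret group G by fact
  interpret H: group H by fact
  interpret \<phi>: group_hom G H \<phi> by unfold_locales (rule \<phi>)
  \<comment> \<open>The action is built for the image rather than for \<open>H\<close>: as an image
    of \<open>G\<close> it is countable, which is not known of \<open>H\<close> at this stage, and
    it inherits the left order.\<close>
  let ?K = "\<phi> ` carrier G"
  let ?HK = "H\<lparr>carrier := ?K\<rparr>"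
  have K: "subgroup ?K H" by (rule \<phi>.img_is_subgroup)
  have "left_orderable ?HK"
    using left_orderable_subgroup[OF K H(2)] g \<open>\<phi> g \<noteq> \<one>\<^bsub>H\<^esub>\<close> by blast
  moreover have "group ?HK" using K by (rule H.subgroup_imp_group)
  moreover have "countable (carrier ?HK)" using G(2) by simp
  ultimately obtain \<sigma> where \<sigma>: "\<sigma> \<in> hom ?HK Homeo_plus" "\<And>s. \<exists>k\<in>?K. \<sigma> k s \<noteq> s"
    using countable_left_orderable_acts_on_line[of ?HK] by auto
  define \<rho> where "\<rho> = \<sigma> \<circ> \<phi>"
  have hom: "\<rho> \<in> hom G Homeo_plus"
  proof (rule homI)
    show "\<rho> a \<in> carrier Homeo_plus" if "a \<in> carrier G" for a
      using hom_in_carrier[OF \<sigma>(1)] that by (simp add: \<rho>_def)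
    show "\<rho> (a \<otimes> b) = \<rho> a \<otimes>\<^bsub>Homeo_plus\<^esub> \<rho> b" if "a \<in> carrier G" "b \<in> carrier G" for a b
      using hom_mult[OF \<sigma>(1), of "\<phi> a" "\<phi> b"] that by (simp add: \<rho>_def)
  qed
  note \<rho> = hom_Homeo_plus[OF G(1) hom] and \<rho>_pow = hom_Homeo_plus_pow[OF G(1) hom]
  have slope_id: "\<rho> (m [^] p \<otimes> l [^] q) x = x" for x
    using slope(3) \<rho>(4)[of x] by (simp add: \<rho>_def)
  have \<rho>_inj: "x = y" if "a \<in> carrier G" "\<rho> a x = \<rho> a y" for a x y
    using that strict_mono_eq[OF \<rho>(2)] by blast
  have int_nat_q: "l [^] q = l [^] nat q" "0 < nat q"
    using slope(1) int_pow_int[of G l "nat q"] by simp_all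
  have no_fix: "\<rho> m s \<noteq> s" for s
  proof
    assume s: "\<rho> m s = s"
    have fix_pow: "\<rho> (m [^] n) s = s" for n :: nat
      using m by (induction n) (simp_all add: \<rho> s)
    have "\<rho> (inv (m [^] n)) s = s" for n :: nat
      using fix_pow[of n] \<rho>(6)[of "m [^] n" s] m by simp
    then have "\<rho> (m [^] p) s = s"
      using fix_pow m by (cases p rule: int_cases2) (simp_all add: int_pow_int int_pow_neg_int)
    moreover have "\<rho> (m [^] p) (\<rho> (l [^] q) s) = s" using slope_id[of s] m l \<rho>(1) by simp
    ultimately have "\<rho> (l [^] q) s = s" using m \<rho>_inj[of "m [^] p" "\<rho> (l [^] q) s" s] by simp
    then have "(\<rho> l ^^ nat q) s = s" using l by (simp add: int_nat_q \<rho>_pow)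
    \<comment> \<open>The iterate \<open>\<rho> l ^^ nat q\<close> fixes \<open>s\<close>, hence
      moves it neither up nor down; by monotonicity the same holds of
      \<open>\<rho> l\<close>.\<close>
    then have "\<rho> l s \<le> s" "\<rho> l s \<ge> s"
      using strict_mono_funpow_one_sided[of "(\<le>)" "\<rho> l" "nat q" s] \<rho>(2)[OF l] int_nat_q(2)
        strict_mono_funpow_one_sided[of "(\<ge>)" "\<rho> l" "nat q" s] by simp_all
    then have "\<rho> a s = s" if "a \<in> carrier G" for a using fix_all[OF hom s _ that] by simp
    then show False using \<sigma>(2)[of s] by (auto simp: \<rho>_def)
  qed
  \<comment> \<open>\<open>R\<close> names the side to which \<open>inv m\<close> weakly moves all
    points. The other generator will be seen to move them to the same side, whence so does
    \<open>m\<close>; this contradicts the strict motion of \<open>m\<close> to the opposite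
    side.\<close>
  have down: "\<forall>x. R (\<rho> m x) x" if R: "R = (\<le>) \<or> R = (\<ge>)" and inv: "\<forall>x. R (\<rho> (inv m) x) x" for R
  proof -
    have "R (\<rho> (m [^] c \<otimes> l) x) x" for x
    proof (rule strict_mono_funpow_one_sided[OF R _ int_nat_q(2)])
      show "strict_mono (\<rho> (m [^] c \<otimes> l))" using m l by (intro \<rho>(2)) simp
      \<comment> \<open>The bound \<open>c * q \<le> p\<close> makes this difference nonnegative, so
        the factor that remains beside the slope element is a power of \<open>inv m\<close> and not
        of \<open>m\<close>.\<close>
      define k where "k = nat (p - c * q)"
      have k: "c * q = - int k + p" using slope(2) by (simp add: k_def)
      have "(m [^] c \<otimes> l) [^] nat q = (m [^] c) [^] nat q \<otimes> l [^] nat q"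
        using m l comm by (intro pow_mult_distrib int_pow_commute) auto
      also have "(m [^] c) [^] nat q = m [^] (c * q)"
        using int_pow_pow[OF m, of c "int (nat q)"] slope(1) by (simp add: int_pow_int)
      also have "\<dots> = m [^] (- int k) \<otimes> m [^] p"
        unfolding k using m by (rule int_pow_mult)
      also have "m [^] (- int k) = inv m [^] k"
        using m by (simp add: int_pow_neg_int nat_pow_inv)
      finally have "(m [^] c \<otimes> l) [^] nat q = inv m [^] k \<otimes> (m [^] p \<otimes> l [^] q)"
        using m l by (simp add: int_nat_q m_assoc)
      then have "(\<rho> (m [^] c \<otimes> l) ^^ nat q) x = (\<rho> (inv m) ^^ k) x"
        using m l \<rho>(1)[of "inv m [^] k" "m [^] p \<otimes> l [^] q" x]
        by (simp add: slope_id flip: \<rho>_pow)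
      moreover have "R ((\<rho> (inv m) ^^ k) x) x"
      proof (induction k)
        case (Suc k)
        have "R (\<rho> (inv m) ((\<rho> (inv m) ^^ k) x)) ((\<rho> (inv m) ^^ k) x)" using inv by blast
        then show ?case using Suc R by auto
      qed (use R in auto)
      ultimately show "R ((\<rho> (m [^] c \<otimes> l) ^^ nat q) x) x" by simp
    qed
    then show ?thesis
      using root_conj_closed_submonoid_one_sided[OF G(1) hom R _ gen] inv m l by blast
  qed
  consider "\<forall>x. \<rho> m x < x" | "\<forall>x. x < \<rho> m x"
    using continuous_without_fixed_point[OF \<rho>(3)[OF m] no_fix] by blast
  then show False
  proof cases
    case 1
    have "\<forall>x. \<rho> (inv m) x \<ge> x"
      using 1 \<rho>(5)[OF m] by (metis less_imp_le)
    then have "\<forall>x. \<rho> m x \<ge> x" using down[of "(\<ge>)"] by blast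
    then show False using 1 by (meson not_le)
  next
    case 2
    have "\<forall>x. \<rho> (inv m) x \<le> x"
      using 2 \<rho>(5)[OF m] by (metis less_imp_le)
    then have "\<forall>x. \<rho> m x \<le> x" using down[of "(\<le>)"] by blast
    then show False using 2 by (meson not_le)
  qed
qed

section \<open>Tubular neighbourhoods of knots\<close>

lemma cis_inj_open_interval:
  assumes "cis s = cis t" "\<bar>s - t\<bar> < 2 * pi"
  shows "s = t"
proof -
  have "sin s = sin t \<and> cos s = cos t" using assms(1) by (simp add: complex_eq_iff)
  then obtain n :: int where n: "s = t + 2 * pi * n" using sin_cos_eq_iff by blast
  then have "\<bar>real_of_int n\<bar> < 1" using assms(2) by (auto simp: abs_mult)
  then have "n = 0" by linarith
  then show ?thesis using n by simp
qed

lemma unit_eq_cis_Arg: "u \<in> circle \<Longrightarrow> cis (Arg u) = u"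
  using cis_Arg[of u] by (cases "u = 0") (auto simp: sgn_div_norm)

text \<open>Near \<open>u\<close> the angle has the branch \<open>Arg u + Arg (x / u)\<close>,
  continuous there because \<open>Arg\<close> is continuous at 1. Composition with it recovers
  \<open>f\<close> from the map in the real parameter \<open>t\<close>, in terms of which the
  smoothness of a tubular neighbourhood is stated.\<close>

lemma continuous_on_circle_times:
  fixes f :: "complex \<times> 'a::real_normed_vector \<Rightarrow> 'b::topological_space"
  assumes "continuous_on (UNIV \<times> B) (\<lambda>(t::real, z). f (cis t, z))" "open B"
  shows "continuous_on (circle \<times> B) f"
  unfolding continuous_on_eq_continuous_within
proof
  fix w assume "w \<in> circle \<times> B"
  then obtain u z where w: "w = (u, z)" and u: "u \<in> circle" and z: "z \<in> B" by blast
  have u0: "u \<noteq> 0" using u by auto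
  let ?P = "\<lambda>(t::real, z). f (cis t, z)"
  let ?g = "\<lambda>x. (Arg u + Arg (fst x / u), snd x :: 'a)"
  have "isCont ?P (?g w)"
    using assms z by (simp add: continuous_on_eq_continuous_at open_Times w)
  moreover have "isCont ?g w"
  proof -
    have "isCont (\<lambda>x. fst x / u) w" using u0 by (intro continuous_intros) auto
    moreover have "isCont Arg (fst w / u)" using continuous_at_Arg[of 1] u0 by (simp add: w)
    ultimately have "isCont (\<lambda>x. Arg (fst x / u)) w" by (rule isCont_o2)
    then show ?thesis by (intro continuous_intros)
  qed
  ultimately have "isCont (\<lambda>x. ?P (?g x)) w" by (rule isCont_o2[rotated])
  then have "continuous (at w within circle \<times> B) (\<lambda>x. ?P (?g x))"
    by (rule continuous_at_imp_continuous_at_within)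
  then show "continuous (at w within circle \<times> B) f"
  proof (rule continuous_transform_within[OF _ zero_less_one \<open>w \<in> circle \<times> B\<close>])
    fix x assume "x \<in> circle \<times> B"
    then have "fst x / u \<in> circle" using u by (auto simp: norm_divide)
    then have "cis (Arg u + Arg (fst x / u)) = fst x"
      using u u0 by (simp add: unit_eq_cis_Arg flip: cis_mult)
    then show "?P (?g x) = f x" by simp
  qed
qed

locale solid_torus_embedding =
  fixes K :: "(real^4) set" and N :: "complex \<times> complex \<Rightarrow> real^4"
  assumes tubular: "tubular_nbhd K N"
begin

definition "exterior = knot_exterior N"

lemma N_cont: "continuous_on (circle \<times> ball 0 2) N"
proof -
  have "smooth_on (UNIV \<times> ball 0 2) (\<lambda>(t::real, z). N (cis t, z))"
    using tubular unfolding tubular_nbhd_def Let_def by blast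
  then have "Ck_on 0 (UNIV \<times> ball 0 2) (\<lambda>(t::real, z). N (cis t, z))"
    unfolding smooth_on_def by blast
  then show ?thesis by (intro continuous_on_circle_times) auto
qed

lemma N_inj: "inj_on N (circle \<times> ball 0 2)"
  using tubular unfolding tubular_nbhd_def by blast

lemma N_S3: "x \<in> circle \<times> ball 0 2 \<Longrightarrow> N x \<in> S3"
  using tubular unfolding tubular_nbhd_def by blast

lemma K_eq: "K = N ` (circle \<times> {0})"
proof -
  have "K = (\<lambda>u. N (u, 0)) ` circle" using tubular unfolding tubular_nbhd_def by blast
  then show ?thesis by auto
qed

lemma sub_domain:
  "circle \<times> ball 0 1 \<subseteq> circle \<times> (ball 0 2 :: complex set)"
  "circle \<times> cball 0 1 \<subseteq> circle \<times> (ball 0 2 :: complex set)"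
  "circle \<times> circle \<subseteq> circle \<times> (ball 0 2 :: complex set)"
  "circle \<times> {0} \<subseteq> circle \<times> (ball 0 2 :: complex set)"
  by auto

lemma compact_K: "compact K"
  unfolding K_eq by (intro compact_continuous_image continuous_on_subset[OF N_cont] compact_Times) auto

lemma compact_tube: "compact (N ` (circle \<times> cball 0 1))"
  by (intro compact_continuous_image continuous_on_subset[OF N_cont] compact_Times) auto

text \<open>The cone over the tube is a union of injective images of open boxes in four dimensions.\<close>

lemma openin_tube: "openin (top_of_set S3) (N ` (circle \<times> ball 0 1))"
proof -
  \<comment> \<open>The angular interval has length \<open>2 * pi\<close> and is open, so
    \<open>cis\<close> is injective on it. The radial factor raises the dimension from three to
    four, so that invariance of domain applies in the ambient space; on the sphere the factor is
    forced to be 1.\<close>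
  define W where "W a = {a - pi<..<a + pi} \<times> ball (0::complex) 1 \<times> {0::real<..}" for a
  define \<Phi> where "\<Phi> = (\<lambda>(t, z, s). s *\<^sub>R N (cis t, z))"
  have open_W: "open (W a)" for a unfolding W_def by (intro open_Times) auto
  have "continuous_on (W a) \<Phi>" for a
  proof -
    have "continuous_on (W a) (\<lambda>x. N (cis (fst x), fst (snd x)))"
      by (rule continuous_on_compose2[OF N_cont]) (auto simp: W_def intro!: continuous_intros)
    then have "continuous_on (W a) (\<lambda>x. snd (snd x) *\<^sub>R N (cis (fst x), fst (snd x)))"
      by (intro continuous_intros)
    then show ?thesis by (simp add: \<Phi>_def case_prod_beta)
  qed
  moreover have "inj_on \<Phi> (W a)" for a
  proof (rule inj_onI)
    fix x y assume xy: "x \<in> W a" "y \<in> W a" "\<Phi> x = \<Phi> y"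
    obtain t z s t' z' s' where x: "x = (t, z, s)" and y: "y = (t', z', s')"
      by (metis prod_cases3)
    have dom: "(cis t, z) \<in> circle \<times> ball 0 2" "(cis t', z') \<in> circle \<times> ball 0 2"
      using xy by (auto simp: x y W_def)
    have s: "0 < s" "0 < s'" using xy by (auto simp: x y W_def)
    have eq: "s *\<^sub>R N (cis t, z) = s' *\<^sub>R N (cis t', z')" using xy(3) by (simp add: \<Phi>_def x y)
    then have "norm (s *\<^sub>R N (cis t, z)) = norm (s' *\<^sub>R N (cis t', z'))" by simp
    then have "s = s'" using N_S3[OF dom(1)] N_S3[OF dom(2)] s by simp
    then have "N (cis t, z) = N (cis t', z')" using eq s by simp
    then have "cis t = cis t'" "z = z'" using inj_onD[OF N_inj _ dom] by auto
    moreover have "\<bar>t - t'\<bar> < 2 * pi" using xy by (auto simp: x y W_def abs_if)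
    ultimately show "x = y" using cis_inj_open_interval \<open>s = s'\<close> by (simp add: x y)
  qed
  ultimately have "open (\<Phi> ` W a)" for a
    using invariance_of_domain_gen[OF open_W[of a], of \<Phi>] by simp
  then have "open (\<Union>a. \<Phi> ` W a)" by blast
  moreover have "N ` (circle \<times> ball 0 1) = S3 \<inter> (\<Union>a. \<Phi> ` W a)"
  proof (intro equalityI subsetI)
    fix x assume "x \<in> N ` (circle \<times> ball 0 1)"
    then obtain u z where uz: "u \<in> circle" "z \<in> ball 0 1" "x = N (u, z)" by auto
    have "\<Phi> (Arg u, z, 1) = x" using uz by (simp add: \<Phi>_def unit_eq_cis_Arg)
    moreover have "(Arg u, z, 1) \<in> W (Arg u)" using uz by (auto simp: W_def)
    moreover have "x \<in> S3" using N_S3[of "(u, z)"] uz by simp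
    ultimately show "x \<in> S3 \<inter> (\<Union>a. \<Phi> ` W a)" by blast
  next
    fix x assume "x \<in> S3 \<inter> (\<Union>a. \<Phi> ` W a)"
    then obtain a t z s where x: "x \<in> S3" "(t, z, s) \<in> W a" "x = \<Phi> (t, z, s)" by auto
    then have s: "0 < s" "(cis t, z) \<in> circle \<times> ball 0 1" by (auto simp: W_def)
    then have "norm (N (cis t, z)) = 1" using N_S3[of "(cis t, z)"] by auto
    then have "s = 1" using x(1,3) s by (simp add: \<Phi>_def)
    then show "x \<in> N ` (circle \<times> ball 0 1)" using x(3) s(2) by (auto simp: \<Phi>_def)
  qed
  ultimately show ?thesis by (auto simp: openin_open)
qed

lemma exterior_subset: "exterior \<subseteq> S3 - K"
  unfolding exterior_def knot_exterior_def K_eq by auto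

lemma compact_exterior: "compact exterior"
proof -
  have "closedin (top_of_set S3) exterior"
    using openin_tube unfolding exterior_def knot_exterior_def by (simp add: closedin_diff)
  then show ?thesis by (rule closedin_compact[rotated]) simp
qed

lemma N_in_exterior_iff:
  assumes "u \<in> circle" "z \<in> ball 0 2"
  shows "N (u, z) \<in> exterior \<longleftrightarrow> 1 \<le> norm z"
proof
  assume "N (u, z) \<in> exterior"
  then show "1 \<le> norm z" using assms unfolding exterior_def knot_exterior_def by (force simp: not_less)
next
  assume "1 \<le> norm z"
  moreover have "N (u, z) = N x \<Longrightarrow> x \<in> circle \<times> ball 0 1 \<Longrightarrow> x = (u, z)" for x
    using inj_onD[OF N_inj, of x "(u, z)"] assms sub_domain(1) by auto
  ultimately show "N (u, z) \<in> exterior"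
    using N_S3[of "(u, z)"] assms unfolding exterior_def knot_exterior_def by auto
qed

lemma torus_in_exterior: "N ` (circle \<times> circle) \<subseteq> exterior"
  using N_in_exterior_iff by auto

lemma base_in_exterior: "N (1, 1) \<in> exterior"
  using torus_in_exterior by auto

definition tube_inv :: "real^4 \<Rightarrow> complex \<times> complex" where
  "tube_inv = inv_into (circle \<times> cball 0 1) N"

lemma tube_inv: "x \<in> circle \<times> cball 0 1 \<Longrightarrow> tube_inv (N x) = x"
  unfolding tube_inv_def using inv_into_f_f[OF inj_on_subset[OF N_inj sub_domain(2)]] by blast

lemma continuous_on_tube_inv: "continuous_on (N ` (circle \<times> cball 0 1)) tube_inv"
  by (rule continuous_on_inv)
    (auto simp: tube_inv intro!: continuous_on_subset[OF N_cont] compact_Times)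

text \<open>In the tube, \<open>sgn z\<close> is the radial projection of \<open>z\<close> to the
  unit circle, so the two cases agree on the boundary torus. Points of \<open>K\<close> have
  \<open>z = 0\<close> and hence no direction; the map is used on \<open>S3 - K\<close>
  only.\<close>

definition retraction_to_exterior :: "real^4 \<Rightarrow> real^4" where
  "retraction_to_exterior x =
     (if x \<in> exterior then x else N (fst (tube_inv x), sgn (snd (tube_inv x))))"

lemma retraction_id: "x \<in> exterior \<Longrightarrow> retraction_to_exterior x = x"
  by (simp add: retraction_to_exterior_def)

lemma tube_decomposition:
  assumes "x \<in> N ` (circle \<times> cball 0 1) - K"
  obtains u z where "x = N (u, z)" "u \<in> circle" "z \<in> cball 0 1" "z \<noteq> 0" "tube_inv x = (u, z)"
    "sgn z \<in> circle"
proof -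
  obtain u z where uz: "x = N (u, z)" "u \<in> circle" "z \<in> cball 0 1" using assms by auto
  moreover have "z \<noteq> 0" using assms uz by (auto simp: K_eq)
  ultimately show thesis by (intro that[of u z]) (auto simp: tube_inv norm_sgn)
qed

lemma complement_decomposition: "S3 - K = exterior \<union> (N ` (circle \<times> cball 0 1) - K)"
proof -
  have "N ` (circle \<times> cball 0 1) \<subseteq> S3" using N_S3 sub_domain(2) by blast
  then show ?thesis
    using exterior_subset unfolding exterior_def knot_exterior_def by (auto simp: K_eq)
qed

lemma retraction_in_exterior:
  assumes "x \<in> S3 - K" shows "retraction_to_exterior x \<in> exterior"
proof (cases "x \<in> exterior")
  case False
  then have "x \<in> N ` (circle \<times> cball 0 1) - K" using assms complement_decomposition by blast
  then obtain u z where "x = N (u, z)" "u \<in> circle" "tube_inv x = (u, z)" "sgn z \<in> circle"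
    by (rule tube_decomposition)
  then show ?thesis using False torus_in_exterior by (auto simp: retraction_to_exterior_def)
qed (simp add: retraction_id)

lemma continuous_on_retraction: "continuous_on (S3 - K) retraction_to_exterior"
proof -
  let ?T = "N ` (circle \<times> cball 0 1) - K"
  let ?g = "\<lambda>x. N (fst (tube_inv x), sgn (snd (tube_inv x)))"
  have g: "continuous_on ?T ?g"
  proof (rule continuous_on_compose2[OF N_cont])
    have c: "continuous_on ?T tube_inv" by (rule continuous_on_subset[OF continuous_on_tube_inv]) auto
    show "continuous_on ?T (\<lambda>x. (fst (tube_inv x), sgn (snd (tube_inv x))))"
      by (intro continuous_intros c ballI) (metis snd_conv tube_decomposition)
    show "(\<lambda>x. (fst (tube_inv x), sgn (snd (tube_inv x)))) ` ?T \<subseteq> circle \<times> ball 0 2"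
    proof (rule image_subsetI)
      fix x assume "x \<in> ?T"
      then obtain u z where "u \<in> circle" "tube_inv x = (u, z)" "sgn z \<in> circle"
        by (rule tube_decomposition)
      then show "(fst (tube_inv x), sgn (snd (tube_inv x))) \<in> circle \<times> ball 0 2" by auto
    qed
  qed
  have "continuous_on (exterior \<union> ?T) (\<lambda>x. if x \<in> exterior then x else ?g x)"
  proof (rule continuous_on_cases_local)
    show "closedin (top_of_set (exterior \<union> ?T)) exterior"
      using compact_exterior by (intro closed_subset) (auto intro: compact_imp_closed)
    have "?T = (exterior \<union> ?T) \<inter> N ` (circle \<times> cball 0 1)"
      using exterior_subset by auto
    then show "closedin (top_of_set (exterior \<union> ?T)) ?T"
      using compact_imp_closed[OF compact_tube] closedin_closed by metis
    fix x assume "x \<in> exterior \<and> x \<notin> exterior \<or> x \<in> ?T \<and> x \<in> exterior"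
    then have x: "x \<in> ?T" "x \<in> exterior" by auto
    obtain u z where uz: "x = N (u, z)" "u \<in> circle" "z \<in> cball 0 1" "tube_inv x = (u, z)"
      using tube_decomposition[OF x(1)] by metis
    have "norm z = 1" using N_in_exterior_iff[of u z] x(2) uz by auto
    then show "x = ?g x" using uz by (simp add: sgn_div_norm)
  qed (use g in auto)
  then show ?thesis unfolding complement_decomposition[symmetric] retraction_to_exterior_def .
qed

lemma path_connected_torus: "path_connected (N ` (circle \<times> circle))"
  by (intro path_connected_continuous_image continuous_on_subset[OF N_cont sub_domain(3)]
      path_connected_Times path_connected_sphere) auto

text \<open>A path in the sphere from a point of the exterior to the tube first meets the tube on its
  boundary torus.\<close>

lemma path_connected_exterior: "path_connected exterior"
proof -
  have base: "path_component exterior a (N (1, 1))" if a: "a \<in> exterior" for a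
  proof -
    let ?T = "N ` (circle \<times> cball 0 1)" and ?O = "N ` (circle \<times> ball 0 1)"
    have "a \<in> S3" "N (1, 1) \<in> S3" using a base_in_exterior exterior_subset by auto
    moreover have "path_connected S3" by (rule path_connected_sphere) simp
    ultimately obtain p where p: "path p" "path_image p \<subseteq> S3" "pathstart p = a" "pathfinish p = N (1, 1)"
      unfolding path_connected_def by blast
    have pc: "continuous_on {0..1} p" and pS: "\<And>t. t \<in> {0..1} \<Longrightarrow> p t \<in> S3"
      using p(1,2) unfolding path_def path_image_def by blast+
    define A where "A = {t \<in> {0..1}. p t \<in> ?T}"
    have "closed A"
      using continuous_closed_preimage[OF pc closed_atLeastAtMost compact_imp_closed[OF compact_tube]]
      by (simp add: A_def vimage_def Int_def)
    then have "compact ({0..1} \<inter> A)" by (intro compact_Int_closed) auto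
    moreover have "{0..1} \<inter> A = A" by (auto simp: A_def)
    ultimately have "compact A" by simp
    moreover have "1 \<in> A" using p(4) by (auto simp: A_def pathfinish_def)
    ultimately obtain m where m: "m \<in> A" "\<And>t. t \<in> A \<Longrightarrow> m \<le> t"
      using compact_attains_inf[of A] by blast
    have m01: "m \<in> {0..1}" and pm: "p m \<in> ?T" using m(1) by (auto simp: A_def)
    have ext: "p t \<in> exterior" if "0 \<le> t" "t < m" for t
    proof -
      have "t \<in> {0..1}" "t \<notin> A" using that m(2)[of t] m01 by auto
      then have "p t \<in> S3" "p t \<notin> ?T" using pS by (auto simp: A_def)
      then show ?thesis unfolding exterior_def knot_exterior_def by auto
    qed
    \<comment> \<open>The open tube is open in the sphere, so a first hitting point inside it would
      be preceded by other points of the tube. Time 0 is excluded because \<open>a\<close> lies in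
      the exterior.\<close>
    have "p m \<notin> ?O"
    proof
      assume O: "p m \<in> ?O"
      obtain Q where Q: "open Q" "?O = S3 \<inter> Q" using openin_tube unfolding openin_open by blast
      have "m \<noteq> 0" using O p(3) a by (auto simp: pathstart_def exterior_def knot_exterior_def)
      have "openin (top_of_set {0..1}) ({0..1} \<inter> p -` Q)"
        by (rule continuous_openin_preimage_gen[OF pc Q(1)])
      moreover have "m \<in> {0..1} \<inter> p -` Q" using m01 O Q(2) by blast
      ultimately obtain d where d: "0 < d" "\<And>t. t \<in> {0..1} \<Longrightarrow> dist t m < d \<Longrightarrow> p t \<in> Q"
        unfolding openin_euclidean_subtopology_iff by blast
      define t where "t = max 0 (m - d / 2)"
      have t: "t \<in> {0..1}" "t < m" "dist t m < d" using m01 d(1) \<open>m \<noteq> 0\<close> by (auto simp: t_def dist_real_def)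
      then have "p t \<in> ?O" using d(2) pS Q(2) by blast
      then show False using ext[of t] t by (auto simp: exterior_def knot_exterior_def)
    qed
    then have torus: "p m \<in> N ` (circle \<times> circle)" using pm by (force simp: less_le)
    have "path_component exterior a (p m)"
      unfolding path_component_def
    proof (intro exI conjI)
      let ?q = "\<lambda>t. p (m * t)"
      have "continuous_on {0..1} ?q"
        by (rule continuous_on_compose2[OF pc]) (use m01 in \<open>auto intro!: continuous_intros mult_le_one\<close>)
      then show "path ?q" by (simp add: path_def)
      show "path_image ?q \<subseteq> exterior"
      proof (clarsimp simp: path_image_def)
        fix t :: real assume t: "0 \<le> t" "t \<le> 1"
        have "m * t \<le> m" using t m01 mult_left_le by auto
        then show "p (m * t) \<in> exterior"
          using ext[of "m * t"] torus torus_in_exterior t m01 by (cases "m * t = m") auto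
      qed
      show "pathstart ?q = a" "pathfinish ?q = p m" using p(3) by (auto simp: pathstart_def pathfinish_def)
    qed
    moreover have "path_component exterior (p m) (N (1, 1))"
    proof (rule path_component_of_subset[OF torus_in_exterior])
      show "path_component (N ` (circle \<times> circle)) (p m) (N (1, 1))"
        using path_connected_torus torus unfolding path_connected_component by auto
    qed
    ultimately show ?thesis by (rule path_component_trans)
  qed
  show ?thesis
    unfolding path_connected_component
  proof (intro ballI)
    fix a b assume "a \<in> exterior" "b \<in> exterior"
    then show "path_component exterior a b"
      using path_component_trans[OF base path_component_sym[OF base]] by blast
  qed
qed

section \<open>The peripheral subgroup\<close>

definition torus_map :: "real \<times> real \<Rightarrow> real^4" where
  "torus_map = (\<lambda>(s, t). N (cis (2 * pi * s), cis (2 * pi * t)))"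

text \<open>\<open>torus_map\<close> is the universal covering of the boundary torus, with the
  longitude along the first coordinate. The loop of \<open>a\<close> meridians and \<open>b\<close>
  longitudes lifts to the segment from the origin to \<open>(b, a)\<close>, hence the swapped
  coordinates.\<close>

definition slope_loop :: "int \<Rightarrow> int \<Rightarrow> real \<Rightarrow> real^4" where
  "slope_loop a b = (\<lambda>t. torus_map (of_int b * t, of_int a * t))"

definition slope_class :: "int \<Rightarrow> int \<Rightarrow> (real \<Rightarrow> real^4) set" where
  "slope_class a b = loop_class (top_of_set (S3 - K)) (N (1, 1)) (slope_loop a b)"

lemma torus_map_in_torus: "torus_map x \<in> N ` (circle \<times> circle)"
  by (auto simp: torus_map_def case_prod_beta)

lemma continuous_map_torus_map: "continuous_map (top_of_set UNIV) (top_of_set (S3 - K)) torus_map"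
proof -
  have "continuous_on UNIV (\<lambda>x. N (cis (2 * pi * fst x), cis (2 * pi * snd x)))"
    by (rule continuous_on_compose2[OF N_cont]) (auto intro!: continuous_intros)
  then have "continuous_on UNIV torus_map" by (simp add: torus_map_def case_prod_beta)
  moreover have "torus_map ` UNIV \<subseteq> S3 - K"
    using torus_map_in_torus torus_in_exterior exterior_subset by blast
  ultimately show ?thesis by (auto simp: continuous_map_in_subtopology)
qed

lemma torus_map_periodic: "torus_map (s + of_int a, t + of_int b) = torus_map (s, t)"
proof -
  have "cis (2 * pi * (x + of_int n)) = cis (2 * pi * x)" for x n
    by (simp add: distrib_left cis_multiple_2pi flip: cis_mult)
  then show ?thesis by (simp add: torus_map_def)
qed

lemma torus_map_0: "torus_map (0, 0) = N (1, 1)"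
  by (simp add: torus_map_def)

lemma slope_loop_in_loops: "slope_loop a b \<in> loops (top_of_set (S3 - K)) (N (1, 1))"
proof -
  have "continuous_map (top_of_set {0..1}) (top_of_set (S3 - K)) (\<lambda>t. torus_map (of_int b * t, of_int a * t))"
    by (rule continuous_map_comp_on[OF continuous_map_torus_map]) (auto intro!: continuous_intros)
  then show ?thesis
    using torus_map_periodic[of 0 b 0 a] by (simp add: loops_def pathin_def slope_loop_def torus_map_0)
qed

lemma base_in_complement: "N (1, 1) \<in> S3 - K"
  using base_in_exterior exterior_subset by blast

lemma group_knot_group: "group (knot_group K N)"
  unfolding knot_group_def by (rule fundamental_group_group) (use base_in_complement in simp)

lemma slope_class_in_carrier: "slope_class a b \<in> carrier (knot_group K N)"
  using slope_loop_in_loops by (simp add: knot_group_def slope_class_def)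

text \<open>In the covering plane the product lifts to the broken line through \<open>(b, a)\<close>
  to \<open>(b + d, a + c)\<close>, which is homotopic to the segment with the same ends;
  periodicity accounts for the shifted start of the second half. In particular meridian and
  longitude commute.\<close>

lemma slope_class_mult:
  "slope_class a b \<otimes>\<^bsub>knot_group K N\<^esub> slope_class c d = slope_class (a + c) (b + d)"
proof -
  let ?X = "top_of_set (S3 - K)"
  let ?u = "\<lambda>t. (of_int b * min (2 * t) 1 + of_int d * max 0 (2 * t - 1),
                 of_int a * min (2 * t) 1 + of_int c * max 0 (2 * t - 1)) :: real \<times> real"
  let ?v = "\<lambda>t. (of_int (b + d) * t, of_int (a + c) * t) :: real \<times> real"
  have "path_homotopic ?X (\<lambda>t. torus_map (?u t)) (\<lambda>t. torus_map (?v t))"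
    by (rule path_homotopic_convex[OF convex_UNIV continuous_map_torus_map])
      (auto intro!: continuous_intros)
  moreover have "(\<lambda>t. torus_map (?v t)) = slope_loop (a + c) (b + d)"
    by (simp add: slope_loop_def)
  moreover have "(\<lambda>t. torus_map (?u t)) = loop_join (slope_loop a b) (slope_loop c d)"
  proof
    fix t :: real
    show "torus_map (?u t) = loop_join (slope_loop a b) (slope_loop c d) t"
    proof (cases "t \<le> 1/2")
      case True
      then show ?thesis by (simp add: loop_join_def slope_loop_def)
    next
      case False
      then show ?thesis
        using torus_map_periodic[of "of_int d * (2 * t - 1)" b "of_int c * (2 * t - 1)" a]
        by (simp add: loop_join_def slope_loop_def add.commute)
    qed
  qed
  ultimately have "path_homotopic ?X (loop_join (slope_loop a b) (slope_loop c d)) (slope_loop (a + c) (b + d))"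
    by simp
  then show ?thesis
    unfolding knot_group_def slope_class_def fundamental_group_mult[OF slope_loop_in_loops slope_loop_in_loops]
    by (rule loop_class_eqI) (intro loops_join slope_loop_in_loops)
qed

lemma slope_class_0: "slope_class 0 0 = \<one>\<^bsub>knot_group K N\<^esub>"
  by (simp add: slope_class_def knot_group_def fundamental_group_one slope_loop_def torus_map_0)

lemma slope_class_pow:
  "slope_class a b [^]\<^bsub>knot_group K N\<^esub> (n :: int) = slope_class (n * a) (n * b)"
proof -
  interpret group "knot_group K N" by (rule group_knot_group)
  have nat: "slope_class a b [^]\<^bsub>knot_group K N\<^esub> (k :: nat) = slope_class (int k * a) (int k * b)" for k
    by (induction k) (simp_all add: slope_class_0 slope_class_mult algebra_simps)
  show ?thesis
  proof (cases n rule: int_cases2)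
    case (nonneg k)
    then show ?thesis by (simp add: int_pow_int nat)
  next
    case (nonpos k)
    have "slope_class (n * a) (n * b) = inv\<^bsub>knot_group K N\<^esub> slope_class (int k * a) (int k * b)"
      by (rule inv_equality[symmetric]) (simp_all add: nonpos slope_class_mult slope_class_0 slope_class_in_carrier)
    then show ?thesis by (simp add: nonpos int_pow_neg_int slope_class_in_carrier nat)
  qed
qed

lemma meridian_eq: "meridian K N = slope_class 1 0"
  by (simp add: meridian_def slope_class_def slope_loop_def torus_map_def)

lemma longitude_eq: "longitude K N = slope_class 0 1"
  by (simp add: longitude_def slope_class_def slope_loop_def torus_map_def)

text \<open>The knot complement is not open in the ambient space, but the cone over it without the
  apex is, and normalising vectors by \<open>sgn\<close> retracts this cone onto it.\<close>

lemma countable_knot_group: "countable (carrier (knot_group K N))"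
  unfolding knot_group_def
proof (rule countable_fundamental_group_nbhd_retract)
  let ?U = "(-{0}) \<inter> sgn -` (- K)"
  have c: "continuous_on (-{0}) (sgn :: real^4 \<Rightarrow> real^4)" by (intro continuous_intros) auto
  show "open ?U"
    using compact_imp_closed[OF compact_K] by (intro continuous_open_preimage[OF c]) auto
  show "continuous_on ?U (sgn :: real^4 \<Rightarrow> real^4)" by (rule continuous_on_subset[OF c]) auto
  show "sgn ` ?U \<subseteq> S3 - K" by (auto simp: norm_sgn)
  show "sgn x = x" if "x \<in> S3 - K" for x using that by (auto simp: sgn_div_norm)
  then show "S3 - K \<subseteq> ?U" by auto
qed

end

section \<open>Dehn surgery\<close>

locale surgery = solid_torus_embedding +
  fixes p q :: int and h :: "complex \<times> complex \<Rightarrow> real^4" and k :: "real^4 \<Rightarrow> complex \<times> complex"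
    and M :: "'m topology" and i :: "real^4 \<Rightarrow> 'm" and j :: "complex \<times> complex \<Rightarrow> 'm"
  assumes hk: "homeomorphism (circle \<times> circle) (N ` (circle \<times> circle)) h k"
    and meridian_slope: "h ` ({1} \<times> circle) = slope_curve N p q"
    and i_inj: "inj_on i exterior" and j_inj: "inj_on j (circle \<times> cball 0 1)"
    and M_space: "topspace M = i ` exterior \<union> j ` (circle \<times> cball 0 1)"
    and glue: "x \<in> exterior \<Longrightarrow> v \<in> circle \<times> cball 0 1 \<Longrightarrow>
                 i x = j v \<longleftrightarrow> v \<in> circle \<times> circle \<and> x = h v"
    and M_open: "W \<subseteq> topspace M \<Longrightarrow> openin M W \<longleftrightarrow>
                   openin (top_of_set exterior) {x \<in> exterior. i x \<in> W} \<and>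
                   openin (top_of_set (circle \<times> cball 0 1)) {v \<in> circle \<times> cball 0 1. j v \<in> W}"
begin

abbreviation "V \<equiv> circle \<times> (cball 0 1 :: complex set)"
abbreviation "T \<equiv> circle \<times> circle"

lemma T_sub_V: "T \<subseteq> V" by auto

lemma compact_V: "compact V" by (intro compact_Times) auto

lemma compact_T: "compact T" by (intro compact_Times) auto

lemma h_T: "v \<in> T \<Longrightarrow> h v \<in> exterior"
  using homeomorphism_image1[OF hk] torus_in_exterior by blast

lemma h_cont: "continuous_on T h"
  using hk by (rule homeomorphism_cont1)

lemma glue_T: "v \<in> T \<Longrightarrow> j v = i (h v)"
proof -
  assume v: "v \<in> T"
  show "j v = i (h v)" using glue[OF h_T[OF v] subsetD[OF T_sub_V v]] v by simp
qed

lemma i_cont: "continuous_map (top_of_set exterior) M i"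
proof -
  have "i \<in> exterior \<rightarrow> topspace M" using M_space by blast
  moreover have "openin (top_of_set exterior) {x \<in> exterior. i x \<in> W}" if "openin M W" for W
    using M_open[OF openin_subset[OF that]] that by blast
  ultimately show ?thesis unfolding continuous_map_def by simp
qed

lemma j_cont: "continuous_map (top_of_set V) M j"
proof -
  have "j \<in> V \<rightarrow> topspace M" using M_space by blast
  moreover have "openin (top_of_set V) {v \<in> V. j v \<in> W}" if "openin M W" for W
    using M_open[OF openin_subset[OF that]] that by blast
  ultimately show ?thesis unfolding continuous_map_def by simp
qed

lemma M_closed:
  assumes "C \<subseteq> topspace M"
    and "closed {x \<in> exterior. i x \<in> C}" "closed {v \<in> V. j v \<in> C}"
  shows "closedin M C"
proof -
  have "{x \<in> exterior. i x \<in> topspace M - C} = exterior - {x \<in> exterior. i x \<in> C}"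
    "{v \<in> V. j v \<in> topspace M - C} = V - {v \<in> V. j v \<in> C}"
    using M_space by blast+
  moreover have "openin (top_of_set exterior) (exterior - {x \<in> exterior. i x \<in> C})"
    by (intro openin_diff closed_subset assms) auto
  moreover have "openin (top_of_set V) (V - {v \<in> V. j v \<in> C})"
    by (intro openin_diff closed_subset assms) auto
  ultimately have "openin M (topspace M - C)"
    using M_open[of "topspace M - C"] by simp
  then show ?thesis using assms(1) by (simp add: closedin_def)
qed

text \<open>Closedness in \<open>M\<close> is tested in both pieces. In the solid torus the image of
  \<open>C\<close> leaves the preimage of \<open>C\<close> under \<open>h\<close>, which is closed
  because \<open>h\<close> is continuous on the compact torus \<open>T\<close>.\<close>

lemma i_closed: "closed_map (top_of_set exterior) M i"
  unfolding closed_map_def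
proof (intro allI impI)
  fix C assume "closedin (top_of_set exterior) C"
  then have C: "closed C" "C \<subseteq> exterior"
    using compact_imp_closed[OF compact_exterior] closedin_closed_trans closedin_imp_subset by blast+
  have "{x \<in> exterior. i x \<in> i ` C} = C" using C(2) i_inj by (auto dest: inj_onD)
  moreover have "{v \<in> V. j v \<in> i ` C} = T \<inter> h -` C"
  proof (intro equalityI subsetI)
    fix v assume "v \<in> {v \<in> V. j v \<in> i ` C}"
    then obtain x where "v \<in> V" "x \<in> C" "i x = j v" by (metis (mono_tags, lifting) imageE mem_Collect_eq)
    then show "v \<in> T \<inter> h -` C" using glue[of x v] C(2) by auto
  next
    fix v assume "v \<in> T \<inter> h -` C"
    then show "v \<in> {v \<in> V. j v \<in> i ` C}" using glue_T T_sub_V by auto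
  qed
  ultimately show "closedin M (i ` C)"
    using C M_space continuous_closed_preimage[OF h_cont compact_imp_closed[OF compact_T] C(1)]
    by (intro M_closed) auto
qed

text \<open>In the exterior the image of \<open>C\<close> leaves the image of
  \<open>T \<inter> C\<close> under \<open>h\<close>, which is closed because it is compact.\<close>

lemma j_closed: "closed_map (top_of_set V) M j"
  unfolding closed_map_def
proof (intro allI impI)
  fix C assume "closedin (top_of_set V) C"
  then have C: "closed C" "C \<subseteq> V"
    using compact_imp_closed[OF compact_V] closedin_closed_trans closedin_imp_subset by blast+
  have "{v \<in> V. j v \<in> j ` C} = C" using C(2) j_inj by (auto dest: inj_onD)
  moreover have "{x \<in> exterior. i x \<in> j ` C} = h ` (T \<inter> C)"
  proof (intro equalityI subsetI)
    fix x assume "x \<in> {x \<in> exterior. i x \<in> j ` C}"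
    then obtain v where "x \<in> exterior" "v \<in> C" "i x = j v" by auto
    then show "x \<in> h ` (T \<inter> C)" using glue[of x v] C(2) by auto
  next
    fix x assume "x \<in> h ` (T \<inter> C)"
    then obtain v where v: "v \<in> T" "v \<in> C" "x = h v" by blast
    then have "i x = j v" "x \<in> exterior" using glue_T h_T by simp_all
    then show "x \<in> {x \<in> exterior. i x \<in> j ` C}" using v(2) by blast
  qed
  moreover have "compact (h ` (T \<inter> C))"
    by (intro compact_continuous_image continuous_on_subset[OF h_cont] compact_Int_closed compact_T C(1)) auto
  ultimately show "closedin M (j ` C)"
    using C M_space compact_imp_closed by (intro M_closed) auto
qed

definition "iinv = inv_into exterior i"
definition "jinv = inv_into V j"

lemma iinv: "x \<in> exterior \<Longrightarrow> iinv (i x) = x"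
  unfolding iinv_def by (rule inv_into_f_f[OF i_inj])

lemma jinv: "v \<in> V \<Longrightarrow> jinv (j v) = v"
  unfolding jinv_def by (rule inv_into_f_f[OF j_inj])

text \<open>An injective continuous closed map is an embedding. Applied to \<open>i\<close> and
  \<open>j\<close>, this lets paths of \<open>M\<close> that stay in one piece be read in the
  coordinates of that piece.\<close>

lemma continuous_inverse_of_closed_embedding:
  assumes "continuous_map X Y f" "closed_map X Y f" "\<And>x. x \<in> topspace X \<Longrightarrow> g (f x) = x"
  shows "continuous_map (subtopology Y (f ` topspace X)) X g"
proof -
  have "inj_on f (topspace X)" using assms(3) by (rule inj_on_inverseI)
  then have "homeomorphic_map X (subtopology Y (f ` topspace X)) f"
    using injective_closed_imp_embedding_map[OF assms(1,2)] by (simp add: embedding_map_def)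
  then obtain g' where g': "homeomorphic_maps X (subtopology Y (f ` topspace X)) f g'"
    using homeomorphic_map_maps by blast
  then have "continuous_map (subtopology Y (f ` topspace X)) X g'" "\<And>x. x \<in> topspace X \<Longrightarrow> g' (f x) = x"
    by (auto simp: homeomorphic_maps_def)
  then show ?thesis
    using assms(3) by (auto elim!: continuous_map_eq)
qed

lemma iinv_cont: "continuous_map (subtopology M (i ` exterior)) (top_of_set exterior) iinv"
  using continuous_inverse_of_closed_embedding[OF i_cont i_closed, of iinv] by (simp add: iinv)

lemma jinv_cont: "continuous_map (subtopology M (j ` V)) (top_of_set V) jinv"
  using continuous_inverse_of_closed_embedding[OF j_cont j_closed, of jinv] by (simp add: jinv)

text \<open>With the open solid torus this forms the open cover to which the van Kampen argument
  applies. The image of the exterior meets the solid torus only in its boundary and so is not open;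
  its place is taken by the larger set from which only the core circle is removed.\<close>

definition "off_core = topspace M - j ` (circle \<times> {0})"
definition "open_torus = j ` (circle \<times> ball 0 1)"

lemma openin_off_core: "openin M off_core"
proof -
  have "closed (circle \<times> {0::complex})" by (intro closed_Times) auto
  then have "closedin (top_of_set V) (circle \<times> {0})" by (intro closed_subset) auto
  then have "closedin M (j ` (circle \<times> {0}))" using j_closed unfolding closed_map_def by blast
  then show ?thesis unfolding off_core_def by blast
qed

lemma open_torus_sub: "circle \<times> ball 0 1 \<subseteq> V" by auto

lemma openin_open_torus: "openin M open_torus"
proof -
  have "i x \<noteq> j v" if "x \<in> exterior" "v \<in> circle \<times> ball 0 1" for x v
    using glue[OF that(1) subsetD[OF open_torus_sub that(2)]] that(2) by auto
  then have pre_i: "{x \<in> exterior. i x \<in> open_torus} = {}"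
    unfolding open_torus_def by blast
  have pre_j: "{v \<in> V. j v \<in> open_torus} = circle \<times> ball 0 1"
    using inj_on_image_mem_iff[OF j_inj _ open_torus_sub] open_torus_sub unfolding open_torus_def by blast
  have "openin (top_of_set V) (circle \<times> ball 0 1)"
  proof -
    have "circle \<times> ball 0 1 = V \<inter> (UNIV \<times> ball (0::complex) 1)" by auto
    moreover have "open ((UNIV :: complex set) \<times> ball (0::complex) 1)" by (intro open_Times) auto
    ultimately show ?thesis unfolding openin_open by blast
  qed
  moreover have sub: "open_torus \<subseteq> topspace M" using open_torus_sub M_space unfolding open_torus_def by blast
  ultimately show ?thesis unfolding M_open[OF sub] pre_i pre_j by simp
qed

lemma cover: "topspace M = off_core \<union> open_torus"
proof -
  have "j ` (circle \<times> {0}) \<subseteq> open_torus" unfolding open_torus_def by auto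
  moreover have "open_torus \<subseteq> topspace M" using openin_open_torus openin_subset by blast
  ultimately show ?thesis unfolding off_core_def by blast
qed

lemma i_off_core: "x \<in> exterior \<Longrightarrow> i x \<in> off_core"
proof -
  assume x: "x \<in> exterior"
  have "i x \<noteq> j v" if "v \<in> circle \<times> {0}" for v
    using glue[OF x, of v] that by auto
  then show ?thesis using x M_space unfolding off_core_def by blast
qed

lemma j_off_core_iff: "v \<in> V \<Longrightarrow> j v \<in> off_core \<longleftrightarrow> snd v \<noteq> 0"
proof -
  assume v: "v \<in> V"
  have "j v \<in> j ` (circle \<times> {0}) \<longleftrightarrow> v \<in> circle \<times> {0}"
    using v by (intro inj_on_image_mem_iff[OF j_inj]) auto
  then show ?thesis using v M_space unfolding off_core_def by (cases v) auto
qed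

text \<open>Only the disc coordinate has to be moved away from \<open>0\<close>, and the disc is convex.\<close>

lemma open_torus_path_off_core:
  assumes \<beta>: "pathin (subtopology M open_torus) \<beta>" and ends: "\<beta> 0 \<in> off_core" "\<beta> 1 \<in> off_core"
  shows "\<exists>\<beta>'. pathin (subtopology M off_core) \<beta>' \<and> path_homotopic M \<beta> \<beta>'"
proof -
  have \<beta>_torus: "\<beta> t \<in> open_torus" if "t \<in> {0..1}" for t
    using \<beta> that unfolding pathin_def continuous_map_in_subtopology by auto
  define w where "w t = jinv (\<beta> t)" for t
  have w: "w t \<in> circle \<times> ball 0 1" "j (w t) = \<beta> t" if t: "t \<in> {0..1}" for t
  proof -
    obtain v where "v \<in> circle \<times> ball 0 1" "\<beta> t = j v" using \<beta>_torus[OF t] unfolding open_torus_def by blast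
    then show "w t \<in> circle \<times> ball 0 1" "j (w t) = \<beta> t" using jinv open_torus_sub unfolding w_def by auto
  qed
  have "continuous_map (top_of_set {0..1}) (subtopology M (j ` V)) \<beta>"
    using pathin_subtopology[OF \<beta>] unfolding pathin_def
    by (rule continuous_map_into_subtopology)
      (use \<beta>_torus image_mono[OF open_torus_sub, of j] in \<open>auto simp flip: open_torus_def\<close>)
  then have "continuous_map (top_of_set {0..1}) (top_of_set V) (jinv \<circ> \<beta>)"
    using jinv_cont by (rule continuous_map_compose)
  then have wc: "continuous_on {0..1} w" by (simp add: w_def o_def)
  have "snd (w 0) \<noteq> 0" "snd (w 1) \<noteq> 0"
    using ends w[of 0] w[of 1] j_off_core_iff[of "w 0"] j_off_core_iff[of "w 1"] open_torus_sub by auto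
  then have "snd (w 0) \<in> ball 0 1 - {0}" "snd (w 1) \<in> ball 0 1 - {0}"
    using w(1)[of 0] w(1)[of 1] by auto
  \<comment> \<open>Any path in the punctured disc with the right ends will do: in the full disc it
    is homotopic to the disc coordinate of \<open>\<beta>\<close>.\<close>
  moreover have "path_connected (ball 0 1 - {0::complex})" by (rule path_connected_punctured_ball) simp
  ultimately obtain g where g: "path g" "path_image g \<subseteq> ball 0 1 - {0}" "pathstart g = snd (w 0)" "pathfinish g = snd (w 1)"
    unfolding path_connected_def by blast
  have gc: "continuous_on {0..1} g" and g_im: "\<And>t. t \<in> {0..1} \<Longrightarrow> g t \<in> ball 0 1 - {0}"
    using g(1,2) unfolding path_def path_image_def by blast+
  \<comment> \<open>Time is kept as a coordinate so that the circle component is prescribed by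
    \<open>w\<close>. Both paths then live in an interval times a disc, which is convex although the
    solid torus is not.\<close>
  let ?P = "\<lambda>x. j (fst (w (fst x)), snd x)"
  have P: "continuous_map (top_of_set ({0..1} \<times> ball 0 1)) M ?P"
  proof (rule continuous_map_comp_on[OF j_cont])
    have "continuous_on ({0..1} \<times> ball 0 1) (\<lambda>x. w (fst x))"
      by (rule continuous_on_compose2[OF wc]) (auto intro!: continuous_intros)
    then show "continuous_on ({0..1} \<times> ball 0 1) (\<lambda>x. (fst (w (fst x)), snd x))"
      by (intro continuous_intros)
    show "(\<lambda>x. (fst (w (fst x)), snd x)) ` ({0..1} \<times> ball 0 1) \<subseteq> V"
      using w(1) by fastforce
  qed
  have "path_homotopic M (\<lambda>t. ?P (t, snd (w t))) (\<lambda>t. ?P (t, g t))"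
  proof (rule path_homotopic_convex[OF _ P])
    show "convex ({0..1::real} \<times> ball (0::complex) 1)" by (intro convex_Times convex_ball convex_real_interval)
    show "continuous_on {0..1} (\<lambda>t. (t, snd (w t)))" "continuous_on {0..1} (\<lambda>t. (t, g t))"
      by (intro continuous_intros wc gc)+
    show "(\<lambda>t. (t, snd (w t))) ` {0..1} \<subseteq> {0..1} \<times> ball 0 1"
      using w(1) by fastforce
    show "(\<lambda>t. (t, g t)) ` {0..1} \<subseteq> {0..1} \<times> ball 0 1"
      using g_im by fastforce
    show "(0, snd (w 0)) = (0::real, g 0)" "(1, snd (w 1)) = (1::real, g 1)"
      using g(3,4) by (simp_all add: pathstart_def pathfinish_def)
  qed
  moreover have "path_homotopic M \<beta> (\<lambda>t. ?P (t, snd (w t)))"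
    using pathin_subtopology[OF \<beta>] by (rule path_homotopic_eq) (simp add: w(2))
  ultimately have hom: "path_homotopic M \<beta> (\<lambda>t. ?P (t, g t))" by (rule path_homotopic_trans[rotated])
  moreover have "pathin (subtopology M off_core) (\<lambda>t. ?P (t, g t))"
  proof -
    have "?P (t, g t) \<in> off_core" if "t \<in> {0..1}" for t
      using w(1)[OF that] g_im[OF that] by (subst j_off_core_iff) auto
    then show ?thesis
      using path_homotopic_pathin(2)[OF hom] unfolding pathin_def
      by (intro continuous_map_into_subtopology) auto
  qed
  ultimately show ?thesis by blast
qed

text \<open>For \<open>s\<close> from 0 to 1 this is the deformation retraction of the solid torus
  without its core onto the boundary torus.\<close>

definition radial :: "real \<Rightarrow> complex \<times> complex \<Rightarrow> complex \<times> complex" where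
  "radial s v = (fst v, (1 - s) *\<^sub>R snd v + s *\<^sub>R sgn (snd v))"

lemma radial_in_V:
  assumes "v \<in> V" "snd v \<noteq> 0" "s \<in> {0..1}"
  shows "radial s v \<in> V"
proof -
  have "sgn (snd v) \<in> cball 0 1" "snd v \<in> cball 0 1" using assms by (auto simp: norm_sgn)
  then have "(1 - s) *\<^sub>R snd v + s *\<^sub>R sgn (snd v) \<in> cball 0 1"
    using assms(3) by (intro convexD_alt convex_cball) auto
  then show ?thesis using assms(1) by (auto simp: radial_def)
qed

lemma radial_T: "v \<in> T \<Longrightarrow> radial s v = v"
  by (auto simp: radial_def sgn_div_norm simp flip: scaleR_left_distrib)

text \<open>Points of \<open>\<gamma>\<close> outside the exterior move along \<open>radial\<close>,
  the others rest, and the two rules agree on the glued torus. The ends rest by assumption, and the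
  final path lies in the image of the exterior, where \<open>iinv\<close> pulls it back.\<close>

lemma deform_to_exterior:
  assumes \<gamma>: "pathin (subtopology M off_core) \<gamma>" and ends: "\<gamma> 0 \<in> i ` exterior" "\<gamma> 1 \<in> i ` exterior"
  shows "\<exists>\<sigma>. pathin (top_of_set exterior) \<sigma> \<and> path_homotopic M \<gamma> (i \<circ> \<sigma>)"
proof -
  let ?Q = "top_of_set ({0..1::real} \<times> {0..1::real})"
  let ?E = "\<lambda>z. \<gamma> (snd z) \<in> i ` exterior"
  let ?f = "\<lambda>z. \<gamma> (snd z)" and ?g = "\<lambda>z. j (radial (fst z) (jinv (\<gamma> (snd z))))"
  have \<gamma>_off: "\<gamma> t \<in> off_core" if "t \<in> {0..1}" for t
    using \<gamma> that unfolding pathin_def continuous_map_in_subtopology by auto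
  have \<gamma>M: "continuous_map ?Q M ?f"
    using pathin_subtopology[OF \<gamma>] unfolding pathin_def
    by (rule continuous_map_comp_on) (auto intro!: continuous_intros)
  have closed_i: "closedin M (i ` exterior)" and closed_j: "closedin M (j ` V)"
    using i_closed j_closed unfolding closed_map_def by (metis closedin_topspace topspace_euclidean_subtopology)+
  \<comment> \<open>\<open>continuous_map_cases\<close> asks for the two formulas on the closures of
    the case sets. As preimages of closed sets, \<open>CE\<close> and \<open>CV\<close> contain
    these closures; on their overlap the path is on the glued torus, which \<open>radial\<close>
    fixes.\<close>
  define CE where "CE = {z \<in> topspace ?Q. ?f z \<in> i ` exterior}"
  define CV where "CV = {z \<in> topspace ?Q. ?f z \<in> j ` V}"
  have "closedin ?Q CE" "closedin ?Q CV"
    unfolding CE_def CV_def using closedin_continuous_map_preimage[OF \<gamma>M] closed_i closed_j by blast+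
  moreover have "topspace ?Q \<inter> {z. ?E z} \<subseteq> CE" "topspace ?Q \<inter> {z. \<not> ?E z} \<subseteq> CV"
  proof -
    show "topspace ?Q \<inter> {z. ?E z} \<subseteq> CE" by (auto simp: CE_def)
    show "topspace ?Q \<inter> {z. \<not> ?E z} \<subseteq> CV"
    proof
      fix z assume z: "z \<in> topspace ?Q \<inter> {z. \<not> ?E z}"
      then have "?f z \<in> topspace M" using \<gamma>_off[of "snd z"] unfolding off_core_def by auto
      then show "z \<in> CV" using z M_space unfolding CV_def by blast
    qed
  qed
  ultimately have "?Q closure_of (topspace ?Q \<inter> {z. ?E z}) \<subseteq> CE"
    "?Q closure_of (topspace ?Q \<inter> {z. \<not> ?E z}) \<subseteq> CV"
    by (metis (no_types) closure_of_minimal)+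
  then have cl: "?Q closure_of {z. ?E z} \<subseteq> CE" "?Q closure_of {z. \<not> ?E z} \<subseteq> CV"
    unfolding closure_of_restrict[of ?Q "{z. ?E z}", symmetric]
      closure_of_restrict[of ?Q "{z. \<not> ?E z}", symmetric] .
  have in_CV: "jinv (?f z) \<in> V" "j (jinv (?f z)) = ?f z" "snd (jinv (?f z)) \<noteq> 0" if z: "z \<in> CV" for z
  proof -
    obtain v where v: "v \<in> V" "?f z = j v" using z unfolding CV_def by blast
    moreover have "snd z \<in> {0..1}" using z unfolding CV_def by auto
    then have "?f z \<in> off_core" by (rule \<gamma>_off)
    ultimately show "jinv (?f z) \<in> V" "j (jinv (?f z)) = ?f z" "snd (jinv (?f z)) \<noteq> 0"
      using jinv[OF v(1)] j_off_core_iff[OF v(1)] by auto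
  qed
  have "continuous_map (subtopology ?Q CV) (subtopology M (j ` V)) ?f"
    by (rule continuous_map_into_subtopology[OF continuous_map_from_subtopology[OF \<gamma>M]]) (simp add: CV_def Pi_iff)
  then have "continuous_map (subtopology ?Q CV) (top_of_set V) (jinv \<circ> ?f)"
    using jinv_cont by (rule continuous_map_compose)
  moreover have Q_CV: "subtopology ?Q CV = top_of_set CV"
    by (subst subtopology_subtopology) (auto simp: CV_def intro!: arg_cong[of _ _ top_of_set])
  ultimately have jf: "continuous_on CV (\<lambda>z. jinv (?f z))" by (simp add: o_def)
  have g: "continuous_map (top_of_set CV) M ?g"
  proof (rule continuous_map_comp_on[OF j_cont])
    show "continuous_on CV (\<lambda>z. radial (fst z) (jinv (\<gamma> (snd z))))"
    proof -
      have s: "continuous_on CV (\<lambda>z. sgn (snd (jinv (?f z))))"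
        by (rule continuous_on_sgn[OF continuous_on_snd[OF jf]]) (use in_CV(3) in blast)
      show ?thesis
        unfolding radial_def
        by (intro continuous_on_Pair continuous_on_add continuous_on_scaleR continuous_on_diff
            continuous_on_const continuous_on_fst continuous_on_snd continuous_on_id jf s)
    qed
    show "(\<lambda>z. radial (fst z) (jinv (\<gamma> (snd z)))) ` CV \<subseteq> V"
    proof (rule image_subsetI)
      fix z assume z: "z \<in> CV"
      then have "fst z \<in> {0..1}" by (auto simp: CV_def)
      then show "radial (fst z) (jinv (\<gamma> (snd z))) \<in> V"
        by (rule radial_in_V[OF in_CV(1)[OF z] in_CV(3)[OF z]])
    qed
  qed
  have eq_on_both: "?f z = ?g z" if z: "z \<in> CE" "z \<in> CV" for z
  proof -
    obtain x where x: "x \<in> exterior" "?f z = i x" using z(1) unfolding CE_def by blast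
    then have "jinv (?f z) \<in> T" using glue[OF x(1) in_CV(1)[OF z(2)]] in_CV(2)[OF z(2)] by simp
    then show ?thesis using radial_T in_CV(2)[OF z(2)] by simp
  qed
  let ?H = "\<lambda>z. if ?E z then ?f z else ?g z"
  have H: "continuous_map ?Q M ?H"
  proof (rule continuous_map_cases)
    show "continuous_map (subtopology ?Q (?Q closure_of {z. ?E z})) M ?f"
      using \<gamma>M by (rule continuous_map_from_subtopology)
    show "continuous_map (subtopology ?Q (?Q closure_of {z. \<not> ?E z})) M ?g"
      using g cl(2) unfolding Q_CV[symmetric] by (rule continuous_map_from_subtopology_mono)
    fix z assume "z \<in> ?Q frontier_of {z. ?E z}"
    then have "z \<in> ?Q closure_of {z. ?E z}" "z \<in> ?Q closure_of {z. \<not> ?E z}"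
      by (auto simp: frontier_of_closures Collect_neg_eq closure_of_restrict[of ?Q "- {z. ?E z}"] Diff_eq Int_commute)
    then show "?f z = ?g z" using eq_on_both cl by blast
  qed
  have hom: "path_homotopic M \<gamma> (\<lambda>t. ?H (1, t))"
    unfolding path_homotopic_iff
  proof (intro exI[of _ ?H] conjI ballI)
    show "continuous_map ?Q M ?H" by (rule H)
    show "?H (0, t) = \<gamma> t" if t: "t \<in> {0..1}" for t
    proof (cases "?E (0, t)")
      case False
      then have "(0, t) \<in> CV" using t cl(2) \<gamma>_off[OF t] M_space unfolding off_core_def CV_def by auto
      then show ?thesis using False in_CV(2)[of "(0, t)"] by (simp add: radial_def)
    qed simp
  qed (use ends in auto)
  have end_ext: "?H (1, t) \<in> i ` exterior" if t: "t \<in> {0..1}" for t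
  proof (cases "?E (1, t)")
    case False
    then have cv: "(1, t) \<in> CV" using t \<gamma>_off[OF t] M_space unfolding off_core_def CV_def by auto
    then have "radial 1 (jinv (\<gamma> t)) \<in> T"
      using in_CV(1,3)[OF cv] by (auto simp: radial_def norm_sgn)
    then show ?thesis using False glue_T h_T by auto
  qed simp
  define \<sigma> where "\<sigma> t = iinv (?H (1, t))" for t
  have i\<sigma>: "i (\<sigma> t) = ?H (1, t)" if "t \<in> {0..1}" for t
    using end_ext[OF that] iinv unfolding \<sigma>_def by auto
  have "continuous_map (top_of_set {0..1}) (subtopology M (i ` exterior)) (\<lambda>t. ?H (1, t))"
    using path_homotopic_pathin(2)[OF hom] end_ext unfolding pathin_def
    by (intro continuous_map_into_subtopology) auto
  then have "continuous_map (top_of_set {0..1}) (top_of_set exterior) (iinv \<circ> (\<lambda>t. ?H (1, t)))"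
    using iinv_cont by (rule continuous_map_compose)
  moreover have "iinv \<circ> (\<lambda>t. ?H (1, t)) = \<sigma>" by (simp add: fun_eq_iff \<sigma>_def)
  ultimately have "pathin (top_of_set exterior) \<sigma>" unfolding pathin_def by metis
  moreover have "path_homotopic M (\<lambda>t. ?H (1, t)) (i \<circ> \<sigma>)"
    using path_homotopic_pathin(2)[OF hom] by (rule path_homotopic_eq) (simp only: comp_apply i\<sigma>)
  then have "path_homotopic M \<gamma> (i \<circ> \<sigma>)" by (rule path_homotopic_trans[OF hom])
  ultimately show ?thesis by blast
qed

abbreviation "base \<equiv> N (1, 1)"

text \<open>This is surjectivity on fundamental groups: the van Kampen step pushes the loop off the
  core, and radial projection pushes it into the exterior. Injectivity of \<open>i\<close> makes the
  pulled-back path a loop at \<open>base\<close>.\<close>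

lemma loop_from_exterior:
  assumes "\<gamma> \<in> loops M (i base)"
  shows "\<exists>\<sigma>\<in>loops (top_of_set exterior) base. path_homotopic M \<gamma> (i \<circ> \<sigma>)"
proof -
  have b: "i base \<in> off_core" by (rule i_off_core[OF base_in_exterior])
  obtain \<gamma>' where \<gamma>': "\<gamma>' \<in> loops (subtopology M off_core) (i base)" "path_homotopic M \<gamma> \<gamma>'"
    using loops_deform_into_open_set[OF openin_off_core openin_open_torus cover b open_torus_path_off_core assms] by blast
  then have "pathin (subtopology M off_core) \<gamma>'" "\<gamma>' 0 = i base" "\<gamma>' 1 = i base" by (auto simp: loops_def)
  then obtain \<sigma> where \<sigma>: "pathin (top_of_set exterior) \<sigma>" "path_homotopic M \<gamma>' (i \<circ> \<sigma>)"
    using deform_to_exterior base_in_exterior by (metis imageI)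
  have ext: "\<sigma> t \<in> exterior" if "t \<in> {0..1}" for t
    using \<sigma>(1) that unfolding pathin_def continuous_map_in_subtopology by auto
  have "i (\<sigma> 0) = i base" "i (\<sigma> 1) = i base"
    using path_homotopic_endpoints[OF \<sigma>(2)] \<gamma>'(1) by (auto simp: loops_def)
  then have "\<sigma> 0 = base" "\<sigma> 1 = base"
    using inj_onD[OF i_inj] ext[of 0] ext[of 1] base_in_exterior by auto
  then have "\<sigma> \<in> loops (top_of_set exterior) base" using \<sigma>(1) by (simp add: loops_def)
  then show ?thesis using path_homotopic_trans[OF \<gamma>'(2) \<sigma>(2)] by blast
qed

text \<open>Read through \<open>k\<close>, the slope loop runs in the boundary circle of the
  meridian disc over 1. That disc is convex, so the loop contracts in it, and \<open>j\<close>
  carries the contraction to \<open>M\<close>.\<close>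

lemma slope_loop_null: "path_homotopic M (i \<circ> slope_loop p q) (\<lambda>_. i base)"
proof -
  define u where "u t = k (slope_loop p q t)" for t
  have in_curve: "slope_loop p q t \<in> slope_curve N p q" for t
    unfolding slope_curve_def slope_loop_def torus_map_def
    by (rule range_eqI[of _ _ "2 * pi * t"]) (simp add: mult_ac)
  have u: "u t \<in> {1} \<times> circle" "h (u t) = slope_loop p q t" for t
  proof -
    obtain v where v: "v \<in> {1} \<times> circle" "slope_loop p q t = h v"
      using in_curve[of t] meridian_slope by blast
    then have "k (h v) = v" using homeomorphism_apply1[OF hk, of v] by auto
    then show "u t \<in> {1} \<times> circle" "h (u t) = slope_loop p q t" using v by (auto simp: u_def)
  qed
  have ju: "j (u t) = i (slope_loop p q t)" for t
    using glue_T[of "u t"] u[of t] by auto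
  have "continuous_on {0..1} (\<lambda>t. k (slope_loop p q t))"
  proof (rule continuous_on_compose2[OF homeomorphism_cont2[OF hk]])
    show "continuous_on {0..1} (slope_loop p q)"
      using slope_loop_in_loops[of p q] by (simp add: loops_def pathin_def continuous_map_in_subtopology)
    show "slope_loop p q ` {0..1} \<subseteq> N ` T" using torus_map_in_torus by (auto simp: slope_loop_def)
  qed
  then have uc: "continuous_on {0..1} u" by (simp add: u_def)
  have "slope_loop p q 0 = base" "slope_loop p q 1 = base" using slope_loop_in_loops[of p q] by (auto simp: loops_def)
  then have u01: "u 0 = u 1" "j (u 0) = i base" using ju[of 0] by (simp_all add: u_def)
  have "path_homotopic M (\<lambda>t. j (u t)) (\<lambda>t. j (u 0))"
  proof (rule path_homotopic_convex[of "{1} \<times> cball 0 1"])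
    show "convex ({1::complex} \<times> cball (0::complex) 1)" by (intro convex_Times convex_cball) simp
    show "continuous_map (top_of_set ({1} \<times> cball 0 1)) M j"
      by (rule continuous_map_comp_on[OF j_cont, where u = "\<lambda>x. x"]) auto
    have "u t \<in> {1} \<times> cball 0 1" for t using u(1)[of t] by auto
    then show "u ` {0..1} \<subseteq> {1} \<times> cball 0 1" "(\<lambda>t. u 0) ` {0..1} \<subseteq> {1} \<times> cball 0 1" by blast+
  qed (use uc u01 in auto)
  moreover have "(\<lambda>t. j (u t)) = i \<circ> slope_loop p q" by (simp add: ju fun_eq_iff)
  ultimately show ?thesis by (simp only: u01(2))
qed

lemma path_connected_M:
  assumes "y \<in> topspace M"
  shows "\<exists>\<delta>. pathin M \<delta> \<and> \<delta> 0 = i base \<and> \<delta> 1 = y"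
proof -
  have ext: "\<exists>\<delta>. pathin M \<delta> \<and> \<delta> 0 = i base \<and> \<delta> 1 = i x" if x: "x \<in> exterior" for x
  proof -
    obtain g where g: "path g" "path_image g \<subseteq> exterior" "pathstart g = base" "pathfinish g = x"
      using path_connected_exterior x base_in_exterior unfolding path_connected_def by blast
    then have "pathin (top_of_set exterior) g"
      by (auto simp: pathin_def path_def path_image_def)
    then have "pathin M (i \<circ> g)" by (rule pathin_image[OF _ i_cont])
    then show ?thesis using g(3,4) by (intro exI[of _ "i \<circ> g"]) (simp add: pathstart_def pathfinish_def)
  qed
  consider x where "x \<in> exterior" "y = i x" | v where "v \<in> V" "y = j v"
    using assms M_space by blast
  then show ?thesis
  proof cases
    case 1
    then show ?thesis using ext by blast
  next
    case 2
    \<comment> \<open>A segment inside one meridian disc, from the boundary point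
      \<open>(fst v, 1)\<close>, which is glued to the exterior, to \<open>v\<close>.\<close>
    let ?e = "\<lambda>t::real. j (fst v, (1 - t) *\<^sub>R 1 + t *\<^sub>R snd v)"
    have e: "pathin M ?e"
      unfolding pathin_def
    proof (rule continuous_map_comp_on[OF j_cont])
      show "continuous_on {0..1} (\<lambda>t::real. (fst v, (1 - t) *\<^sub>R 1 + t *\<^sub>R snd v))" by (intro continuous_intros)
      have "(1 - t) *\<^sub>R 1 + t *\<^sub>R snd v \<in> cball 0 1" if "t \<in> {0..1}" for t :: real
        using that 2(1) by (intro convexD_alt convex_cball) auto
      then show "(\<lambda>t::real. (fst v, (1 - t) *\<^sub>R 1 + t *\<^sub>R snd v)) ` {0..1} \<subseteq> V" using 2(1) by auto
    qed
    have T: "(fst v, 1) \<in> T" using 2(1) by auto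
    obtain \<delta> where \<delta>: "pathin M \<delta>" "\<delta> 0 = i base" "\<delta> 1 = i (h (fst v, 1))" using ext[OF h_T[OF T]] by blast
    then have "\<delta> 1 = ?e 0" using glue_T[OF T] by simp
    then have "pathin M (loop_join \<delta> ?e)" by (rule pathin_loop_join[OF \<delta>(1) e])
    then show ?thesis using \<delta>(2) 2(2) by (intro exI[of _ "loop_join \<delta> ?e"]) simp
  qed
qed

theorem surgery_group_not_left_orderable:
  fixes c :: int
  assumes q: "0 < q" and slope: "c * q \<le> p" and y: "y \<in> topspace M"
    and fix_all: "\<And>\<rho> s g. \<rho> \<in> hom (knot_group K N) Homeo_plus \<Longrightarrow> \<rho> (meridian K N) s = s \<Longrightarrow>
        \<rho> (longitude K N) s = s \<Longrightarrow> g \<in> carrier (knot_group K N) \<Longrightarrow> \<rho> g s = s"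
    and gen: "meridian K N \<in> root_conj_closed_submonoid (knot_group K N)
        {meridian K N [^]\<^bsub>knot_group K N\<^esub> c \<otimes>\<^bsub>knot_group K N\<^esub> longitude K N, inv\<^bsub>knot_group K N\<^esub> meridian K N}"
  shows "\<not> left_orderable (fundamental_group M y)"
proof
  assume LO: "left_orderable (fundamental_group M y)"
  let ?G = "knot_group K N" and ?H = "fundamental_group M y" and ?X = "top_of_set (S3 - K)"
  obtain \<delta> where \<delta>: "pathin M \<delta>" "\<delta> 0 = i base" "\<delta> 1 = y" using path_connected_M[OF y] by blast
  define f where "f = i \<circ> retraction_to_exterior"
  have "continuous_map ?X (top_of_set exterior) retraction_to_exterior"
    using continuous_on_retraction retraction_in_exterior by (auto simp: continuous_map_in_subtopology)
  then have f: "continuous_map ?X M f"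
    unfolding f_def using i_cont by (rule continuous_map_compose)
  have f_ext: "f x = i x" if "x \<in> exterior" for x using that by (simp add: f_def retraction_id)
  have f_loops: "f \<circ> \<gamma> \<in> loops M (i base)" if "\<gamma> \<in> loops ?X base" for \<gamma>
    using that pathin_image[OF _ f] f_ext[OF base_in_exterior] by (auto simp: loops_def)
  \<comment> \<open>The map \<open>f\<close> takes loops at \<open>base\<close> to loops at
    \<open>i base\<close>; conjugation along \<open>\<delta>\<close> moves them to the given base
    point \<open>y\<close>.\<close>
  let ?F = "\<lambda>\<gamma>. conj_path \<delta> (f \<circ> \<gamma>)"
  have F_loops: "?F \<gamma> \<in> loops M y" if "\<gamma> \<in> loops ?X base" for \<gamma>
    using conj_path_in_loops[OF f_loops[OF that] \<delta>] .
  obtain \<phi> where \<phi>: "\<phi> \<in> hom (fundamental_group ?X base) ?H"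
    "\<And>\<gamma>. \<gamma> \<in> loops ?X base \<Longrightarrow> \<phi> (loop_class ?X base \<gamma>) = loop_class M y (?F \<gamma>)"
  proof (rule fundamental_group_hom[of ?X base ?F M y])
    fix \<gamma> \<gamma>' assume \<gamma>: "\<gamma> \<in> loops ?X base"
    show "path_homotopic M (?F \<gamma>) (?F \<gamma>')" if "path_homotopic ?X \<gamma> \<gamma>'"
      by (rule path_homotopic_conj[OF path_homotopic_image[OF that f] f_loops[OF \<gamma>] \<delta>(1,2)])
    show "path_homotopic M (?F (loop_join \<gamma> \<gamma>')) (loop_join (?F \<gamma>) (?F \<gamma>'))" if "\<gamma>' \<in> loops ?X base"
      unfolding loop_join_image
      by (rule path_homotopic_conj_join[OF f_loops[OF \<gamma>] f_loops[OF that] \<delta>(1,2)])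
  qed (use F_loops in auto)
  have null_iff: "\<phi> (loop_class ?X base \<gamma>) = \<one>\<^bsub>?H\<^esub> \<longleftrightarrow> path_homotopic M (f \<circ> \<gamma>) (\<lambda>_. i base)"
    if "\<gamma> \<in> loops ?X base" for \<gamma>
    using null_homotopic_conj_iff[OF f_loops[OF that] \<delta>]
    by (simp add: \<phi>(2)[OF that] fundamental_group_one loop_class_eq_iff F_loops[OF that] const_loop[OF y])
  \<comment> \<open>The slope loop lies on the boundary torus, where the retraction is the
    identity.\<close>
  have "f \<circ> slope_loop p q = i \<circ> slope_loop p q"
    using torus_map_in_torus torus_in_exterior f_ext by (fastforce simp: slope_loop_def)
  then have kill: "\<phi> (slope_class p q) = \<one>\<^bsub>?H\<^esub>"
    using null_iff[OF slope_loop_in_loops] slope_loop_null by (simp add: slope_class_def)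
  interpret G: group ?G by (rule group_knot_group)
  have "\<phi> g = \<one>\<^bsub>?H\<^esub>" if g: "g \<in> carrier ?G" for g
  proof (rule peripheral_quotient_trivial[where G = ?G and H = ?H and \<phi> = \<phi> and m = "meridian K N"
        and l = "longitude K N" and c = c and p = p and q = q])
    show "group ?G" "countable (carrier ?G)" "group ?H" "left_orderable ?H" "0 < q" "c * q \<le> p"
      "g \<in> carrier ?G"
      by (rule group_knot_group countable_knot_group fundamental_group_group[OF y] LO q slope g)+
    show "meridian K N \<in> root_conj_closed_submonoid ?G
        {meridian K N [^]\<^bsub>?G\<^esub> c \<otimes>\<^bsub>?G\<^esub> longitude K N, inv\<^bsub>?G\<^esub> meridian K N}"
      by (rule gen)
    show "\<rho> g s = s" if "\<rho> \<in> hom ?G Homeo_plus" "\<rho> (meridian K N) s = s" "\<rho> (longitude K N) s = s"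
      "g \<in> carrier ?G" for \<rho> s g
      by (rule fix_all[OF that])
    show "\<phi> \<in> hom ?G ?H" using \<phi>(1) by (simp add: knot_group_def)
    show "meridian K N \<in> carrier ?G" "longitude K N \<in> carrier ?G"
      "meridian K N \<otimes>\<^bsub>?G\<^esub> longitude K N = longitude K N \<otimes>\<^bsub>?G\<^esub> meridian K N"
      by (simp_all add: meridian_eq longitude_eq slope_class_in_carrier slope_class_mult)
    show "\<phi> (meridian K N [^]\<^bsub>?G\<^esub> p \<otimes>\<^bsub>?G\<^esub> longitude K N [^]\<^bsub>?G\<^esub> q) = \<one>\<^bsub>?H\<^esub>"
      by (simp add: meridian_eq longitude_eq slope_class_pow slope_class_mult kill)
  qed
  then have dead: "path_homotopic M (f \<circ> \<gamma>) (\<lambda>_. i base)" if "\<gamma> \<in> loops ?X base" for \<gamma>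
    using null_iff[OF that] that by (auto simp: knot_group_def)
  have null: "path_homotopic M \<gamma> (\<lambda>_. i base)" if \<gamma>: "\<gamma> \<in> loops M (i base)" for \<gamma>
  proof -
    obtain \<sigma> where \<sigma>: "\<sigma> \<in> loops (top_of_set exterior) base" "path_homotopic M \<gamma> (i \<circ> \<sigma>)"
      using loop_from_exterior[OF \<gamma>] by blast
    have \<sigma>_ext: "\<sigma> t \<in> exterior" if "t \<in> {0..1}" for t
      using \<sigma>(1) that unfolding loops_def pathin_def continuous_map_in_subtopology by auto
    \<comment> \<open>Read in the knot complement, \<sigma> represents an element of the knot group,
      and \<open>f\<close> agrees with \<open>i\<close> along it. In this way the triviality of the
      homomorphism reaches every loop of \<open>M\<close>.\<close>
    have "\<sigma> \<in> loops ?X base"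
      using \<sigma>(1) exterior_subset by (auto simp: loops_def pathin_def)
    then have "path_homotopic M (f \<circ> \<sigma>) (\<lambda>_. i base)" by (rule dead)
    moreover have "path_homotopic M (i \<circ> \<sigma>) (f \<circ> \<sigma>)"
      using path_homotopic_pathin(2)[OF \<sigma>(2)] by (rule path_homotopic_eq) (simp add: f_ext \<sigma>_ext)
    ultimately show ?thesis using path_homotopic_trans \<sigma>(2) by blast
  qed
  have "carrier ?H = {\<one>\<^bsub>?H\<^esub>}"
  proof -
    have "loop_class M y \<eta> = loop_class M y (\<lambda>_. y)" if \<eta>: "\<eta> \<in> loops M y" for \<eta>
    proof (rule loop_class_eqI[OF _ \<eta>])
      have R: "pathin M (rev_path \<delta>)" "rev_path \<delta> 0 = y" "rev_path \<delta> 1 = i base"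
        using \<delta> by (simp_all add: pathin_rev_path)
      show "path_homotopic M \<eta> (\<lambda>_. y)"
        using null[OF conj_path_in_loops[OF \<eta> R]] null_homotopic_conj_iff[OF \<eta> R] by blast
    qed
    then have "loop_class M y ` loops M y = {loop_class M y (\<lambda>_. y)}"
      using const_loop[OF y] by blast
    then show ?thesis unfolding fundamental_group_carrier fundamental_group_one .
  qed
  then show False using LO unfolding left_orderable_def by blast
qed

end

theorem theorem4p1:
  fixes K :: "(real^4) set" and p q :: int and M :: "'m topology" and y :: 'm
  assumes "knot K"
    and "\<not> trivial_knot K"
    and "property_D K"
    and "q > 0" and "coprime p q"
    and "real_of_int p / real_of_int q \<ge> 2 * real (seifert_genus K) - 1"
    and "dehn_surgery K p q M"
    and "y \<in> topspace M"
  shows "\<not> left_orderable (fundamental_group M y)"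
proof -
  obtain N h k i j where N: "preferred_nbhd K N"
    and hk: "homeomorphism (circle \<times> circle) (N ` (circle \<times> circle)) h k"
    and slope: "h ` ({1} \<times> circle) = slope_curve N p q"
    and ij: "inj_on i (knot_exterior N)" "inj_on j (circle \<times> cball 0 1)"
      "topspace M = i ` knot_exterior N \<union> j ` (circle \<times> cball 0 1)"
      "\<forall>x\<in>knot_exterior N. \<forall>y\<in>circle \<times> cball 0 1. i x = j y \<longleftrightarrow> y \<in> circle \<times> circle \<and> x = h y"
      "\<forall>W\<subseteq>topspace M. openin M W \<longleftrightarrow>
         openin (top_of_set (knot_exterior N)) {x \<in> knot_exterior N. i x \<in> W} \<and>
         openin (top_of_set (circle \<times> cball 0 1)) {y \<in> circle \<times> cball 0 1. j y \<in> W}"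
    using assms(7) unfolding dehn_surgery_def glued_space_def topspace_euclidean_subtopology
    by (elim exE conjE) rule
  interpret solid_torus_embedding K N
    using N by unfold_locales (simp add: preferred_nbhd_def)
  interpret surgery K N p q h k M i j
  proof (unfold_locales, unfold exterior_def)
    show "i x = j v \<longleftrightarrow> v \<in> circle \<times> circle \<and> x = h v"
      if "x \<in> knot_exterior N" "v \<in> circle \<times> cball 0 1" for x v
      using ij(4) that by blast
    show "openin M W \<longleftrightarrow>
        openin (top_of_set (knot_exterior N)) {x \<in> knot_exterior N. i x \<in> W} \<and>
        openin (top_of_set (circle \<times> cball 0 1)) {v \<in> circle \<times> cball 0 1. j v \<in> W}"
      if "W \<subseteq> topspace M" for W
      using ij(5) that by blast
  qed (rule hk slope ij)+
  let ?c = "2 * int (seifert_genus K) - 1"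
  have "real_of_int (?c * q) \<le> real_of_int p"
    using assms(4,6) by (simp add: pos_le_divide_eq)
  then have "?c * q \<le> p" by linarith
  \<comment> \<open>Property (D) is stated for every preferred neighbourhood, so it holds for the
    very \<open>N\<close> used in the surgery.\<close>
  then show ?thesis
    using assms(3,4,8) N unfolding property_D_def Let_def
    by (intro surgery_group_not_left_orderable) blast+
qed

end
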